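(* Let $\mathcal A$ be a semisimple stable autonomous tensor category over a field $K$, with finite set $\Sigma$ of representative simple objects, and let $Q(P)\in K$ be defined as in the context. For an object $b\in\Sigma$ and $k\ge1$ let $\rho_{\mathbf 1}[b^k]$ be the representation of the symmetric group $\mathbf S_k$ on $F(\mathbf 1,b^k)=\mathrm{Hom}_{\mathcal A}(\mathbf 1,b^k)$ given by permuting the tensor factors of $b^k$, and let $\mathtt{Trace}$ denote the usual trace. Then: (a) for every integer $k\ge1$, $Q(\langle x\mid x^k\rangle)=\sum_{b\in\Sigma}r(b)\,\mathtt{Trace}\big[\rho_{\mathbf 1}[b^k](1,2,3,\dots,k)\big]$; in particular $Q(\langle x\mid x^2\rangle)=\sum_{b\in\Sigma,\;b=b^*}r(b)$; (b) for every $n\ge1$, for the standard presentation of the fundamental group of the closed orientable surface of genus $n$, $Q\big(\langle x_1,x_2,\dots,x_{2n}\mid\prod_{j=1}^{n}x_{2j-1}x_{2j}x_{2j-1}^{-1}x_{2j}^{-1}\rangle\big)=\sum_{b\in\Sigma}r(b)^{-2(n-1)}$; (c) $Q(\langle x,y\mid xyxy^{-1}x^{-1}y^{-1}\rangle)=\sum_{b\in\Sigma,\;b=b^*}\mathtt{Trace}\big[\rho_{\mathbf 1}[b^3](1,2,3)\big]$; (d) $Q(\langle x,y\mid xyx^{-1}y\rangle)=|\{b\in\Sigma\mid b=b^*\}|$ (as an element of $K$).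
   Context: **Category.** $\mathcal A$ is a symmetric monoidal category (product $\diamond$, also written as juxtaposition; unit $\mathbf 1$; symmetry $\gamma_{A,B}:AB\to BA$ with $\gamma_{B,A}\gamma_{A,B}=\mathrm{id}$). It is *autonomous*: each object $A$ has an assigned object $A^*$ and morphisms $\Lambda_A:\mathbf 1\to A^*A$, $\lambda_A:AA^*\to\mathbf 1$ satisfying the two zig-zag identities. It is *stable*: $(A^* )^*=A$ and $\gamma_{A^*,A}\circ\Lambda_A=\Lambda_{A^*}$ for all $A$. It is *semisimple* over the field $K$: it is abelian and $K$-linear (with $\diamond$ bilinear), and there is a finite set of objects $\Sigma$ such that every object is isomorphic to a finite direct sum of objects of $\Sigma$ and, for $a,b\in\Sigma$, $\mathrm{Hom}(a,b)=0$ if $a\ne b$ and $\mathrm{Hom}(a,a)=K\cdot\mathrm{id}_a$. Moreover $\mathbf 1\in\Sigma$ and $\Sigma$ is closed under $*$. Write $F(A,B)=\mathrm{Hom}_{\mathcal A}(A,B)$ and identify $F(\mathbf 1,\mathbf 1)=K$. Associativity and unit isomorphisms are suppressed; iterated products are bracketed from the left. A *permutation* of tensor factors means the canonical isomorphism built from associativity, unit and symmetry isomorphisms. The *rank* of $A$ is $r(A)=\lambda_{A^*}\circ\Lambda_A\in K$ (nonzero for $A\in\Sigma$). Empty products are $\mathbf 1$. **Dual bases and partial trace.** For $a\in\Sigma$ and an object $A$, a basis $\{\epsilon_i\}$ of $F(a,A)$ has a dual basis $\{\epsilon_i^*\}$ of $F(A,a)$ with $\epsilon_i^*\circ\epsilon_j=\delta_{ij}\,\mathrm{id}_a$.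 For $\phi:A_1\diamond\dots\diamond A_l\to A_1\diamond\dots\diamond A_l$ and $a\in\Sigma$, $\mathrm{Tr}_{A_k\to a}(\phi)=\sum_i(\mathrm{id}\diamond\epsilon_i^*\diamond\mathrm{id})\circ\phi\circ(\mathrm{id}\diamond\epsilon_i\diamond\mathrm{id})$ with $\{\epsilon_i\}$ a basis of $F(a,A_k)$ inserted in the $k$-th factor; it is independent of the basis. Partial traces over different factors commute, and $\mathrm{Tr}_{\{A_k\to a_k\}_k}$ denotes their composite. **The morphisms $f(b,l)$.** For $b\in\Sigma$ and a nonzero integer $l$, $b^l$ denotes the $l$-fold product of $b$ if $l>0$, and the $|l|$-fold product of $b^*$ if $l<0$. Define $f(b,l):b\diamond b^l\to b^l\diamond b$: if $l>0$ it is the identity of $b^{l+1}$ (up to reassociation); if $l=-m<0$, it contracts the initial $b$ with the last ($m$-th) factor $b^*$ of the source by $\lambda_b$, sends the $j$-th factor $b^*$ of the source identically to the $(j+1)$-st factor $b^*$ of the target ($1\le j\le m-1$), and creates the first factor $b^*$ and the final $b$ of the target by $\Lambda_b$. **Definition of $Q(P)$ for one relator.** Let $P=\langle x_1,\dots,x_n\mid R\rangle$ with $R=x_{i_1}^{l_1}\cdots x_{i_s}^{l_s}$, $l_r$ nonzero integers. For $b\in\Sigma$ put $R(b)=b^{l_1}\diamond\dots\diamond b^{l_s}$. Let $[R,b]^o:b\diamond R(b)\to R(b)\diamond b$ be the composite that moves $b$ successively past $b^{l_1},\dots,b^{l_s}$ using $f(b,l_1),\dots,f(b,l_s)$. Let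 $[R,b]:R(b)\to R(b)$ be $r(b)$ times the closure of $[R,b]^o$ over $b$, where the closure is the composite $R(b)\xrightarrow{\Lambda_b\diamond\mathrm{id}}b^*bR(b)\xrightarrow{\mathrm{id}\diamond(\gamma_{R(b),b}\circ[R,b]^o)}b^*bR(b)\xrightarrow{\lambda_{b^*}\diamond\mathrm{id}}R(b)$. Let $g_k(R,b)$ be the product, in order, of those $b^{l_r}$ with $x_{i_r}=x_k$, and let $\kappa(R):R(b)\to g_1(R,b)\diamond\dots\diamond g_n(R,b)$ be the permutation grouping the factors according to generators. Then $$Q(P)=\sum_{b\in\Sigma}\mathrm{Tr}_{\{g_k(R,b)\to\mathbf 1\}_{k=1}^n}\big(\kappa(R)\circ[R,b]\circ\kappa(R)^{-1}\big)\in K.$$ *)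

theory Defs
  imports Complex_Main "HOL-Combinatorics.Cycles"
begin

section \<open>Semisimple stable autonomous tensor categories\<close>

text \<open>
  Every element of the type \<open>'o\<close> is an object. All hom-sets are subsets of one type \<open>'m\<close>,
  which carries the \<open>K\<close>-vector space structure, and each hom-set is a linear subspace.
  This is no restriction on the category: one may take the direct sum of all hom-spaces as
  ambient space, and hom-sets are not required to be disjoint (they all share \<open>0\<close>).
  Composition \<open>g \<cdot> f\<close> and tensor product \<open>f \<otimes> g\<close> are only constrained on arguments from the
  appropriate hom-sets.
\<close>

record ('o, 'm, 'k) tensor_category =
  Hom :: "'o \<Rightarrow> 'o \<Rightarrow> 'm set"
  cmp :: "'m \<Rightarrow> 'm \<Rightarrow> 'm" (infixl "\<cdot>\<index>" 70)
  idm :: "'o \<Rightarrow> 'm"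
  scal :: "'k \<Rightarrow> 'm \<Rightarrow> 'm" (infixr "\<odot>\<index>" 75)
  tobj :: "'o \<Rightarrow> 'o \<Rightarrow> 'o" (infixl "\<diamondop>\<index>" 80)
  tmor :: "'m \<Rightarrow> 'm \<Rightarrow> 'm" (infixl "\<otimes>\<index>" 80)
  uno :: "'o" ("\<one>\<index>")
  assoc :: "'o \<Rightarrow> 'o \<Rightarrow> 'o \<Rightarrow> 'm" ("\<alpha>\<index>")
  lunit :: "'o \<Rightarrow> 'm" ("\<l>\<index>")
  runit :: "'o \<Rightarrow> 'm" ("\<r>\<index>")
  symm :: "'o \<Rightarrow> 'o \<Rightarrow> 'm" ("\<gamma>\<index>")
  dual :: "'o \<Rightarrow> 'o"
  coev :: "'o \<Rightarrow> 'm" ("\<Lambda>\<index>")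
  eval :: "'o \<Rightarrow> 'm" ("\<epsilon>\<index>")

text \<open>
  \<open>coev A : \<one> \<rightarrow> A* A\<close> is \<open>\<Lambda>\<^sub>A\<close>, and \<open>eval A : A A* \<rightarrow> \<one>\<close> is the morphism usually written with a
  lower case lambda.
\<close>

context
  fixes C :: "('o, 'm::ab_group_add, 'k::field) tensor_category" (structure)
begin

definition inverse_pair :: "'o \<Rightarrow> 'o \<Rightarrow> 'm \<Rightarrow> 'm \<Rightarrow> bool" where
  "inverse_pair A B f g \<longleftrightarrow>
     f \<in> Hom C A B \<and> g \<in> Hom C B A \<and> g \<cdot> f = idm C A \<and> f \<cdot> g = idm C B"

definition iso_mor :: "'o \<Rightarrow> 'o \<Rightarrow> 'm \<Rightarrow> bool" where
  "iso_mor A B f \<longleftrightarrow> (\<exists>g. inverse_pair A B f g)"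

definition inv_mor :: "'o \<Rightarrow> 'o \<Rightarrow> 'm \<Rightarrow> 'm" where
  "inv_mor A B f = (THE g. inverse_pair A B f g)"

definition isomorphic :: "'o \<Rightarrow> 'o \<Rightarrow> bool" where
  "isomorphic A B \<longleftrightarrow> (\<exists>f. iso_mor A B f)"

definition monic :: "'o \<Rightarrow> 'o \<Rightarrow> 'm \<Rightarrow> bool" where
  "monic A B f \<longleftrightarrow> f \<in> Hom C A B \<and>
     (\<forall>X. \<forall>u\<in>Hom C X A. \<forall>v\<in>Hom C X A. f \<cdot> u = f \<cdot> v \<longrightarrow> u = v)"

definition epic :: "'o \<Rightarrow> 'o \<Rightarrow> 'm \<Rightarrow> bool" where
  "epic A B f \<longleftrightarrow> f \<in> Hom C A B \<and>
     (\<forall>X. \<forall>u\<in>Hom C B X. \<forall>v\<in>Hom C B X. u \<cdot> f = v \<cdot> f \<longrightarrow> u = v)"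

definition is_kernel :: "'o \<Rightarrow> 'o \<Rightarrow> 'm \<Rightarrow> 'o \<Rightarrow> 'm \<Rightarrow> bool" where
  "is_kernel A B f N k \<longleftrightarrow> k \<in> Hom C N A \<and> f \<cdot> k = 0 \<and>
     (\<forall>X. \<forall>u\<in>Hom C X A. f \<cdot> u = 0 \<longrightarrow> (\<exists>!v. v \<in> Hom C X N \<and> k \<cdot> v = u))"

definition is_cokernel :: "'o \<Rightarrow> 'o \<Rightarrow> 'm \<Rightarrow> 'o \<Rightarrow> 'm \<Rightarrow> bool" where
  "is_cokernel A B f N q \<longleftrightarrow> q \<in> Hom C B N \<and> q \<cdot> f = 0 \<and>
     (\<forall>X. \<forall>u\<in>Hom C B X. u \<cdot> f = 0 \<longrightarrow> (\<exists>!v. v \<in> Hom C N X \<and> v \<cdot> q = u))"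

text \<open>For the empty list this says that \<open>D\<close> is a zero object.\<close>

definition direct_sum :: "'o \<Rightarrow> 'o list \<Rightarrow> (nat \<Rightarrow> 'm) \<Rightarrow> (nat \<Rightarrow> 'm) \<Rightarrow> bool" where
  "direct_sum D As \<iota> \<pi> \<longleftrightarrow>
     (\<forall>i<length As. \<iota> i \<in> Hom C (As ! i) D \<and> \<pi> i \<in> Hom C D (As ! i)) \<and>
     (\<forall>i<length As. \<forall>j<length As. \<pi> i \<cdot> \<iota> j = (if i = j then idm C (As ! i) else 0)) \<and>
     (\<Sum>i<length As. \<iota> i \<cdot> \<pi> i) = idm C D"

end

locale tcategory =
  fixes C :: "('o, 'm::ab_group_add, 'k::field) tensor_category" (structure)
  assumes id_in_Hom: "idm C A \<in> Hom C A A"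
    and cmp_in_Hom: "\<lbrakk>f \<in> Hom C A B; g \<in> Hom C B D\<rbrakk> \<Longrightarrow> g \<cdot> f \<in> Hom C A D"
    and cmp_id_right: "f \<in> Hom C A B \<Longrightarrow> f \<cdot> idm C A = f"
    and cmp_id_left: "f \<in> Hom C A B \<Longrightarrow> idm C B \<cdot> f = f"
    and cmp_assoc: "\<lbrakk>f \<in> Hom C A B; g \<in> Hom C B D; h \<in> Hom C D E\<rbrakk>
          \<Longrightarrow> (h \<cdot> g) \<cdot> f = h \<cdot> (g \<cdot> f)"

locale symmetric_monoidal_category = tcategory +
  assumes tensor_in_Hom: "\<lbrakk>f \<in> Hom C A A'; g \<in> Hom C B B'\<rbrakk>
          \<Longrightarrow> f \<otimes> g \<in> Hom C (A \<diamondop> B) (A' \<diamondop> B')"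
    and tensor_id: "idm C A \<otimes> idm C B = idm C (A \<diamondop> B)"
    and tensor_cmp: "\<lbrakk>f \<in> Hom C A A'; f' \<in> Hom C A' A''; g \<in> Hom C B B'; g' \<in> Hom C B' B''\<rbrakk>
          \<Longrightarrow> (f' \<cdot> f) \<otimes> (g' \<cdot> g) = (f' \<otimes> g') \<cdot> (f \<otimes> g)"
    and assoc_iso: "iso_mor C (A \<diamondop> B \<diamondop> D) (A \<diamondop> (B \<diamondop> D)) (\<alpha> A B D)"
    and assoc_natural: "\<lbrakk>f \<in> Hom C A A'; g \<in> Hom C B B'; h \<in> Hom C D D'\<rbrakk>
          \<Longrightarrow> \<alpha> A' B' D' \<cdot> (f \<otimes> g \<otimes> h) = (f \<otimes> (g \<otimes> h)) \<cdot> \<alpha> A B D"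
    and lunit_iso: "iso_mor C (\<one> \<diamondop> A) A (\<l> A)"
    and lunit_natural: "f \<in> Hom C A B \<Longrightarrow> \<l> B \<cdot> (idm C \<one> \<otimes> f) = f \<cdot> \<l> A"
    and runit_iso: "iso_mor C (A \<diamondop> \<one>) A (\<r> A)"
    and runit_natural: "f \<in> Hom C A B \<Longrightarrow> \<r> B \<cdot> (f \<otimes> idm C \<one>) = f \<cdot> \<r> A"
    and pentagon: "\<alpha> A B (D \<diamondop> E) \<cdot> \<alpha> (A \<diamondop> B) D E
          = (idm C A \<otimes> \<alpha> B D E) \<cdot> \<alpha> A (B \<diamondop> D) E \<cdot> (\<alpha> A B D \<otimes> idm C E)"
    and triangle: "(idm C A \<otimes> \<l> B) \<cdot> \<alpha> A \<one> B = \<r> A \<otimes> idm C B"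
    and symm_in_Hom: "\<gamma> A B \<in> Hom C (A \<diamondop> B) (B \<diamondop> A)"
    and symm_natural: "\<lbrakk>f \<in> Hom C A A'; g \<in> Hom C B B'\<rbrakk>
          \<Longrightarrow> \<gamma> A' B' \<cdot> (f \<otimes> g) = (g \<otimes> f) \<cdot> \<gamma> A B"
    and symm_symm: "\<gamma> B A \<cdot> \<gamma> A B = idm C (A \<diamondop> B)"
    and hexagon: "\<alpha> B D A \<cdot> \<gamma> A (B \<diamondop> D) \<cdot> \<alpha> A B D
          = (idm C B \<otimes> \<gamma> A D) \<cdot> \<alpha> B A D \<cdot> (\<gamma> A B \<otimes> idm C D)"

locale autonomous_category = symmetric_monoidal_category +
  assumes coev_in_Hom: "\<Lambda> A \<in> Hom C \<one> (dual C A \<diamondop> A)"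
    and eval_in_Hom: "\<epsilon> A \<in> Hom C (A \<diamondop> dual C A) \<one>"
    and zigzag: "\<l> A \<cdot> (\<epsilon> A \<otimes> idm C A) \<cdot> inv_mor C (A \<diamondop> dual C A \<diamondop> A) (A \<diamondop> (dual C A \<diamondop> A))
            (\<alpha> A (dual C A) A) \<cdot> (idm C A \<otimes> \<Lambda> A) \<cdot> inv_mor C (A \<diamondop> \<one>) A (\<r> A) = idm C A"
    and zigzag_dual: "\<r> (dual C A) \<cdot> (idm C (dual C A) \<otimes> \<epsilon> A) \<cdot> \<alpha> (dual C A) A (dual C A)
            \<cdot> (\<Lambda> A \<otimes> idm C (dual C A)) \<cdot> inv_mor C (\<one> \<diamondop> dual C A) (dual C A) (\<l> (dual C A))
          = idm C (dual C A)"

locale stable_autonomous_category = autonomous_category +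
  assumes dual_dual: "dual C (dual C A) = A"
    and symm_coev: "\<gamma> (dual C A) A \<cdot> \<Lambda> A = \<Lambda> (dual C A)"

locale linear_category = tcategory C + vector_space "scal C"
  for C :: "('o, 'm::ab_group_add, 'k::field) tensor_category" (structure) +
  assumes Hom_subspace: "subspace (Hom C A B)"
    and cmp_add_left: "\<lbrakk>f \<in> Hom C A B; g \<in> Hom C B D; g' \<in> Hom C B D\<rbrakk>
          \<Longrightarrow> (g + g') \<cdot> f = g \<cdot> f + g' \<cdot> f"
    and cmp_add_right: "\<lbrakk>f \<in> Hom C A B; f' \<in> Hom C A B; g \<in> Hom C B D\<rbrakk>
          \<Longrightarrow> g \<cdot> (f + f') = g \<cdot> f + g \<cdot> f'"
    and cmp_scal_left: "\<lbrakk>f \<in> Hom C A B; g \<in> Hom C B D\<rbrakk> \<Longrightarrow> (c \<odot> g) \<cdot> f = c \<odot> (g \<cdot> f)"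
    and cmp_scal_right: "\<lbrakk>f \<in> Hom C A B; g \<in> Hom C B D\<rbrakk> \<Longrightarrow> g \<cdot> (c \<odot> f) = c \<odot> (g \<cdot> f)"

locale abelian_linear_category = linear_category +
  assumes direct_sums: "\<exists>D \<iota> \<pi>. direct_sum C D As \<iota> \<pi>"
    and kernels: "f \<in> Hom C A B \<Longrightarrow> \<exists>N k. is_kernel C A B f N k"
    and cokernels: "f \<in> Hom C A B \<Longrightarrow> \<exists>N q. is_cokernel C A B f N q"
    and monic_normal: "monic C A B f \<Longrightarrow> \<exists>D g. g \<in> Hom C B D \<and> is_kernel C B D g A f"
    and epic_normal: "epic C A B f \<Longrightarrow> \<exists>D g. g \<in> Hom C D A \<and> is_cokernel C D A g B f"

locale semisimple_stable_autonomous_category =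
  stable_autonomous_category C + abelian_linear_category C
  for C :: "('o, 'm::ab_group_add, 'k::field) tensor_category" (structure)
    and S :: "'o set" +
  assumes tensor_add_left: "\<lbrakk>f \<in> Hom C A A'; f' \<in> Hom C A A'; g \<in> Hom C B B'\<rbrakk>
          \<Longrightarrow> (f + f') \<otimes> g = f \<otimes> g + f' \<otimes> g"
    and tensor_add_right: "\<lbrakk>f \<in> Hom C A A'; g \<in> Hom C B B'; g' \<in> Hom C B B'\<rbrakk>
          \<Longrightarrow> f \<otimes> (g + g') = f \<otimes> g + f \<otimes> g'"
    and tensor_scal_left: "\<lbrakk>f \<in> Hom C A A'; g \<in> Hom C B B'\<rbrakk>
          \<Longrightarrow> (c \<odot> f) \<otimes> g = c \<odot> (f \<otimes> g)"
    and tensor_scal_right: "\<lbrakk>f \<in> Hom C A A'; g \<in> Hom C B B'\<rbrakk>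
          \<Longrightarrow> f \<otimes> (c \<odot> g) = c \<odot> (f \<otimes> g)"
    and finite_simples: "finite S"
    and semisimple: "\<exists>D as \<iota> \<pi>. set as \<subseteq> S \<and> direct_sum C D as \<iota> \<pi> \<and> isomorphic C A D"
    and Hom_distinct: "\<lbrakk>a \<in> S; b \<in> S; a \<noteq> b\<rbrakk> \<Longrightarrow> Hom C a b = {0}"
    and Hom_same: "a \<in> S \<Longrightarrow> Hom C a a = range (\<lambda>c. c \<odot> idm C a)"
    and id_nonzero: "a \<in> S \<Longrightarrow> idm C a \<noteq> 0"
    and uno_in: "\<one> \<in> S"
    and dual_in: "a \<in> S \<Longrightarrow> dual C a \<in> S"


section \<open>Linear algebra\<close>

text \<open>The trace of an endomorphism of a finite-dimensional subspace of a vector space.\<close>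

definition trace_on :: "('k::field \<Rightarrow> 'm::ab_group_add \<Rightarrow> 'm) \<Rightarrow> 'm set \<Rightarrow> ('m \<Rightarrow> 'm) \<Rightarrow> 'k" where
  "trace_on scl W \<phi> =
     (let B = SOME B. \<not> module.dependent scl B \<and> module.span scl B = W
      in \<Sum>v\<in>B. module.representation scl B (\<phi> v) v)"


section \<open>Morphisms between iterated products\<close>

text \<open>
  To make precise the convention that associativity and unit isomorphisms are suppressed, the
  diagrams below are written with \<^emph>\<open>word morphisms\<close>: a word is a list of objects, standing for its
  product bracketed from the left, and a word morphism consists of two words and a morphism
  between their products. The isomorphisms \<open>join\<close> rebracket after concatenating words.
\<close>

datatype ('o, 'm) wmor = WMor (wsrc: "'o list") (wtgt: "'o list") (wmor: 'm)

context
  fixes C :: "('o, 'm::ab_group_add, 'k::field) tensor_category" (structure)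
begin

fun oprod :: "'o list \<Rightarrow> 'o" where
  "oprod [] = \<one>"
| "oprod (A # As) = foldl (\<diamondop>) A As"

text \<open>\<open>join As Bs : oprod As \<diamondop> oprod Bs \<rightarrow> oprod (As @ Bs)\<close>\<close>

function join :: "'o list \<Rightarrow> 'o list \<Rightarrow> 'm" where
  "join [] Bs = \<l> (oprod Bs)"
| "join (A # As) [] = \<r> (oprod (A # As))"
| "join (A # As) [B] = idm C (oprod (A # As) \<diamondop> B)"
| "join (A # As) ((B' # Bs) @ [B]) = (join (A # As) (B' # Bs) \<otimes> idm C B)
     \<cdot> inv_mor C (oprod (A # As) \<diamondop> oprod (B' # Bs) \<diamondop> B) (oprod (A # As) \<diamondop> (oprod (B' # Bs) \<diamondop> B))
         (\<alpha> (oprod (A # As)) (oprod (B' # Bs)) B)"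
  by (auto, metis append_Cons append_Nil list.exhaust rev_exhaust)
termination by (relation "measure (\<lambda>(As, Bs). length Bs)") auto

definition unjoin :: "'o list \<Rightarrow> 'o list \<Rightarrow> 'm" where
  "unjoin As Bs = inv_mor C (oprod As \<diamondop> oprod Bs) (oprod (As @ Bs)) (join As Bs)"

definition wid :: "'o list \<Rightarrow> ('o, 'm) wmor" where
  "wid As = WMor As As (idm C (oprod As))"

definition wcomp :: "('o, 'm) wmor \<Rightarrow> ('o, 'm) wmor \<Rightarrow> ('o, 'm) wmor" (infixl "\<bullet>" 55) where
  "g \<bullet> f = WMor (wsrc f) (wtgt g) (wmor g \<cdot> wmor f)"

definition wtensor :: "('o, 'm) wmor \<Rightarrow> ('o, 'm) wmor \<Rightarrow> ('o, 'm) wmor" (infixl "\<boxtimes>" 60) where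
  "f \<boxtimes> g = WMor (wsrc f @ wsrc g) (wtgt f @ wtgt g)
     (join (wtgt f) (wtgt g) \<cdot> (wmor f \<otimes> wmor g) \<cdot> unjoin (wsrc f) (wsrc g))"

definition wsymm :: "'o list \<Rightarrow> 'o list \<Rightarrow> ('o, 'm) wmor" where
  "wsymm As Bs = WMor (As @ Bs) (Bs @ As)
     (join Bs As \<cdot> \<gamma> (oprod As) (oprod Bs) \<cdot> unjoin As Bs)"

definition wcoev :: "'o \<Rightarrow> ('o, 'm) wmor" where
  "wcoev A = WMor [] [dual C A, A] (\<Lambda> A)"

definition weval :: "'o \<Rightarrow> ('o, 'm) wmor" where
  "weval A = WMor [A, dual C A] [] (\<epsilon> A)"

definition wscal :: "'k \<Rightarrow> ('o, 'm) wmor \<Rightarrow> ('o, 'm) wmor" where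
  "wscal c f = WMor (wsrc f) (wtgt f) (c \<odot> wmor f)"

definition winv :: "('o, 'm) wmor \<Rightarrow> ('o, 'm) wmor" where
  "winv f = WMor (wtgt f) (wsrc f) (inv_mor C (oprod (wsrc f)) (oprod (wtgt f)) (wmor f))"

text \<open>
  The permutation isomorphism that rearranges a product of blocks \<open>Ws\<close>. The second argument lists
  the positions of the source blocks (counted from \<open>0\<close>) in the order in which they appear in the
  target: \<open>wperm Ws ps : concat Ws \<rightarrow> concat (map ((!) Ws) ps)\<close>, provided \<open>ps\<close> is a rearrangement of
  \<open>[0..<length Ws]\<close>. Block number \<open>p = hd ps\<close> is moved to the front, and the others
  are then permuted among themselves.
\<close>

fun wperm :: "'o list list \<Rightarrow> nat list \<Rightarrow> ('o, 'm) wmor" where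
  "wperm Ws [] = wid []"
| "wperm Ws (p # ps) =
     (wid (Ws ! p) \<boxtimes> wperm (take p Ws @ drop (Suc p) Ws) (map (\<lambda>q. if p < q then q - 1 else q) ps))
     \<bullet> (wsymm (concat (take p Ws)) (Ws ! p) \<boxtimes> wid (concat (drop (Suc p) Ws)))"


section \<open>Rank, partial traces and permutation representations\<close>

text \<open>The identification of \<open>Hom(\<one>,\<one>)\<close> with \<open>K\<close>.\<close>

definition scalar_of :: "'m \<Rightarrow> 'k" where
  "scalar_of f = (THE c. f = c \<odot> idm C \<one>)"

definition rank :: "'o \<Rightarrow> 'k" where
  "rank A = scalar_of (\<epsilon> (dual C A) \<cdot> \<Lambda> A)"

text \<open>\<open>d\<close> assigns to each element of the basis \<open>E\<close> of \<open>Hom(a,A)\<close> its dual in \<open>Hom(A,a)\<close>.\<close>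

definition dual_bases :: "'o \<Rightarrow> 'o \<Rightarrow> 'm set \<Rightarrow> ('m \<Rightarrow> 'm) \<Rightarrow> bool" where
  "dual_bases a A E d \<longleftrightarrow>
     \<not> module.dependent (scal C) E \<and> module.span (scal C) E = Hom C a A \<and>
     \<not> module.dependent (scal C) (d ` E) \<and> module.span (scal C) (d ` E) = Hom C A a \<and>
     (\<forall>e\<in>E. \<forall>e'\<in>E. d e \<cdot> e' = (if e = e' then idm C a else 0))"

text \<open>
  For an endomorphism \<open>\<phi>\<close> of \<open>X @ G @ Y\<close>, its partial trace over the factor \<open>G\<close> to
  the simple object \<open>oprod w\<close>; the word \<open>w\<close> is \<open>[a]\<close>, or \<open>[]\<close> for the unit object.
\<close>

definition partial_trace ::
  "'o list \<Rightarrow> 'o list \<Rightarrow> 'o list \<Rightarrow> 'o list \<Rightarrow> ('o, 'm) wmor \<Rightarrow> ('o, 'm) wmor" where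
  "partial_trace X G Y w \<phi> =
     (let (E, d) = (SOME (E, d). dual_bases (oprod w) (oprod G) E d)
      in WMor (X @ w @ Y) (X @ w @ Y)
           (\<Sum>e\<in>E. wmor ((wid X \<boxtimes> WMor G w (d e) \<boxtimes> wid Y) \<bullet> \<phi> \<bullet> (wid X \<boxtimes> WMor w G e \<boxtimes> wid Y))))"

text \<open>
  The composite of the partial traces to \<open>\<one>\<close> over all factors of \<open>concat Gs\<close>; the result is
  a morphism from the empty word to itself, that is, an element of \<open>Hom(\<one>,\<one>)\<close>.
\<close>

fun full_trace :: "'o list list \<Rightarrow> ('o, 'm) wmor \<Rightarrow> ('o, 'm) wmor" where
  "full_trace [] \<phi> = \<phi>"
| "full_trace (G # Gs) \<phi> = full_trace Gs (partial_trace [] G (concat Gs) [] \<phi>)"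

text \<open>
  For \<open>\<sigma>\<close> permuting \<open>{1..k}\<close>, the action of \<open>\<sigma>\<close> on \<open>Hom(\<one>,b\<^sup>k)\<close>: it sends the factor in position
  \<open>i\<close> to position \<open>\<sigma> i\<close>, so position \<open>j\<close> of the target is filled from position \<open>\<sigma>\<^sup>-\<^sup>1 j\<close>.
\<close>

definition perm_rep :: "'o \<Rightarrow> nat \<Rightarrow> (nat \<Rightarrow> nat) \<Rightarrow> 'm \<Rightarrow> 'm" where
  "perm_rep b k \<sigma> u =
     wmor (wperm (replicate k [b]) (map (\<lambda>j. inv \<sigma> j - 1) [1..<k + 1])) \<cdot> u"


section \<open>The invariant of a one-relator presentation\<close>

text \<open>
  The relator \<open>x\<^sub>i\<^sub>1^l\<^sub>1 \<dots> x\<^sub>i\<^sub>s^l\<^sub>s\<close> is represented by the list of pairs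
  \<open>[(i\<^sub>1,l\<^sub>1), \<dots>, (i\<^sub>s,l\<^sub>s)]\<close> with \<open>i\<^sub>r\<close> in \<open>{1..n}\<close> and nonzero \<open>l\<^sub>r\<close>; it is not reduced.
\<close>

definition wpower :: "'o \<Rightarrow> int \<Rightarrow> 'o list" where
  "wpower b l = (if l > 0 then replicate (nat l) b else replicate (nat (- l)) (dual C b))"

text \<open>\<open>pass b l : b \<diamondop> b\<^sup>l \<rightarrow> b\<^sup>l \<diamondop> b\<close> is the morphism \<open>f(b,l)\<close>.\<close>

definition pass :: "'o \<Rightarrow> int \<Rightarrow> ('o, 'm) wmor" where
  "pass b l =
     (if l > 0 then wid (replicate (nat l + 1) b)
      else let B = replicate (nat (- l) - 1) (dual C b)
        in (wid [dual C b] \<boxtimes> wsymm [b] B) \<bullet> (wcoev b \<boxtimes> wid B)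
           \<bullet> (wid B \<boxtimes> weval b) \<bullet> (wsymm [b] B \<boxtimes> wid [dual C b]))"

definition blocks :: "'o \<Rightarrow> (nat \<times> int) list \<Rightarrow> 'o list list" where
  "blocks b R = map (\<lambda>(i, l). wpower b l) R"

definition relator_word :: "'o \<Rightarrow> (nat \<times> int) list \<Rightarrow> 'o list" where
  "relator_word b R = concat (blocks b R)"

text \<open>The morphism \<open>[R,b]\<^sup>o : b \<diamondop> R(b) \<rightarrow> R(b) \<diamondop> b\<close>.\<close>

fun open_relator :: "'o \<Rightarrow> (nat \<times> int) list \<Rightarrow> ('o, 'm) wmor" where
  "open_relator b [] = wid [b]"
| "open_relator b ((i, l) # R) =
     (wid (wpower b l) \<boxtimes> open_relator b R) \<bullet> (pass b l \<boxtimes> wid (relator_word b R))"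

definition closed_relator :: "'o \<Rightarrow> (nat \<times> int) list \<Rightarrow> ('o, 'm) wmor" where
  "closed_relator b R = wscal (rank b)
     ((weval (dual C b) \<boxtimes> wid (relator_word b R))
      \<bullet> (wid [dual C b] \<boxtimes> (wsymm (relator_word b R) [b] \<bullet> open_relator b R))
      \<bullet> (wcoev b \<boxtimes> wid (relator_word b R)))"

definition group_word :: "nat \<Rightarrow> (nat \<times> int) list \<Rightarrow> 'o \<Rightarrow> 'o list" where
  "group_word k R b = concat (blocks b (filter (\<lambda>(i, l). i = k) R))"

definition grouping :: "nat \<Rightarrow> (nat \<times> int) list \<Rightarrow> 'o \<Rightarrow> ('o, 'm) wmor" where
  "grouping n R b = wperm (blocks b R)
     (concat (map (\<lambda>k. filter (\<lambda>r. fst (R ! r) = k) [0..<length R]) [1..<n + 1]))"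

text \<open>\<open>Q S n R\<close> is the value for \<open>\<langle>x\<^sub>1, \<dots>, x\<^sub>n | R\<rangle>\<close>, where \<open>S\<close> is the set of simple objects.\<close>

definition Q :: "'o set \<Rightarrow> nat \<Rightarrow> (nat \<times> int) list \<Rightarrow> 'k" where
  "Q S n R = (\<Sum>b\<in>S. scalar_of (wmor
     (full_trace (map (\<lambda>k. group_word k R b) [1..<n + 1])
       (grouping n R b \<bullet> closed_relator b R \<bullet> winv (grouping n R b)))))"

end

end

theory Submission
  imports Defs
begin

text \<open>
  Words and word morphisms form a strict symmetric monoidal category with duals: the rebracketing
  isomorphisms \<open>join\<close> are compatible with the associators (Mac Lane's coherence argument), so string
  diagrams can be computed without associativity and unit isomorphisms.

  A vector \<open>E\<close> and a covector \<open>D\<close> on \<open>R(b)\<close> turn the strand \<open>b\<close> that passes \<open>R(b)\<close> into an endomorphism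
  of \<open>b\<close>, which by Schur's lemma is a scalar \<open>t\<close>, and \<open>D \<circ> [R,b] \<circ> E = r(b)\<^sup>2 t\<close>: one factor \<open>r(b)\<close>
  is the normalisation and one is the value of the closed loop. If every generator occurs in two
  letters only, the spaces \<open>Hom(\<one>, g\<^sub>k)\<close> are zero or spanned by a coevaluation, whose dual is
  the evaluation divided by \<open>r(b)\<close>, and the zig-zag identities straighten the strand; this
  gives \<open>t = r(b)\<^sup>-\<^sup>2\<close> for a commutator and for the Klein bottle, and scalars multiply along a
  product of commutators. For \<open>x\<^sup>k\<close> the strand closes up to the cyclic permutation. For the trefoil
  relator a morphism \<open>b* \<rightarrow> b\<close> splits off the strand, so \<open>b = b*\<close>; then the two scalars that
  remain are matrix coefficients of the transpositions \<open>(1,2)\<close> and \<open>(2,3)\<close>, and summing over dual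
  bases gives the trace of the 3-cycle that is their product.
\<close>

section \<open>Word morphisms as a strict category\<close>

text \<open>Since hom-sets may overlap, every diagram law is conditional on sources and targets;
  carrying words along turns these conditions into equations between lists, which rewriting decides.
  Two choices hide in the statement: a basis in each partial trace and a basis in
  \<open>trace_on\<close>. The summands of a partial trace are bilinear in covector and vector, so
  every pair of dual bases gives the same value, and a convenient pair is substituted: a single
  coevaluation, the empty set, or an unspecified pair that is later summed away. Stability speaks of
  coevaluations only, and it is not assumed that \<open>rank\<close> is nonzero on simple objects.
  The matching law for evaluations follows from the uniqueness of duals, and the non-vanishing
  follows because Schur's lemma leaves no covector on a dual pair except multiples of the
  evaluation.\<close>

context tcategory
begin

notation wcomp (infixl "\<bullet>\<index>" 55)

definition wok :: "('o, 'm) wmor \<Rightarrow> bool" where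
  "wok f \<longleftrightarrow> wmor f \<in> Hom C (oprod C (wsrc f)) (oprod C (wtgt f))"

lemma wcomp_sel [simp]:
  "wsrc (g \<bullet> f) = wsrc f" "wtgt (g \<bullet> f) = wtgt g" "wmor (g \<bullet> f) = wmor g \<cdot> wmor f"
  by (simp_all add: wcomp_def)

lemma wid_sel [simp]:
  "wsrc (wid C X) = X" "wtgt (wid C X) = X" "wmor (wid C X) = idm C (oprod C X)"
  by (simp_all add: wid_def)

lemma wok_wid [simp]: "wok (wid C X)"
  by (simp add: wok_def id_in_Hom)

lemma wok_wcomp [simp]: "\<lbrakk>wok f; wok g; wsrc g = wtgt f\<rbrakk> \<Longrightarrow> wok (g \<bullet> f)"
  by (auto simp: wok_def intro: cmp_in_Hom)

lemma wcomp_assoc [simp]: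
  "\<lbrakk>wok f; wok g; wok h; wsrc g = wtgt f; wsrc h = wtgt g\<rbrakk> \<Longrightarrow> h \<bullet> g \<bullet> f = h \<bullet> (g \<bullet> f)"
  by (auto simp: wok_def wcomp_def intro!: cmp_assoc)

lemma wcomp_wid_left [simp]: "\<lbrakk>wok f; wtgt f = X\<rbrakk> \<Longrightarrow> wid C X \<bullet> f = f"
  by (cases f) (auto simp: wok_def wcomp_def intro!: cmp_id_left)

lemma wcomp_wid_right [simp]: "\<lbrakk>wok f; wsrc f = X\<rbrakk> \<Longrightarrow> f \<bullet> wid C X = f"
  by (cases f) (auto simp: wok_def wcomp_def intro!: cmp_id_right)

text \<open>Composites are normalised to right-nested form, where \<open>g \<bullet> f\<close> is no
  longer a subterm of a longer composite; this variant applies an equation for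
  \<open>g \<bullet> f\<close> there.\<close>

lemma wcomp_reassoc:
  "\<lbrakk>g \<bullet> f = h; wok f; wok g; wok x; wsrc g = wtgt f; wsrc f = wtgt x\<rbrakk> \<Longrightarrow> g \<bullet> (f \<bullet> x) = h \<bullet> x"
  by (metis wcomp_assoc)

lemma wmor_eqI: "\<lbrakk>wsrc f = wsrc g; wtgt f = wtgt g; wmor f = wmor g\<rbrakk> \<Longrightarrow> f = g"
  by (cases f; cases g) simp

lemma inverse_pair_unique:
  assumes "inverse_pair C A B f g" "inverse_pair C A B f h"
  shows "g = h"
proof -
  have "g = g \<cdot> (f \<cdot> h)"
    using assms by (metis inverse_pair_def cmp_id_right)
  also have "\<dots> = (g \<cdot> f) \<cdot> h"
    using assms by (metis inverse_pair_def cmp_assoc)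
  also have "\<dots> = h"
    using assms by (metis inverse_pair_def cmp_id_left)
  finally show ?thesis .
qed

lemma inv_mor_eqI: "inverse_pair C A B f g \<Longrightarrow> inv_mor C A B f = g"
  unfolding inv_mor_def using inverse_pair_unique by blast

lemma inverse_pair_inv_mor: "iso_mor C A B f \<Longrightarrow> inverse_pair C A B f (inv_mor C A B f)"
  by (metis inv_mor_eqI iso_mor_def)

lemma winv_sel [simp]: "wsrc (winv C f) = wtgt f" "wtgt (winv C f) = wsrc f"
  by (simp_all add: winv_def)

lemma inverse_pair_wordI:
  assumes "wok f" "wok g" "wsrc f = wtgt g" "wtgt f = wsrc g" "g \<bullet> f = wid C (wsrc f)"
    "f \<bullet> g = wid C (wsrc g)"
  shows "inverse_pair C (oprod C (wsrc f)) (oprod C (wtgt f)) (wmor f) (wmor g)"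
proof -
  have "wmor g \<cdot> wmor f = idm C (oprod C (wsrc f))"
    using arg_cong[OF assms(5), of wmor] by (simp only: wcomp_sel wid_sel)
  moreover have "wmor f \<cdot> wmor g = idm C (oprod C (wsrc g))"
    using arg_cong[OF assms(6), of wmor] by (simp only: wcomp_sel wid_sel)
  ultimately show ?thesis
    using assms(1-4) by (simp add: inverse_pair_def wok_def)
qed

lemma winv_eqI:
  assumes "wok f" "wok g" "wsrc f = wtgt g" "wtgt f = wsrc g" "g \<bullet> f = wid C (wsrc f)"
    "f \<bullet> g = wid C (wsrc g)"
  shows "winv C f = g"
  using inv_mor_eqI[OF inverse_pair_wordI[OF assms]] assms(3,4) by (cases g) (auto simp: winv_def)

definition wiso :: "('o, 'm) wmor \<Rightarrow> bool" where
  "wiso f \<longleftrightarrow> iso_mor C (oprod C (wsrc f)) (oprod C (wtgt f)) (wmor f)"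

lemma
  assumes "wiso f"
  shows wok_wiso [simp]: "wok f"
    and wok_winv [simp]: "wok (winv C f)"
    and winv_left [simp]: "winv C f \<bullet> f = wid C (wsrc f)"
    and winv_right [simp]: "f \<bullet> winv C f = wid C (wtgt f)"
proof -
  have "inverse_pair C (oprod C (wsrc f)) (oprod C (wtgt f)) (wmor f) (wmor (winv C f))"
    using assms inverse_pair_inv_mor by (simp add: wiso_def winv_def)
  then show "wok f" "wok (winv C f)" "winv C f \<bullet> f = wid C (wsrc f)" "f \<bullet> winv C f = wid C (wtgt f)"
    by (auto simp: wok_def inverse_pair_def intro!: wmor_eqI)
qed

lemma winv_left_assoc [simp]: "\<lbrakk>wiso f; wok x; wtgt x = wsrc f\<rbrakk> \<Longrightarrow> winv C f \<bullet> (f \<bullet> x) = x"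
  by (subst wcomp_reassoc[of _ _ "wid C (wsrc f)"]) auto

lemma winv_right_assoc [simp]: "\<lbrakk>wiso f; wok x; wtgt x = wtgt f\<rbrakk> \<Longrightarrow> f \<bullet> (winv C f \<bullet> x) = x"
  by (subst wcomp_reassoc[of _ _ "wid C (wtgt f)"]) auto

lemma wisoI:
  assumes "wok f" "wok g" "wsrc f = wtgt g" "wtgt f = wsrc g" "g \<bullet> f = wid C (wsrc f)"
    "f \<bullet> g = wid C (wsrc g)"
  shows "wiso f"
  using inverse_pair_wordI[OF assms] by (auto simp: wiso_def iso_mor_def)

lemma wiso_wid [simp]: "wiso (wid C X)"
  by (rule wisoI[of _ "wid C X"]) auto

lemma wiso_winv [simp]: "wiso f \<Longrightarrow> wiso (winv C f)"
  by (rule wisoI[of _ f]) auto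

lemma wiso_wcomp [simp]: "\<lbrakk>wiso f; wiso g; wsrc g = wtgt f\<rbrakk> \<Longrightarrow> wiso (g \<bullet> f)"
  by (rule wisoI[of _ "winv C f \<bullet> winv C g"]) auto

lemma winv_wcomp: "\<lbrakk>wiso f; wiso g; wsrc g = wtgt f\<rbrakk> \<Longrightarrow> winv C (g \<bullet> f) = winv C f \<bullet> winv C g"
  by (rule winv_eqI) auto

lemma winv_wid [simp]: "winv C (wid C X) = wid C X"
  by (rule winv_eqI) auto

lemma winv_winv [simp]: "wiso f \<Longrightarrow> winv C (winv C f) = f"
  by (rule winv_eqI) auto

lemma wcomp_right_cancel:
  assumes "wiso f" "wok g" "wok h" "wsrc g = wtgt f" "wsrc h = wtgt f" "g \<bullet> f = h \<bullet> f"
  shows "g = h"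
proof -
  have "g = (g \<bullet> f) \<bullet> winv C f"
    using assms(1-5) by simp
  also have "\<dots> = h"
    unfolding assms(6) using assms(1-5) by simp
  finally show ?thesis .
qed

lemma wcomp_left_cancel:
  assumes "wiso f" "wok g" "wok h" "wtgt g = wsrc f" "wtgt h = wsrc f" "f \<bullet> g = f \<bullet> h"
  shows "g = h"
proof -
  have "g = winv C f \<bullet> (f \<bullet> g)"
    using assms(1-5) by simp
  also have "\<dots> = h"
    unfolding assms(6) using assms(1-5) by simp
  finally show ?thesis .
qed

end

section \<open>Coherence\<close>

context symmetric_monoidal_category
begin

lemma oprod_snoc [simp]: "X \<noteq> [] \<Longrightarrow> oprod C (X @ [B]) = oprod C X \<diamondop> B"
  by (cases X) auto

text \<open>
  Hom-sets need not be disjoint, so a morphism does not determine its source and target. Recording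
  them, with a word serving as a name for its product, lets the simplifier check composability.
\<close>

definition ntensor (infixl "\<odot>\<odot>" 60) where
  "f \<odot>\<odot> g = WMor [oprod C (wsrc f) \<diamondop> oprod C (wsrc g)] [oprod C (wtgt f) \<diamondop> oprod C (wtgt g)]
     (wmor f \<otimes> wmor g)"

lemma ntensor_sel [simp]:
  "wsrc (f \<odot>\<odot> g) = [oprod C (wsrc f) \<diamondop> oprod C (wsrc g)]"
  "wtgt (f \<odot>\<odot> g) = [oprod C (wtgt f) \<diamondop> oprod C (wtgt g)]"
  "wmor (f \<odot>\<odot> g) = wmor f \<otimes> wmor g"
  by (simp_all add: ntensor_def)

lemma wok_ntensor [simp]: "\<lbrakk>wok f; wok g\<rbrakk> \<Longrightarrow> wok (f \<odot>\<odot> g)"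
  by (simp add: wok_def tensor_in_Hom)

lemma ntensor_wcomp:
  "\<lbrakk>wok f; wok f'; wok g; wok g'; wsrc f' = wtgt f; wsrc g' = wtgt g\<rbrakk>
   \<Longrightarrow> (f' \<odot>\<odot> g') \<bullet> (f \<odot>\<odot> g) = (f' \<bullet> f) \<odot>\<odot> (g' \<bullet> g)"
  by (rule wmor_eqI) (auto simp: wok_def tensor_cmp)

lemma ntensor_wcomp_assoc:
  "\<lbrakk>wok f; wok f'; wok g; wok g'; wsrc f' = wtgt f; wsrc g' = wtgt g; wok x;
    wtgt x = [oprod C (wsrc f) \<diamondop> oprod C (wsrc g)]\<rbrakk>
   \<Longrightarrow> (f' \<odot>\<odot> g') \<bullet> ((f \<odot>\<odot> g) \<bullet> x) = ((f' \<bullet> f) \<odot>\<odot> (g' \<bullet> g)) \<bullet> x"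
  by (subst wcomp_reassoc[OF ntensor_wcomp]) auto

lemma ntensor_wid [simp]: "wid C X \<odot>\<odot> wid C Y = wid C [oprod C X \<diamondop> oprod C Y]"
  by (rule wmor_eqI) (auto simp: tensor_id)

lemma wiso_ntensor [simp]: "\<lbrakk>wiso f; wiso g\<rbrakk> \<Longrightarrow> wiso (f \<odot>\<odot> g)"
  by (rule wisoI[of _ "winv C f \<odot>\<odot> winv C g"]) (auto simp: ntensor_wcomp)

definition asc where
  "asc X Y Z = WMor [oprod C X \<diamondop> oprod C Y \<diamondop> oprod C Z] [oprod C X \<diamondop> (oprod C Y \<diamondop> oprod C Z)]
     (\<alpha> (oprod C X) (oprod C Y) (oprod C Z))"

definition lw where "lw X = WMor [\<one> \<diamondop> oprod C X] X (\<l> (oprod C X))"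

definition rw where "rw X = WMor [oprod C X \<diamondop> \<one>] X (\<r> (oprod C X))"

text \<open>The passage between two encodings of a product: it starts at a one-letter word naming
  the product and ends in the concatenated word.\<close>

definition jn where "jn X Y = WMor [oprod C X \<diamondop> oprod C Y] (X @ Y) (join C X Y)"

definition sw where
  "sw X Y = WMor [oprod C X \<diamondop> oprod C Y] [oprod C Y \<diamondop> oprod C X] (\<gamma> (oprod C X) (oprod C Y))"

lemma structure_sel [simp]:
  "wsrc (asc X Y Z) = [oprod C X \<diamondop> oprod C Y \<diamondop> oprod C Z]"
  "wtgt (asc X Y Z) = [oprod C X \<diamondop> (oprod C Y \<diamondop> oprod C Z)]"
  "wsrc (lw X) = [\<one> \<diamondop> oprod C X]" "wtgt (lw X) = X"
  "wsrc (rw X) = [oprod C X \<diamondop> \<one>]" "wtgt (rw X) = X"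
  "wsrc (jn X Y) = [oprod C X \<diamondop> oprod C Y]" "wtgt (jn X Y) = X @ Y"
  "wsrc (sw X Y) = [oprod C X \<diamondop> oprod C Y]" "wtgt (sw X Y) = [oprod C Y \<diamondop> oprod C X]"
  by (simp_all add: asc_def lw_def rw_def jn_def sw_def)

lemma structure_iso [simp]: "wiso (asc X Y Z)" "wiso (lw X)" "wiso (rw X)"
  by (simp_all add: wiso_def asc_def lw_def rw_def assoc_iso lunit_iso runit_iso)

lemma asc_natural:
  "\<lbrakk>wok f; wok g; wok h; wtgt f = X; wtgt g = Y; wtgt h = Z\<rbrakk> \<Longrightarrow>
   asc X Y Z \<bullet> ((f \<odot>\<odot> g) \<odot>\<odot> h) = (f \<odot>\<odot> (g \<odot>\<odot> h)) \<bullet> asc (wsrc f) (wsrc g) (wsrc h)"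
  by (rule wmor_eqI) (auto simp: asc_def wok_def assoc_natural)

lemma lw_natural: "\<lbrakk>wok f; wtgt f = X\<rbrakk> \<Longrightarrow> lw X \<bullet> (wid C [] \<odot>\<odot> f) = f \<bullet> lw (wsrc f)"
  by (rule wmor_eqI) (auto simp: lw_def wok_def lunit_natural)

lemma rw_natural: "\<lbrakk>wok f; wtgt f = X\<rbrakk> \<Longrightarrow> rw X \<bullet> (f \<odot>\<odot> wid C []) = f \<bullet> rw (wsrc f)"
  by (rule wmor_eqI) (auto simp: rw_def wok_def runit_natural)

lemma wpentagon:
  "asc X Y [oprod C Z \<diamondop> oprod C W] \<bullet> asc [oprod C X \<diamondop> oprod C Y] Z W
   = (wid C X \<odot>\<odot> asc Y Z W) \<bullet> (asc X [oprod C Y \<diamondop> oprod C Z] W \<bullet> (asc X Y Z \<odot>\<odot> wid C W))"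
proof -
  have "asc X Y [oprod C Z \<diamondop> oprod C W] \<bullet> asc [oprod C X \<diamondop> oprod C Y] Z W
   = (wid C X \<odot>\<odot> asc Y Z W) \<bullet> asc X [oprod C Y \<diamondop> oprod C Z] W \<bullet> (asc X Y Z \<odot>\<odot> wid C W)"
    by (rule wmor_eqI) (simp_all add: asc_def pentagon)
  then show ?thesis
    by simp
qed

lemma wtriangle: "(wid C X \<odot>\<odot> lw Y) \<bullet> asc X [] Y = rw X \<odot>\<odot> wid C Y"
  by (rule wmor_eqI) (simp_all add: asc_def lw_def rw_def triangle)

lemma wok_sw [simp]: "wok (sw X Y)"
  by (simp add: sw_def wok_def symm_in_Hom)

lemma sw_natural:
  "\<lbrakk>wok f; wok g; wtgt f = X; wtgt g = Y\<rbrakk>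
   \<Longrightarrow> sw X Y \<bullet> (f \<odot>\<odot> g) = (g \<odot>\<odot> f) \<bullet> sw (wsrc f) (wsrc g)"
  by (rule wmor_eqI) (auto simp: sw_def wok_def symm_natural)

lemma sw_sw [simp]: "sw Y X \<bullet> sw X Y = wid C [oprod C X \<diamondop> oprod C Y]"
  by (rule wmor_eqI) (simp_all add: sw_def symm_symm)

lemma wiso_sw [simp]: "wiso (sw X Y)"
  by (rule wisoI[of _ "sw Y X"]) simp_all

lemma whexagon:
  "asc Y Z X \<bullet> (sw X [oprod C Y \<diamondop> oprod C Z] \<bullet> asc X Y Z)
   = (wid C Y \<odot>\<odot> sw X Z) \<bullet> (asc Y X Z \<bullet> (sw X Y \<odot>\<odot> wid C Z))"
proof -
  have "asc Y Z X \<bullet> sw X [oprod C Y \<diamondop> oprod C Z] \<bullet> asc X Y Z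
   = (wid C Y \<odot>\<odot> sw X Z) \<bullet> asc Y X Z \<bullet> (sw X Y \<odot>\<odot> wid C Z)"
    by (rule wmor_eqI) (simp_all add: asc_def sw_def hexagon)
  then show ?thesis
    by simp
qed

section \<open>Unit coherences implied by pentagon, triangle and hexagon\<close>

lemma unit_ntensor_cancel:
  assumes "wok f" "wok g" "wsrc f = wsrc g" "wtgt f = wtgt g"
    and "wid C [] \<odot>\<odot> f = wid C [] \<odot>\<odot> g"
  shows "f = g"
proof (rule wcomp_right_cancel)
  \<comment> \<open>Tensoring with the unit is naturally isomorphic to the identity via
    \<open>lw\<close>, hence faithful.\<close>
  show "f \<bullet> lw (wsrc f) = g \<bullet> lw (wsrc f)"
    using assms lw_natural[of f] lw_natural[of g] by simp
qed (use assms in auto)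

lemma ntensor_unit_cancel:
  assumes "wok f" "wok g" "wsrc f = wsrc g" "wtgt f = wtgt g"
    and "f \<odot>\<odot> wid C [] = g \<odot>\<odot> wid C []"
  shows "f = g"
proof (rule wcomp_right_cancel)
  show "f \<bullet> rw (wsrc f) = g \<bullet> rw (wsrc f)"
    using assms rw_natural[of f] rw_natural[of g] by simp
qed (use assms in auto)

lemma ntensor_wcomp_wid:
  "\<lbrakk>wok f; wok g; wsrc g = wtgt f\<rbrakk> \<Longrightarrow> (g \<bullet> f) \<odot>\<odot> wid C X = (g \<odot>\<odot> wid C X) \<bullet> (f \<odot>\<odot> wid C X)"
  "\<lbrakk>wok f; wok g; wsrc g = wtgt f\<rbrakk> \<Longrightarrow> wid C X \<odot>\<odot> (g \<bullet> f) = (wid C X \<odot>\<odot> g) \<bullet> (wid C X \<odot>\<odot> f)"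
  by (simp_all add: ntensor_wcomp)

text \<open>Kelly's argument: the only triangle among the axioms has the unit in the middle.
  Tensored with one more unit, the claim becomes the pentagon for two units, X and Y, whose other
  faces are triangles and naturality squares.\<close>

lemma lw_ntensor: "lw [oprod C X \<diamondop> oprod C Y] \<bullet> asc [] X Y = lw X \<odot>\<odot> wid C Y"
proof (rule unit_ntensor_cancel)
  let ?k = "asc [] [\<one> \<diamondop> oprod C X] Y \<bullet> (asc [] [] X \<odot>\<odot> wid C Y)"
  have "(wid C [] \<odot>\<odot> (lw [oprod C X \<diamondop> oprod C Y] \<bullet> asc [] X Y)) \<bullet> ?k
      = (wid C [] \<odot>\<odot> lw [oprod C X \<diamondop> oprod C Y]) \<bullet> ((wid C [] \<odot>\<odot> asc [] X Y) \<bullet> ?k)"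
    by (simp add: ntensor_wcomp_wid)
  also have "(wid C [] \<odot>\<odot> asc [] X Y) \<bullet> ?k = asc [] [] [oprod C X \<diamondop> oprod C Y] \<bullet> asc [\<one> \<diamondop> \<one>] X Y"
    using wpentagon[of "[]" "[]" X Y] by simp
  also have "(wid C [] \<odot>\<odot> lw [oprod C X \<diamondop> oprod C Y]) \<bullet> \<dots>
      = (rw [] \<odot>\<odot> wid C [oprod C X \<diamondop> oprod C Y]) \<bullet> asc [\<one> \<diamondop> \<one>] X Y"
    by (subst wcomp_reassoc[OF wtriangle]) simp_all
  also have "\<dots> = asc [] X Y \<bullet> ((rw [] \<odot>\<odot> wid C X) \<odot>\<odot> wid C Y)"
    by (subst asc_natural) simp_all
  also have "\<dots> = asc [] X Y \<bullet> (((wid C [] \<odot>\<odot> lw X) \<odot>\<odot> wid C Y) \<bullet> (asc [] [] X \<odot>\<odot> wid C Y))"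
    by (simp add: ntensor_wcomp wtriangle)
  also have "\<dots> = (wid C [] \<odot>\<odot> (lw X \<odot>\<odot> wid C Y)) \<bullet> ?k"
    by (subst wcomp_reassoc[OF asc_natural]) simp_all
  finally show "wid C [] \<odot>\<odot> (lw [oprod C X \<diamondop> oprod C Y] \<bullet> asc [] X Y)
      = wid C [] \<odot>\<odot> (lw X \<odot>\<odot> wid C Y)"
    by (rule wcomp_right_cancel[rotated -1]) simp_all
qed simp_all

text \<open>The mirror image of \<open>lw_ntensor\<close>, with the extra unit tensored on the
  right.\<close>

lemma rw_ntensor: "(wid C X \<odot>\<odot> rw Y) \<bullet> asc X Y [] = rw [oprod C X \<diamondop> oprod C Y]"
proof (rule ntensor_unit_cancel)
  let ?k = "asc X [oprod C Y \<diamondop> \<one>] [] \<bullet> (asc X Y [] \<odot>\<odot> wid C [])"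
  have "asc X Y [] \<bullet> (rw [oprod C X \<diamondop> oprod C Y] \<odot>\<odot> wid C [])
      = asc X Y [] \<bullet> (((wid C X \<odot>\<odot> wid C Y) \<odot>\<odot> lw []) \<bullet> asc [oprod C X \<diamondop> oprod C Y] [] [])"
    by (simp add: wtriangle)
  also have "\<dots> = (wid C X \<odot>\<odot> (wid C Y \<odot>\<odot> lw [])) \<bullet>
       (asc X Y [\<one> \<diamondop> \<one>] \<bullet> asc [oprod C X \<diamondop> oprod C Y] [] [])"
    by (subst wcomp_reassoc[OF asc_natural]) (simp_all del: ntensor_wid)
  also have "asc X Y [\<one> \<diamondop> \<one>] \<bullet> asc [oprod C X \<diamondop> oprod C Y] [] [] = (wid C X \<odot>\<odot> asc Y [] []) \<bullet> ?k"
    using wpentagon[of X Y "[]" "[]"] by simp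
  also have "(wid C X \<odot>\<odot> (wid C Y \<odot>\<odot> lw [])) \<bullet> \<dots> = (wid C X \<odot>\<odot> (rw Y \<odot>\<odot> wid C [])) \<bullet> ?k"
    by (simp add: ntensor_wcomp_assoc wtriangle)
  also have "\<dots> = asc X Y [] \<bullet> (((wid C X \<odot>\<odot> rw Y) \<odot>\<odot> wid C []) \<bullet> (asc X Y [] \<odot>\<odot> wid C []))"
    by (subst wcomp_reassoc[OF asc_natural]) simp_all
  also have "\<dots> = asc X Y [] \<bullet> (((wid C X \<odot>\<odot> rw Y) \<bullet> asc X Y []) \<odot>\<odot> wid C [])"
    by (simp add: ntensor_wcomp)
  finally show "((wid C X \<odot>\<odot> rw Y) \<bullet> asc X Y []) \<odot>\<odot> wid C [] = rw [oprod C X \<diamondop> oprod C Y] \<odot>\<odot> wid C []"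
    by (rule wcomp_left_cancel[of "asc X Y []", rotated -1, OF sym]) simp_all
qed simp_all

text \<open>Naturality of \<open>lw\<close> at \<open>lw []\<close> itself identifies
  \<open>wid C [] \<odot>\<odot> lw []\<close> with \<open>lw [\<one> \<diamondop> \<one>]\<close>;
  then \<open>lw_ntensor\<close> and the triangle have equal left sides.\<close>

lemma lw_Nil: "lw [] = rw []"
proof (rule ntensor_unit_cancel)
  have "lw [] \<bullet> (wid C [] \<odot>\<odot> lw []) = lw [] \<bullet> lw [\<one> \<diamondop> \<one>]"
    using lw_natural[of "lw []" "[]"] by simp
  then have "wid C [] \<odot>\<odot> lw [] = lw [\<one> \<diamondop> \<one>]"
    by (rule wcomp_left_cancel[rotated -1]) simp_all
  then show "lw [] \<odot>\<odot> wid C [] = rw [] \<odot>\<odot> wid C []"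
    using lw_ntensor[of "[]" "[]"] wtriangle[of "[]" "[]"] by simp
qed simp_all

text \<open>The hexagon at two units expresses the crossing with the double unit by two crossings
  with the unit; one of them cancels because it is invertible.\<close>

lemma sw_unit: "lw X \<bullet> sw X [] = rw X"
proof (rule ntensor_unit_cancel)
  let ?l = "lw [\<one> \<diamondop> oprod C X]"
  have "sw X [] \<bullet> (rw X \<odot>\<odot> wid C []) = sw X [] \<bullet> ((wid C X \<odot>\<odot> lw []) \<bullet> asc X [] [])"
    by (simp add: wtriangle)
  also have "\<dots> = (lw [] \<odot>\<odot> wid C X) \<bullet> (sw X [\<one> \<diamondop> \<one>] \<bullet> asc X [] [])"
    by (subst wcomp_reassoc[OF sw_natural]) simp_all
  also have "\<dots> = ?l \<bullet> (asc [] [] X \<bullet> (sw X [\<one> \<diamondop> \<one>] \<bullet> asc X [] []))"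
    by (subst wcomp_reassoc[OF lw_ntensor[of "[]" X, simplified]]) simp_all
  also have "\<dots> = ?l \<bullet> ((wid C [] \<odot>\<odot> sw X []) \<bullet> (asc [] X [] \<bullet> (sw X [] \<odot>\<odot> wid C [])))"
    using whexagon[of "[]" "[]" X] by simp
  also have "\<dots> = sw X [] \<bullet> (lw [oprod C X \<diamondop> \<one>] \<bullet> (asc [] X [] \<bullet> (sw X [] \<odot>\<odot> wid C [])))"
    by (subst wcomp_reassoc[OF lw_natural]) simp_all
  also have "\<dots> = sw X [] \<bullet> ((lw X \<odot>\<odot> wid C []) \<bullet> (sw X [] \<odot>\<odot> wid C []))"
    by (subst wcomp_reassoc[OF lw_ntensor[of X "[]", simplified]]) simp_all
  also have "\<dots> = sw X [] \<bullet> ((lw X \<bullet> sw X []) \<odot>\<odot> wid C [])"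
    by (simp add: ntensor_wcomp)
  finally show "(lw X \<bullet> sw X []) \<odot>\<odot> wid C [] = rw X \<odot>\<odot> wid C []"
    by (rule wcomp_left_cancel[of "sw X []", rotated -1, OF sym]) simp_all
qed simp_all

section \<open>Rebracketing isomorphisms and the associator\<close>

lemma jn_Nil_left [simp]: "jn [] Y = lw Y"
  by (simp add: jn_def lw_def)

lemma jn_Nil_right [simp]: "jn X [] = rw X"
proof (cases X)
  case Nil
  then show ?thesis
    by (simp add: lw_Nil)
qed (simp add: jn_def rw_def)

lemma jn_single: "X \<noteq> [] \<Longrightarrow> jn X [B] = WMor [oprod C X \<diamondop> B] (X @ [B]) (idm C (oprod C X \<diamondop> B))"
  by (cases X) (simp_all add: jn_def)

text \<open>Only the underlying morphisms agree, because the right side ends in a one-letter word;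
  in \<open>jn_snoc\<close> the factor \<open>jn (X @ Y) [B]\<close>, an identity as a morphism,
  corrects the word.\<close>

lemma wmor_jn_snoc:
  assumes "X \<noteq> []" "Y \<noteq> []"
  shows "wmor (jn X (Y @ [B])) = wmor ((jn X Y \<odot>\<odot> wid C [B]) \<bullet> winv C (asc X Y [B]))"
proof -
  obtain A As B' Bs where "X = A # As" "Y = B' # Bs"
    using assms by (meson neq_Nil_conv)
  then show ?thesis
    by (simp add: jn_def winv_def asc_def del: append_Cons)
qed

lemma wiso_jn [simp]: "wiso (jn X Y)"
proof (cases "X = []")
  case False
  show ?thesis
  proof (induction Y rule: rev_induct)
    case (snoc B Y)
    show ?case
    proof (cases "Y = []")
      case True
      have "wiso (wid C [oprod C X \<diamondop> B])"
        by simp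
      then show ?thesis
        using True False by (simp add: jn_single wiso_def del: wiso_wid)
    next
      case Y: False
      have "wiso ((jn X Y \<odot>\<odot> wid C [B]) \<bullet> winv C (asc X Y [B]))"
        using snoc by simp
      then show ?thesis
        unfolding wiso_def wmor_jn_snoc[OF False Y] using False Y
        by (simp flip: append_assoc del: wcomp_sel(3))
    qed
  qed simp
qed simp

lemma jn_snoc:
  assumes "X \<noteq> []" "Y \<noteq> []"
  shows "jn X (Y @ [B]) = jn (X @ Y) [B] \<bullet> ((jn X Y \<odot>\<odot> wid C [B]) \<bullet> winv C (asc X Y [B]))"
proof (rule wmor_eqI)
  let ?g = "(jn X Y \<odot>\<odot> wid C [B]) \<bullet> winv C (asc X Y [B])"
  have "wmor ?g = wmor (wid C [oprod C (X @ Y) \<diamondop> B] \<bullet> ?g)"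
    by (subst wcomp_wid_left) simp_all
  also have "\<dots> = wmor (jn (X @ Y) [B] \<bullet> ?g)"
    unfolding wcomp_sel using assms by (simp add: jn_single)
  finally show "wmor (jn X (Y @ [B])) = wmor (jn (X @ Y) [B] \<bullet> ?g)"
    unfolding wmor_jn_snoc[OF assms] .
qed (use assms in simp_all)

text \<open>\<open>ntensor\<close> depends on words only through their products, so
  \<open>Z @ [D]\<close> may be exchanged for the one-letter word naming the product of
  \<open>Z\<close> and \<open>D\<close>.\<close>

lemma ntensor_cong_word:
  "\<lbrakk>wmor f = wmor f'; wmor g = wmor g'; oprod C (wsrc f) = oprod C (wsrc f');
    oprod C (wtgt f) = oprod C (wtgt f'); oprod C (wsrc g) = oprod C (wsrc g');
    oprod C (wtgt g) = oprod C (wtgt g')\<rbrakk> \<Longrightarrow> f \<odot>\<odot> g = f' \<odot>\<odot> g'"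
  by (simp add: ntensor_def)

lemma asc_cong_word:
  "\<lbrakk>oprod C X = oprod C X'; oprod C Y = oprod C Y'; oprod C Z = oprod C Z'\<rbrakk> \<Longrightarrow> asc X Y Z = asc X' Y' Z'"
  by (simp add: asc_def)

lemma oprod_append_snoc [simp]: "Y \<noteq> [] \<Longrightarrow> oprod C (X @ Y @ [B]) = oprod C (X @ Y) \<diamondop> B"
  by (simp flip: append_assoc)

text \<open>The coherence statement from which strictness follows. Products are bracketed from the
  left, so the induction removes the last letter of \<open>Z\<close>; empty words are treated
  separately because \<open>join\<close> turns them into unit isomorphisms.\<close>

lemma jn_assoc: "jn (X @ Y) Z \<bullet> (jn X Y \<odot>\<odot> wid C Z) = jn X (Y @ Z) \<bullet> ((wid C X \<odot>\<odot> jn Y Z) \<bullet> asc X Y Z)"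
proof -
  consider "X = []" | "Y = []" | "X \<noteq> []" "Y \<noteq> []"
    by blast
  then show ?thesis
  proof cases
    case 1
    then show ?thesis
      using wcomp_reassoc[OF lw_natural[of "jn Y Z" "Y @ Z"], of "asc [] Y Z"] lw_ntensor[of Y Z]
      by simp
  next
    case 2
    then show ?thesis
      by (simp add: wtriangle)
  next
    case 3
    show ?thesis
    proof (induction Z rule: rev_induct)
      case Nil
      have "jn X Y \<bullet> ((wid C X \<odot>\<odot> rw Y) \<bullet> asc X Y []) = rw (X @ Y) \<bullet> (jn X Y \<odot>\<odot> wid C [])"
        by (simp add: rw_ntensor rw_natural)
      then show ?case
        by simp
    next
      case (snoc D Z)
      have id_D: "wid C X \<odot>\<odot> jn Y [D] = wid C [oprod C X \<diamondop> (oprod C Y \<diamondop> D)]"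
        using 3 by (simp add: jn_single ntensor_def wid_def tensor_id)
      show ?case
      proof (cases "Z = []")
        case True
        then show ?thesis
          using 3 id_D by (simp add: jn_snoc)
      next
        case False
        let ?W = "wid C [D]"
        have eq1: "jn X Y \<odot>\<odot> wid C (Z @ [D]) = jn X Y \<odot>\<odot> (wid C Z \<odot>\<odot> ?W)"
          using False by (intro ntensor_cong_word) simp_all
        have eq2: "wid C X \<odot>\<odot> jn Y (Z @ [D]) = (wid C X \<odot>\<odot> (jn Y Z \<odot>\<odot> ?W)) \<bullet> (wid C X \<odot>\<odot> winv C (asc Y Z [D]))"
          using 3 False wmor_jn_snoc[of Y Z D]
          by (subst ntensor_wcomp) (auto intro!: ntensor_cong_word)
        have "jn (X @ Y) (Z @ [D]) \<bullet> (jn X Y \<odot>\<odot> wid C (Z @ [D]))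
          = jn (X @ Y @ Z) [D] \<bullet> ((jn (X @ Y) Z \<odot>\<odot> ?W) \<bullet> (winv C (asc (X @ Y) Z [D]) \<bullet> (jn X Y \<odot>\<odot> (wid C Z \<odot>\<odot> ?W))))"
          using 3 False by (simp add: jn_snoc eq1 del: ntensor_wid)
        also have "winv C (asc (X @ Y) Z [D]) \<bullet> (jn X Y \<odot>\<odot> (wid C Z \<odot>\<odot> ?W))
          = ((jn X Y \<odot>\<odot> wid C Z) \<odot>\<odot> ?W) \<bullet> winv C (asc [oprod C X \<diamondop> oprod C Y] Z [D])" (is "?a = ?b")
        proof (rule wcomp_left_cancel[of "asc (X @ Y) Z [D]"])
          show "asc (X @ Y) Z [D] \<bullet> ?a = asc (X @ Y) Z [D] \<bullet> ?b"
            using asc_natural[of "jn X Y" "wid C Z" ?W "X @ Y" Z "[D]"]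
            by (subst wcomp_reassoc[OF asc_natural]) (simp_all del: ntensor_wid)
        qed simp_all
        also have "(jn (X @ Y) Z \<odot>\<odot> ?W) \<bullet> \<dots> =
          ((jn X (Y @ Z) \<bullet> ((wid C X \<odot>\<odot> jn Y Z) \<bullet> asc X Y Z)) \<odot>\<odot> ?W) \<bullet> winv C (asc [oprod C X \<diamondop> oprod C Y] Z [D])"
          by (simp add: ntensor_wcomp_assoc snoc.IH)
        also have "\<dots> = (jn X (Y @ Z) \<odot>\<odot> ?W) \<bullet> (((wid C X \<odot>\<odot> jn Y Z) \<odot>\<odot> ?W) \<bullet>
            ((asc X Y Z \<odot>\<odot> ?W) \<bullet> winv C (asc [oprod C X \<diamondop> oprod C Y] Z [D])))"
          by (simp add: ntensor_wcomp_wid)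
        \<comment> \<open>The pentagon solved for the composite that occurs here, with three
          associators moved across as inverses.\<close>
        also have "(asc X Y Z \<odot>\<odot> ?W) \<bullet> winv C (asc [oprod C X \<diamondop> oprod C Y] Z [D])
          = winv C (asc X [oprod C Y \<diamondop> oprod C Z] [D]) \<bullet>
            ((wid C X \<odot>\<odot> winv C (asc Y Z [D])) \<bullet> asc X Y [oprod C Z \<diamondop> D])" (is "?a = ?b")
        proof (rule wcomp_left_cancel[of "asc X [oprod C Y \<diamondop> oprod C Z] [D]"])
          have "(wid C X \<odot>\<odot> asc Y Z [D]) \<bullet> (asc X [oprod C Y \<diamondop> oprod C Z] [D] \<bullet> ?a)
            = asc X Y [oprod C Z \<diamondop> D]"
            using arg_cong[OF wpentagon[of X Y Z "[D]"], of "\<lambda>f. f \<bullet> winv C (asc [oprod C X \<diamondop> oprod C Y] Z [D])"]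
            by simp
          then have "(wid C X \<odot>\<odot> winv C (asc Y Z [D])) \<bullet>
            ((wid C X \<odot>\<odot> asc Y Z [D]) \<bullet> (asc X [oprod C Y \<diamondop> oprod C Z] [D] \<bullet> ?a)) =
            (wid C X \<odot>\<odot> winv C (asc Y Z [D])) \<bullet> asc X Y [oprod C Z \<diamondop> D]"
            by simp
          then show "asc X [oprod C Y \<diamondop> oprod C Z] [D] \<bullet> ?a = asc X [oprod C Y \<diamondop> oprod C Z] [D] \<bullet> ?b"
            by (simp add: ntensor_wcomp_assoc)
        qed simp_all
        also have "((wid C X \<odot>\<odot> jn Y Z) \<odot>\<odot> ?W) \<bullet> (winv C (asc X [oprod C Y \<diamondop> oprod C Z] [D]) \<bullet>
            ((wid C X \<odot>\<odot> winv C (asc Y Z [D])) \<bullet> asc X Y [oprod C Z \<diamondop> D]))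
          = winv C (asc X (Y @ Z) [D]) \<bullet> ((wid C X \<odot>\<odot> (jn Y Z \<odot>\<odot> ?W)) \<bullet>
            ((wid C X \<odot>\<odot> winv C (asc Y Z [D])) \<bullet> asc X Y [oprod C Z \<diamondop> D]))" (is "?a = ?b")
        proof (rule wcomp_left_cancel[of "asc X (Y @ Z) [D]"])
          show "asc X (Y @ Z) [D] \<bullet> ?a = asc X (Y @ Z) [D] \<bullet> ?b"
            by (subst wcomp_reassoc[OF asc_natural]) simp_all
        qed simp_all
        also have "asc X Y [oprod C Z \<diamondop> D] = asc X Y (Z @ [D])"
          using False by (intro asc_cong_word) simp_all
        also have "jn (X @ Y @ Z) [D] \<bullet> ((jn X (Y @ Z) \<odot>\<odot> ?W) \<bullet> (winv C (asc X (Y @ Z) [D]) \<bullet>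
            ((wid C X \<odot>\<odot> (jn Y Z \<odot>\<odot> ?W)) \<bullet> ((wid C X \<odot>\<odot> winv C (asc Y Z [D])) \<bullet> asc X Y (Z @ [D])))))
          = jn X ((Y @ Z) @ [D]) \<bullet> ((wid C X \<odot>\<odot> jn Y (Z @ [D])) \<bullet> asc X Y (Z @ [D]))"
          using 3 False by (subst jn_snoc) (simp_all add: eq2)
        finally show ?thesis
          by simp
      qed
    qed
  qed
qed

end

section \<open>Word morphisms as a strict symmetric monoidal category\<close>

context symmetric_monoidal_category
begin

notation wtensor (infixl "\<boxtimes>\<index>" 60)

lemma wtensor_sel [simp]: "wsrc (f \<boxtimes> g) = wsrc f @ wsrc g" "wtgt (f \<boxtimes> g) = wtgt f @ wtgt g"
  by (simp_all add: wtensor_def)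

lemma wsymm_sel [simp]: "wsrc (wsymm C X Y) = X @ Y" "wtgt (wsymm C X Y) = Y @ X"
  by (simp_all add: wsymm_def)

lemma wtensor_eq:
  assumes "wok f" "wok g"
  shows "f \<boxtimes> g = jn (wtgt f) (wtgt g) \<bullet> ((f \<odot>\<odot> g) \<bullet> winv C (jn (wsrc f) (wsrc g)))"
proof -
  have "f \<boxtimes> g = jn (wtgt f) (wtgt g) \<bullet> (f \<odot>\<odot> g) \<bullet> winv C (jn (wsrc f) (wsrc g))"
    by (rule wmor_eqI) (simp_all add: wtensor_def jn_def unjoin_def winv_def)
  then show ?thesis
    using assms by simp
qed

lemma wsymm_eq: "wsymm C X Y = jn Y X \<bullet> (sw X Y \<bullet> winv C (jn X Y))"
proof -
  have "wsymm C X Y = jn Y X \<bullet> sw X Y \<bullet> winv C (jn X Y)"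
    by (rule wmor_eqI) (simp_all add: wsymm_def jn_def unjoin_def winv_def sw_def)
  then show ?thesis
    by simp
qed

lemma wok_wtensor [simp]: "\<lbrakk>wok f; wok g\<rbrakk> \<Longrightarrow> wok (f \<boxtimes> g)"
  by (simp add: wtensor_eq)

lemma wok_wsymm [simp]: "wok (wsymm C X Y)"
  by (simp add: wsymm_eq)

text \<open>As \<open>jn\<close> is invertible, this square determines the word tensor, so
  identities can be checked after composing with \<open>jn\<close>.\<close>

lemma wtensor_jn:
  "\<lbrakk>wok f; wok g; wsrc f = X; wsrc g = Y\<rbrakk> \<Longrightarrow> (f \<boxtimes> g) \<bullet> jn X Y = jn (wtgt f) (wtgt g) \<bullet> (f \<odot>\<odot> g)"
  by (auto simp: wtensor_eq)

lemma wsymm_jn: "wsymm C X Y \<bullet> jn X Y = jn Y X \<bullet> sw X Y"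
  by (simp add: wsymm_eq)

lemma wtensor_wcomp:
  assumes "wok f" "wok f'" "wok g" "wok g'" "wsrc f' = wtgt f" "wsrc g' = wtgt g"
  shows "(f' \<boxtimes> g') \<bullet> (f \<boxtimes> g) = (f' \<bullet> f) \<boxtimes> (g' \<bullet> g)"
  using assms by (simp add: wtensor_eq ntensor_wcomp_assoc)

lemma wid_wtensor [simp]: "wid C X \<boxtimes> wid C Y = wid C (X @ Y)"
  by (simp add: wtensor_eq)

lemma wid_Nil_wtensor [simp]: "wok f \<Longrightarrow> wid C [] \<boxtimes> f = f"
  by (rule wcomp_right_cancel[of "lw (wsrc f)"]) (auto simp: wtensor_eq lw_natural)

lemma wtensor_wid_Nil [simp]: "wok f \<Longrightarrow> f \<boxtimes> wid C [] = f"
  by (rule wcomp_right_cancel[of "rw (wsrc f)"]) (auto simp: wtensor_eq rw_natural)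

text \<open>Both sides are conjugate to the two bracketings of the named tensor product, and by
  \<open>jn_assoc\<close> the conjugating isomorphisms differ by the associator alone.\<close>

lemma wtensor_assoc [simp]:
  assumes [simp]: "wok f" "wok g" "wok h"
  shows "f \<boxtimes> g \<boxtimes> h = f \<boxtimes> (g \<boxtimes> h)"
proof -
  let ?X = "wsrc f" and ?Y = "wsrc g" and ?Z = "wsrc h"
  let ?X' = "wtgt f" and ?Y' = "wtgt g" and ?Z' = "wtgt h"
  let ?k = "jn (?X @ ?Y) ?Z \<bullet> (jn ?X ?Y \<odot>\<odot> wid C ?Z)"
  have "(f \<boxtimes> g \<boxtimes> h) \<bullet> ?k = jn (?X' @ ?Y') ?Z' \<bullet> (((f \<boxtimes> g) \<odot>\<odot> h) \<bullet> (jn ?X ?Y \<odot>\<odot> wid C ?Z))"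
    by (subst wcomp_reassoc[OF wtensor_jn]) simp_all
  also have "((f \<boxtimes> g) \<odot>\<odot> h) \<bullet> (jn ?X ?Y \<odot>\<odot> wid C ?Z) = (jn ?X' ?Y' \<odot>\<odot> wid C ?Z') \<bullet> ((f \<odot>\<odot> g) \<odot>\<odot> h)"
    by (simp add: ntensor_wcomp wtensor_jn)
  also have "jn (?X' @ ?Y') ?Z' \<bullet> \<dots> =
      jn ?X' (?Y' @ ?Z') \<bullet> ((wid C ?X' \<odot>\<odot> jn ?Y' ?Z') \<bullet> (asc ?X' ?Y' ?Z' \<bullet> ((f \<odot>\<odot> g) \<odot>\<odot> h)))"
    by (subst wcomp_reassoc[OF jn_assoc]) simp_all
  also have "\<dots> = jn ?X' (?Y' @ ?Z') \<bullet> ((wid C ?X' \<odot>\<odot> jn ?Y' ?Z') \<bullet> ((f \<odot>\<odot> (g \<odot>\<odot> h)) \<bullet> asc ?X ?Y ?Z))"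
    by (subst asc_natural) simp_all
  also have "\<dots> = jn ?X' (?Y' @ ?Z') \<bullet> ((f \<odot>\<odot> (g \<boxtimes> h)) \<bullet> ((wid C ?X \<odot>\<odot> jn ?Y ?Z) \<bullet> asc ?X ?Y ?Z))"
    by (simp add: ntensor_wcomp_assoc wtensor_jn)
  also have "\<dots> = (f \<boxtimes> (g \<boxtimes> h)) \<bullet> (jn ?X (?Y @ ?Z) \<bullet> ((wid C ?X \<odot>\<odot> jn ?Y ?Z) \<bullet> asc ?X ?Y ?Z))"
    by (subst wcomp_reassoc[OF wtensor_jn]) simp_all
  also have "\<dots> = (f \<boxtimes> (g \<boxtimes> h)) \<bullet> ?k"
    by (simp add: jn_assoc)
  finally show ?thesis
    by (rule wcomp_right_cancel[rotated -1]) simp_all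
qed

lemma wsymm_natural:
  assumes [simp]: "wok f" "wok g" and "wtgt f = X" "wtgt g = Y"
  shows "wsymm C X Y \<bullet> (f \<boxtimes> g) = (g \<boxtimes> f) \<bullet> wsymm C (wsrc f) (wsrc g)"
proof -
  have "wsymm C X Y \<bullet> (f \<boxtimes> g) = jn Y X \<bullet> (sw X Y \<bullet> ((f \<odot>\<odot> g) \<bullet> winv C (jn (wsrc f) (wsrc g))))"
    using assms by (auto simp: wtensor_eq wsymm_eq)
  also have "\<dots> = jn Y X \<bullet> ((g \<odot>\<odot> f) \<bullet> (sw (wsrc f) (wsrc g) \<bullet> winv C (jn (wsrc f) (wsrc g))))"
    using assms by (subst wcomp_reassoc[OF sw_natural]) auto
  also have "\<dots> = (g \<boxtimes> f) \<bullet> wsymm C (wsrc f) (wsrc g)"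
    using assms by (auto simp: wtensor_eq wsymm_eq)
  finally show ?thesis .
qed

lemma wsymm_wsymm [simp]: "wsymm C Y X \<bullet> wsymm C X Y = wid C (X @ Y)"
proof -
  have "wsymm C Y X \<bullet> wsymm C X Y = jn X Y \<bullet> (sw Y X \<bullet> (sw X Y \<bullet> winv C (jn X Y)))"
    by (simp add: wsymm_eq)
  also have "\<dots> = wid C (X @ Y)"
    by (subst wcomp_reassoc[OF sw_sw]) simp_all
  finally show ?thesis .
qed

lemma wiso_wsymm [simp]: "wiso (wsymm C X Y)"
  by (rule wisoI[of _ "wsymm C Y X"]) simp_all

lemma winv_wsymm [simp]: "winv C (wsymm C X Y) = wsymm C Y X"
  by (rule winv_eqI) simp_all

lemma wiso_wtensor [simp]: "\<lbrakk>wiso f; wiso g\<rbrakk> \<Longrightarrow> wiso (f \<boxtimes> g)"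
  by (rule wisoI[of _ "winv C f \<boxtimes> winv C g"]) (simp_all add: wtensor_wcomp)

lemma winv_wtensor: "\<lbrakk>wiso f; wiso g\<rbrakk> \<Longrightarrow> winv C (f \<boxtimes> g) = winv C f \<boxtimes> winv C g"
  by (rule winv_eqI) (simp_all add: wtensor_wcomp)

lemma wsymm_Nil [simp]: "wsymm C X [] = wid C X" "wsymm C [] X = wid C X"
proof -
  show 1: "wsymm C X [] = wid C X"
    by (simp add: wsymm_eq wcomp_reassoc[OF sw_unit])
  then show "wsymm C [] X = wid C X"
    using wsymm_wsymm[of "[]" X] by simp
qed

text \<open>The hexagon, whose three associators are absorbed by three uses of
  \<open>jn_assoc\<close>.\<close>

lemma wsymm_append_right:
  "wsymm C X (Y @ Z) = (wid C Y \<boxtimes> wsymm C X Z) \<bullet> (wsymm C X Y \<boxtimes> wid C Z)"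
proof -
  let ?k = "jn (X @ Y) Z \<bullet> (jn X Y \<odot>\<odot> wid C Z)"
  have "wsymm C X (Y @ Z) \<bullet> ?k
      = jn (Y @ Z) X \<bullet> (sw X (Y @ Z) \<bullet> ((wid C X \<odot>\<odot> jn Y Z) \<bullet> asc X Y Z))"
    unfolding jn_assoc by (subst wcomp_reassoc[OF wsymm_jn]) simp_all
  also have "\<dots> = jn (Y @ Z) X \<bullet> ((jn Y Z \<odot>\<odot> wid C X) \<bullet> (sw X [oprod C Y \<diamondop> oprod C Z] \<bullet> asc X Y Z))"
    by (subst wcomp_reassoc[OF sw_natural]) simp_all
  also have "\<dots> = jn Y (Z @ X) \<bullet> ((wid C Y \<odot>\<odot> jn Z X) \<bullet> (asc Y Z X \<bullet> (sw X [oprod C Y \<diamondop> oprod C Z] \<bullet> asc X Y Z)))"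
    by (subst wcomp_reassoc[OF jn_assoc]) simp_all
  also have "\<dots> = jn Y (Z @ X) \<bullet> ((wid C Y \<odot>\<odot> jn Z X) \<bullet> ((wid C Y \<odot>\<odot> sw X Z) \<bullet> (asc Y X Z \<bullet> (sw X Y \<odot>\<odot> wid C Z))))"
    by (simp add: whexagon)
  also have "\<dots> = jn Y (Z @ X) \<bullet> ((wid C Y \<odot>\<odot> wsymm C X Z) \<bullet> ((wid C Y \<odot>\<odot> jn X Z) \<bullet> (asc Y X Z \<bullet> (sw X Y \<odot>\<odot> wid C Z))))"
    by (simp add: ntensor_wcomp_assoc wsymm_jn)
  also have "\<dots> = (wid C Y \<boxtimes> wsymm C X Z) \<bullet> (jn Y (X @ Z) \<bullet> ((wid C Y \<odot>\<odot> jn X Z) \<bullet> (asc Y X Z \<bullet> (sw X Y \<odot>\<odot> wid C Z))))"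
    by (subst wcomp_reassoc[OF wtensor_jn]) simp_all
  also have "jn Y (X @ Z) \<bullet> ((wid C Y \<odot>\<odot> jn X Z) \<bullet> (asc Y X Z \<bullet> (sw X Y \<odot>\<odot> wid C Z)))
      = jn (Y @ X) Z \<bullet> ((jn Y X \<odot>\<odot> wid C Z) \<bullet> (sw X Y \<odot>\<odot> wid C Z))"
    by (subst wcomp_reassoc[OF jn_assoc]) simp_all
  also have "\<dots> = (wsymm C X Y \<boxtimes> wid C Z) \<bullet> ?k"
    by (subst wcomp_reassoc[OF wtensor_jn]) (simp_all add: ntensor_wcomp wsymm_jn)
  also have "(wid C Y \<boxtimes> wsymm C X Z) \<bullet> \<dots> = ((wid C Y \<boxtimes> wsymm C X Z) \<bullet> (wsymm C X Y \<boxtimes> wid C Z)) \<bullet> ?k"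
    by simp
  finally show ?thesis
    by (rule wcomp_right_cancel[rotated -1]) simp_all
qed

text \<open>The inverse of \<open>wsymm_append_right\<close>, since the inverse of a symmetry is a
  symmetry.\<close>

lemma wsymm_append_left:
  "wsymm C (X @ Y) Z = (wsymm C X Z \<boxtimes> wid C Y) \<bullet> (wid C X \<boxtimes> wsymm C Y Z)"
proof -
  have "wsymm C (X @ Y) Z = winv C (wsymm C Z (X @ Y))"
    by simp
  also have "\<dots> = (wsymm C X Z \<boxtimes> wid C Y) \<bullet> (wid C X \<boxtimes> wsymm C Y Z)"
    unfolding wsymm_append_right by (subst winv_wcomp) (simp_all add: winv_wtensor)
  finally show ?thesis .
qed

end

section \<open>Bases of hom-spaces\<close>

context linear_category
begin

lemma zero_in_Hom [simp]: "0 \<in> Hom C A B"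
  by (simp add: Hom_subspace subspace_0)

lemma add_in_Hom: "\<lbrakk>f \<in> Hom C A B; g \<in> Hom C A B\<rbrakk> \<Longrightarrow> f + g \<in> Hom C A B"
  by (simp add: Hom_subspace subspace_add)

lemma scal_in_Hom [simp]: "f \<in> Hom C A B \<Longrightarrow> c \<odot> f \<in> Hom C A B"
  by (simp add: Hom_subspace subspace_scale)

lemma sum_in_Hom: "(\<And>i. i \<in> I \<Longrightarrow> f i \<in> Hom C A B) \<Longrightarrow> sum f I \<in> Hom C A B"
  by (simp add: Hom_subspace subspace_sum)

lemma cmp_zero_left [simp]: "f \<in> Hom C A B \<Longrightarrow> 0 \<cdot> f = 0"
  using cmp_scal_left[of f A B 0 B 0] by simp

lemma cmp_zero_right [simp]: "f \<in> Hom C A B \<Longrightarrow> f \<cdot> 0 = 0"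
  using cmp_scal_right[of 0 A A f B 0] by simp

text \<open>Linearity on one hom-set only, because composition and tensor product are unconstrained
  outside the appropriate hom-sets.\<close>

definition linear_on_Hom where
  "linear_on_Hom A B F \<longleftrightarrow>
     (\<forall>f\<in>Hom C A B. \<forall>g\<in>Hom C A B. F (f + g) = F f + F g) \<and> (\<forall>f\<in>Hom C A B. \<forall>c. F (c \<odot> f) = c \<odot> F f)"

lemma linear_on_Hom_sum:
  assumes "linear_on_Hom A B F" "\<And>i. i \<in> I \<Longrightarrow> x i \<in> Hom C A B"
  shows "F (\<Sum>i\<in>I. c i \<odot> x i) = (\<Sum>i\<in>I. c i \<odot> F (x i))"
proof -
  have [simp]: "F 0 = 0"
    using assms(1) zero_in_Hom unfolding linear_on_Hom_def by (metis scale_zero_left)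
  show ?thesis
    using assms(2)
  proof (induction I rule: infinite_finite_induct)
    case (insert j I)
    then have "(\<Sum>i\<in>I. c i \<odot> x i) \<in> Hom C A B"
      by (intro sum_in_Hom) auto
    then have "F (c j \<odot> x j + (\<Sum>i\<in>I. c i \<odot> x i)) = F (c j \<odot> x j) + F (\<Sum>i\<in>I. c i \<odot> x i)"
      using insert.prems assms(1) by (simp add: linear_on_Hom_def)
    moreover have "F (c j \<odot> x j) = c j \<odot> F (x j)"
      using insert.prems assms(1) by (simp add: linear_on_Hom_def)
    ultimately show ?case
      using insert by simp
  qed simp_all
qed

lemma linear_on_Hom_cmp:
  "g \<in> Hom C B D \<Longrightarrow> linear_on_Hom A B (\<lambda>f. g \<cdot> f)"
  "f \<in> Hom C A B \<Longrightarrow> linear_on_Hom B D (\<lambda>g. g \<cdot> f)"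
  by (simp_all add: linear_on_Hom_def cmp_add_left cmp_add_right cmp_scal_left cmp_scal_right)

lemma linear_on_Hom_comp:
  assumes "linear_on_Hom A B F" "linear_on_Hom A' B' G" "\<And>f. f \<in> Hom C A B \<Longrightarrow> F f \<in> Hom C A' B'"
  shows "linear_on_Hom A B (\<lambda>f. G (F f))"
  using assms by (simp add: linear_on_Hom_def)

lemma
  assumes "g \<in> Hom C B D" "\<And>i. i \<in> I \<Longrightarrow> f i \<in> Hom C A B"
  shows cmp_sum_right: "g \<cdot> (\<Sum>i\<in>I. c i \<odot> f i) = (\<Sum>i\<in>I. c i \<odot> (g \<cdot> f i))"
    and cmp_sum_right1: "g \<cdot> (\<Sum>i\<in>I. f i) = (\<Sum>i\<in>I. g \<cdot> f i)"
  using linear_on_Hom_sum[OF linear_on_Hom_cmp(1)[OF assms(1)] assms(2), where c = c]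
    linear_on_Hom_sum[OF linear_on_Hom_cmp(1)[OF assms(1)] assms(2), where c = "\<lambda>_. 1"] by simp_all

lemma
  assumes "f \<in> Hom C A B" "\<And>i. i \<in> I \<Longrightarrow> g i \<in> Hom C B D"
  shows cmp_sum_left: "(\<Sum>i\<in>I. c i \<odot> g i) \<cdot> f = (\<Sum>i\<in>I. c i \<odot> (g i \<cdot> f))"
    and cmp_sum_left1: "(\<Sum>i\<in>I. g i) \<cdot> f = (\<Sum>i\<in>I. g i \<cdot> f)"
  using linear_on_Hom_sum[OF linear_on_Hom_cmp(2)[OF assms(1)] assms(2), where c = c]
    linear_on_Hom_sum[OF linear_on_Hom_cmp(2)[OF assms(1)] assms(2), where c = "\<lambda>_. 1"] by simp_all

text \<open>Biorthogonality alone gives the independence of both families: pairing a linear relation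
  with one dual element isolates one coefficient.\<close>

lemma dual_basesI:
  assumes fin: "finite E" and nz: "idm C a \<noteq> 0"
    and E: "E \<subseteq> Hom C a A" and d: "d ` E \<subseteq> Hom C A a"
    and dual: "\<And>e e'. \<lbrakk>e \<in> E; e' \<in> E\<rbrakk> \<Longrightarrow> d e \<cdot> e' = (if e = e' then idm C a else 0)"
    and span: "Hom C a A \<subseteq> span E" "Hom C A a \<subseteq> span (d ` E)"
  shows "dual_bases C a A E d"
proof -
  have inj: "inj_on d E"
    using dual nz by (metis inj_onI)
  have "independent E"
    unfolding dependent_finite[OF fin]
  proof safe
    fix u v
    assume "v \<in> E" "u v \<noteq> 0" "(\<Sum>v\<in>E. u v \<odot> v) = 0"
    then have "0 = d v \<cdot> (\<Sum>v\<in>E. u v \<odot> v)"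
      using d by (metis cmp_zero_right image_subset_iff)
    also have "\<dots> = (\<Sum>w\<in>E. u w \<odot> (d v \<cdot> w))"
      using E d \<open>v \<in> E\<close> by (intro cmp_sum_right[where B = A]) auto
    also have "\<dots> = (\<Sum>w\<in>E. if w = v then u v \<odot> idm C a else 0)"
      by (rule sum.cong) (auto simp: dual \<open>v \<in> E\<close>)
    also have "\<dots> = u v \<odot> idm C a"
      using fin \<open>v \<in> E\<close> by simp
    finally show False
      using nz \<open>u v \<noteq> 0\<close> by (metis scale_eq_0_iff)
  qed
  moreover have "independent (d ` E)"
    unfolding dependent_finite[OF finite_imageI[OF fin]]
  proof safe
    fix u v
    assume v: "v \<in> E" "u (d v) \<noteq> 0" "(\<Sum>v\<in>d ` E. u v \<odot> v) = 0"
    then have "0 = (\<Sum>v\<in>E. u (d v) \<odot> d v) \<cdot> v"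
      using E cmp_zero_left[of v a A] by (auto simp: sum.reindex[OF inj])
    also have "\<dots> = (\<Sum>w\<in>E. u (d w) \<odot> (d w \<cdot> v))"
      using E d \<open>v \<in> E\<close> by (intro cmp_sum_left[where B = A]) auto
    also have "\<dots> = (\<Sum>w\<in>E. if w = v then u (d v) \<odot> idm C a else 0)"
      by (rule sum.cong) (auto simp: dual \<open>v \<in> E\<close>)
    also have "\<dots> = u (d v) \<odot> idm C a"
      using fin \<open>v \<in> E\<close> by simp
    finally show False
      using nz v(2) by (metis scale_eq_0_iff)
  qed
  ultimately show ?thesis
    unfolding dual_bases_def using E d span dual Hom_subspace by (simp add: span_subspace)
qed

end

context semisimple_stable_autonomous_category
begin

text \<open>In a decomposition of \<open>A\<close> into simple summands, the inclusions and
  projections of the summands equal to \<open>a\<close> are dual to each other; by Schur's lemma the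
  other summands contribute nothing to \<open>Hom(a,A)\<close> and \<open>Hom(A,a)\<close>.\<close>

lemma exists_dual_bases:
  assumes a: "a \<in> S"
  shows "\<exists>E d. finite E \<and> dual_bases C a A E d"
proof -
  obtain D as \<iota> \<pi> where as: "set as \<subseteq> S" and ds: "direct_sum C D as \<iota> \<pi>" and "isomorphic C A D"
    using semisimple by blast
  then obtain \<phi> \<psi> where "inverse_pair C A D \<phi> \<psi>"
    by (auto simp: isomorphic_def iso_mor_def)
  then have phi [simp]: "\<phi> \<in> Hom C A D" and psi [simp]: "\<psi> \<in> Hom C D A"
    and psi_phi: "\<psi> \<cdot> \<phi> = idm C A" and phi_psi: "\<phi> \<cdot> \<psi> = idm C D"
    by (auto simp: inverse_pair_def)
  let ?n = "length as"
  have io [simp]: "\<iota> i \<in> Hom C (as ! i) D" and pi [simp]: "\<pi> i \<in> Hom C D (as ! i)" if "i < ?n" for i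
    using ds that by (auto simp: direct_sum_def)
  have pi_io: "\<pi> i \<cdot> \<iota> j = (if i = j then idm C (as ! i) else 0)" if "i < ?n" "j < ?n" for i j
    using ds that by (auto simp: direct_sum_def)
  have io_pi: "(\<Sum>i<?n. \<iota> i \<cdot> \<pi> i) = idm C D"
    using ds by (auto simp: direct_sum_def)
  define I where "I = {i. i < ?n \<and> as ! i = a}"
  have fin: "finite I" and I_less: "\<And>i. i \<in> I \<Longrightarrow> i < ?n" and I_eq: "\<And>i. i \<in> I \<Longrightarrow> as ! i = a"
    by (auto simp: I_def)
  define e where "e i = \<psi> \<cdot> \<iota> i" for i
  define d where "d i = \<pi> i \<cdot> \<phi>" for i
  have e [simp]: "e i \<in> Hom C (as ! i) A" if "i < ?n" for i
    unfolding e_def using that by (intro cmp_in_Hom[OF io psi])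
  have d [simp]: "d i \<in> Hom C A (as ! i)" if "i < ?n" for i
    unfolding d_def using that by (intro cmp_in_Hom[OF phi pi])
  have d_e: "d i \<cdot> e j = (if i = j then idm C a else 0)" if "i \<in> I" "j \<in> I" for i j
  proof -
    have i: "i < ?n" and j: "j < ?n"
      using that I_less by auto
    have "d i \<cdot> e j = \<pi> i \<cdot> (\<phi> \<cdot> (\<psi> \<cdot> \<iota> j))"
      unfolding d_def e_def by (rule cmp_assoc[OF cmp_in_Hom[OF io[OF j] psi] phi pi[OF i]])
    also have "\<phi> \<cdot> (\<psi> \<cdot> \<iota> j) = \<iota> j"
      using cmp_assoc[OF io[OF j] psi phi] cmp_id_left[OF io[OF j]] by (simp add: phi_psi)
    finally show ?thesis
      using i j I_eq[OF that(1)] by (auto simp: pi_io)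
  qed
  have idsum: "idm C A = (\<Sum>i<?n. e i \<cdot> d i)"
  proof -
    have "idm C A = \<psi> \<cdot> ((\<Sum>i<?n. \<iota> i \<cdot> \<pi> i) \<cdot> \<phi>)"
      by (simp add: io_pi cmp_id_left[OF phi] psi_phi)
    also have "(\<Sum>i<?n. \<iota> i \<cdot> \<pi> i) \<cdot> \<phi> = (\<Sum>i<?n. \<iota> i \<cdot> \<pi> i \<cdot> \<phi>)"
      by (rule cmp_sum_left1[OF phi]) (auto intro: cmp_in_Hom[OF pi io])
    also have "\<dots> = (\<Sum>i<?n. \<iota> i \<cdot> d i)"
      unfolding d_def by (rule sum.cong[OF refl], rule cmp_assoc[OF phi pi io]) auto
    also have "\<psi> \<cdot> \<dots> = (\<Sum>i<?n. \<psi> \<cdot> (\<iota> i \<cdot> d i))"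
      by (rule cmp_sum_right1[OF psi]) (auto intro: cmp_in_Hom[OF d io])
    also have "\<dots> = (\<Sum>i<?n. e i \<cdot> d i)"
      unfolding e_def by (rule sum.cong[OF refl], rule cmp_assoc[OF d io psi, symmetric]) auto
    finally show ?thesis .
  qed
  have sum_I: "(\<Sum>i<?n. g i) = (\<Sum>i\<in>I. g i)" if "\<And>i. i < ?n \<Longrightarrow> as ! i \<noteq> a \<Longrightarrow> g i = 0"
    for g :: "nat \<Rightarrow> 'm"
    by (rule sum.mono_neutral_right) (use that in \<open>auto simp: I_def\<close>)
  have inj: "inj_on e I"
    by (rule inj_onI) (metis d_e id_nonzero[OF a])
  \<comment> \<open>\<open>dual_bases\<close> takes the dual as a function of the basis element, so
    the index is recovered from the morphism.\<close>
  define dd where "dd x = d (the_inv_into I e x)" for x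
  have dd [simp]: "dd (e i) = d i" if "i \<in> I" for i
    using that by (simp add: dd_def the_inv_into_f_f[OF inj])
  have "dual_bases C a A (e ` I) dd"
  proof (rule dual_basesI)
    show "e ` I \<subseteq> Hom C a A" "dd ` e ` I \<subseteq> Hom C A a"
      using e d I_less I_eq by fastforce+
    show "dd x \<cdot> y = (if x = y then idm C a else 0)" if "x \<in> e ` I" "y \<in> e ` I" for x y
      using that inj by (auto simp: d_e inj_on_eq_iff)
    show "Hom C a A \<subseteq> span (e ` I)"
    proof
      fix u assume u: "u \<in> Hom C a A"
      have du: "d i \<cdot> u \<in> Hom C a (as ! i)" if "i < ?n" for i
        using cmp_in_Hom[OF u d] that by blast
      have "u = (\<Sum>i<?n. e i \<cdot> d i \<cdot> u)"
        using cmp_id_left[OF u] cmp_sum_left1[OF u, of "{..<?n}" "\<lambda>i. e i \<cdot> d i" A]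
        by (auto simp: idsum intro: cmp_in_Hom[OF d e])
      also have "\<dots> = (\<Sum>i<?n. e i \<cdot> (d i \<cdot> u))"
        by (rule sum.cong[OF refl], rule cmp_assoc[OF u d e]) auto
      also have "\<dots> = (\<Sum>i\<in>I. e i \<cdot> (d i \<cdot> u))"
      proof (rule sum_I)
        fix i assume i: "i < ?n" "as ! i \<noteq> a"
        then have "d i \<cdot> u = 0"
          using du Hom_distinct[OF a, of "as ! i"] as by (metis nth_mem singletonD subsetD)
        then show "e i \<cdot> (d i \<cdot> u) = 0"
          using cmp_zero_right[OF e] i by simp
      qed
      also have "\<dots> \<in> span (e ` I)"
      proof (rule span_sum)
        fix i assume i: "i \<in> I"
        then obtain c where "d i \<cdot> u = c \<odot> idm C a"
          using du[OF I_less] Hom_same[OF a] I_eq by fastforce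
        then have "e i \<cdot> (d i \<cdot> u) = c \<odot> e i"
          using cmp_scal_right[OF id_in_Hom e[OF I_less[OF i]]] cmp_id_right[OF e[OF I_less[OF i]]]
          by (simp add: I_eq[OF i])
        then show "e i \<cdot> (d i \<cdot> u) \<in> span (e ` I)"
          using i by (simp add: span_base span_scale)
      qed
      finally show "u \<in> span (e ` I)" .
    qed
    show "Hom C A a \<subseteq> span (dd ` e ` I)"
    proof
      fix u assume u: "u \<in> Hom C A a"
      have ue: "u \<cdot> e i \<in> Hom C (as ! i) a" if "i < ?n" for i
        using cmp_in_Hom[OF e u] that by blast
      have "u = (\<Sum>i<?n. u \<cdot> (e i \<cdot> d i))"
        using cmp_id_right[OF u] cmp_sum_right1[OF u, of "{..<?n}" "\<lambda>i. e i \<cdot> d i" A]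
        by (auto simp: idsum intro: cmp_in_Hom[OF d e])
      also have "\<dots> = (\<Sum>i<?n. u \<cdot> e i \<cdot> d i)"
        by (rule sum.cong[OF refl], rule cmp_assoc[OF d e u, symmetric]) auto
      also have "\<dots> = (\<Sum>i\<in>I. u \<cdot> e i \<cdot> d i)"
      proof (rule sum_I)
        fix i assume i: "i < ?n" "as ! i \<noteq> a"
        then have "u \<cdot> e i = 0"
          using ue Hom_distinct[OF _ a, of "as ! i"] as by (metis nth_mem singletonD subsetD)
        then show "u \<cdot> e i \<cdot> d i = 0"
          using cmp_zero_left[OF d] i by simp
      qed
      also have "\<dots> \<in> span (dd ` e ` I)"
      proof (rule span_sum)
        fix i assume i: "i \<in> I"
        then obtain c where "u \<cdot> e i = c \<odot> idm C a"
          using ue[OF I_less] Hom_same[OF a] I_eq by fastforce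
        then have "u \<cdot> e i \<cdot> d i = c \<odot> dd (e i)"
          using cmp_scal_left[OF d[OF I_less[OF i]] id_in_Hom] cmp_id_left[OF d[OF I_less[OF i]]] i
          by (simp add: I_eq[OF i])
        then show "u \<cdot> e i \<cdot> d i \<in> span (dd ` e ` I)"
          using i span_scale[OF span_base[of "dd (e i)" "dd ` e ` I"], of c] imageI[OF imageI[OF i, of e], of dd]
          by simp
      qed
      finally show "u \<in> span (dd ` e ` I)" .
    qed
  qed (use fin id_nonzero[OF a] in auto)
  then show ?thesis
    using fin by blast
qed

text \<open>\<open>dual_bases\<close> does not ask for finiteness, but a sum over an infinite set is
  0; so every admissible basis is compared with one finite basis.\<close>

lemma dual_bases_finite:
  assumes "a \<in> S" "dual_bases C a A E d"
  shows "finite E"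
proof -
  obtain E' d' where "finite E'" "dual_bases C a A E' d'"
    using exists_dual_bases[OF assms(1)] by blast
  then show ?thesis
    using independent_span_bound[of E' E] assms span_superset[of E] by (auto simp: dual_bases_def)
qed

lemma scalar_of_scal [simp]: "scalar_of C (c \<odot> idm C \<one>) = c"
  unfolding scalar_of_def using id_nonzero[OF uno_in] by auto

lemma scalar_of_0 [simp]: "scalar_of C 0 = 0"
  using scalar_of_scal[of 0] by simp

lemma scalar_of_eq: "f \<in> Hom C \<one> \<one> \<Longrightarrow> scalar_of C f \<odot> idm C \<one> = f"
  using Hom_same[OF uno_in] by force

lemma scalar_of_sum:
  assumes "\<And>i. i \<in> I \<Longrightarrow> f i \<in> Hom C \<one> \<one>"
  shows "scalar_of C (\<Sum>i\<in>I. c i \<odot> f i) = (\<Sum>i\<in>I. c i * scalar_of C (f i))"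
proof -
  have "(\<Sum>i\<in>I. c i \<odot> f i) = (\<Sum>i\<in>I. c i * scalar_of C (f i)) \<odot> idm C \<one>"
    unfolding scale_sum_left by (rule sum.cong) (auto simp: scalar_of_eq[OF assms] simp flip: scale_scale)
  then show ?thesis
    by simp
qed

section \<open>Expansions in dual bases of \<open>Hom(\<one>, A)\<close>\<close>

context
  fixes A E d
  assumes db: "dual_bases C \<one> A E d"
begin

lemma dual_bases_unit:
  shows finite_basis: "finite E"
    and basis_in_Hom: "e \<in> E \<Longrightarrow> e \<in> Hom C \<one> A"
    and dual_basis_in_Hom: "e \<in> E \<Longrightarrow> d e \<in> Hom C A \<one>"
    and scalar_of_dual_basis: "\<lbrakk>e \<in> E; e' \<in> E\<rbrakk> \<Longrightarrow> scalar_of C (d e \<cdot> e') = (if e = e' then 1 else 0)"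
    and inj_on_dual_basis: "inj_on d E"
proof -
  show "finite E"
    using dual_bases_finite[OF uno_in db] .
  show "e \<in> E \<Longrightarrow> e \<in> Hom C \<one> A" "e \<in> E \<Longrightarrow> d e \<in> Hom C A \<one>"
    using db span_superset unfolding dual_bases_def by blast+
  show "scalar_of C (d e \<cdot> e') = (if e = e' then 1 else 0)" if "e \<in> E" "e' \<in> E" for e e'
    using that db scalar_of_scal[of 1] by (simp add: dual_bases_def)
  show "inj_on d E"
    using db id_nonzero[OF uno_in] unfolding dual_bases_def by (metis inj_onI)
qed

lemma sum_delta_unit:
  fixes c :: "'m \<Rightarrow> 'k"
  assumes "e \<in> E"
  shows "(\<Sum>e'\<in>E. c e' * (if e = e' then 1 else 0)) = c e" "(\<Sum>e'\<in>E. c e' * (if e' = e then 1 else 0)) = c e"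
proof -
  have "(\<Sum>e'\<in>E. c e' * (if e = e' then 1 else 0)) = (\<Sum>e'\<in>E. if e = e' then c e' else 0)"
    "(\<Sum>e'\<in>E. c e' * (if e' = e then 1 else 0)) = (\<Sum>e'\<in>E. if e' = e then c e' else 0)"
    by (auto intro!: sum.cong)
  then show "(\<Sum>e'\<in>E. c e' * (if e = e' then 1 else 0)) = c e" "(\<Sum>e'\<in>E. c e' * (if e' = e then 1 else 0)) = c e"
    using assms finite_basis by simp_all
qed

lemma basis_expansion:
  assumes "u \<in> Hom C \<one> A"
  shows "(\<Sum>e\<in>E. scalar_of C (d e \<cdot> u) \<odot> e) = u"
proof -
  have "u \<in> span E"
    using assms db by (simp add: dual_bases_def)
  then obtain c where u: "u = (\<Sum>e\<in>E. c e \<odot> e)"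
    using span_finite[OF finite_basis] by auto
  have "scalar_of C (d e \<cdot> u) = c e" if "e \<in> E" for e
  proof -
    have "d e \<cdot> u = (\<Sum>e'\<in>E. c e' \<odot> (d e \<cdot> e'))"
      unfolding u using that by (intro cmp_sum_right) (auto intro: dual_basis_in_Hom basis_in_Hom)
    then have "scalar_of C (d e \<cdot> u) = (\<Sum>e'\<in>E. c e' * scalar_of C (d e \<cdot> e'))"
      using that by (auto intro!: scalar_of_sum cmp_in_Hom[where B = A] dual_basis_in_Hom basis_in_Hom)
    also have "\<dots> = c e"
      using that sum_delta_unit[of e c] by (simp add: scalar_of_dual_basis)
    finally show ?thesis .
  qed
  then show ?thesis
    by (subst (2) u) simp
qed

lemma dual_basis_expansion:
  assumes "v \<in> Hom C A \<one>"
  shows "(\<Sum>e\<in>E. scalar_of C (v \<cdot> e) \<odot> d e) = v"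
proof -
  have "v \<in> span (d ` E)"
    using assms db by (simp add: dual_bases_def)
  then obtain c where "v = (\<Sum>x\<in>d ` E. c x \<odot> x)"
    using span_finite[of "d ` E"] finite_basis by auto
  then have v: "v = (\<Sum>e\<in>E. c (d e) \<odot> d e)"
    by (simp add: sum.reindex[OF inj_on_dual_basis])
  have "scalar_of C (v \<cdot> e) = c (d e)" if "e \<in> E" for e
  proof -
    have "v \<cdot> e = (\<Sum>e'\<in>E. c (d e') \<odot> (d e' \<cdot> e))"
      unfolding v using that by (intro cmp_sum_left) (auto intro: dual_basis_in_Hom basis_in_Hom)
    then have "scalar_of C (v \<cdot> e) = (\<Sum>e'\<in>E. c (d e') * scalar_of C (d e' \<cdot> e))"
      using that by (auto intro!: scalar_of_sum cmp_in_Hom[where B = A] dual_basis_in_Hom basis_in_Hom)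
    also have "\<dots> = c (d e)"
      using that sum_delta_unit[of e "\<lambda>e. c (d e)"] by (simp add: scalar_of_dual_basis)
    finally show ?thesis .
  qed
  then show ?thesis
    by (subst (2) v) simp
qed

text \<open>Completeness relation: summing over a basis removes the cut between \<open>v\<close> and
  \<open>u\<close>. For the trefoil it merges two matrix coefficients into one coefficient of a
  product.\<close>

lemma scalar_of_basis_expansion:
  assumes "u \<in> Hom C \<one> A" "v \<in> Hom C A \<one>"
  shows "(\<Sum>e\<in>E. scalar_of C (v \<cdot> e) * scalar_of C (d e \<cdot> u)) = scalar_of C (v \<cdot> u)"
proof -
  have "v \<cdot> u = v \<cdot> (\<Sum>e\<in>E. scalar_of C (d e \<cdot> u) \<odot> e)"
    by (simp add: basis_expansion assms)
  also have "\<dots> = (\<Sum>e\<in>E. scalar_of C (d e \<cdot> u) \<odot> (v \<cdot> e))"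
    using assms by (intro cmp_sum_right) (auto intro: basis_in_Hom)
  also have "scalar_of C \<dots> = (\<Sum>e\<in>E. scalar_of C (d e \<cdot> u) * scalar_of C (v \<cdot> e))"
    using assms by (intro scalar_of_sum) (auto intro!: cmp_in_Hom[OF basis_in_Hom])
  finally show ?thesis
    by (simp add: mult.commute)
qed

text \<open>Makes partial traces independent of the basis that the choice operator picks.\<close>

lemma dual_bases_sum_unique:
  assumes db': "dual_bases C \<one> A E' d'"
    and lin: "\<And>v. v \<in> Hom C A \<one> \<Longrightarrow> linear_on_Hom \<one> A (F v)"
      "\<And>u. u \<in> Hom C \<one> A \<Longrightarrow> linear_on_Hom A \<one> (\<lambda>v. F v u)"
  shows "(\<Sum>e\<in>E'. F (d' e) e) = (\<Sum>e\<in>E. F (d e) e)"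
proof -
  note H' = semisimple_stable_autonomous_category.dual_bases_unit[OF semisimple_stable_autonomous_category_axioms db']
  let ?s = "scalar_of C"
  \<comment> \<open>Covector and vector are both expanded in \<open>E\<close> and its dual.\<close>
  have "F (d' e) e = (\<Sum>x\<in>E. \<Sum>y\<in>E. (?s (d y \<cdot> e) * ?s (d' e \<cdot> x)) \<odot> F (d x) y)" if "e \<in> E'" for e
  proof -
    note [simp] = H'(2,3)[OF that]
    have "F (d' e) e = F (\<Sum>x\<in>E. ?s (d' e \<cdot> x) \<odot> d x) e"
      by (simp add: dual_basis_expansion)
    also have "\<dots> = (\<Sum>x\<in>E. ?s (d' e \<cdot> x) \<odot> F (d x) e)"
      by (intro linear_on_Hom_sum[OF lin(2)] dual_basis_in_Hom) simp
    also have "\<dots> = (\<Sum>x\<in>E. ?s (d' e \<cdot> x) \<odot> (\<Sum>y\<in>E. ?s (d y \<cdot> e) \<odot> F (d x) y))"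
    proof (rule sum.cong)
      fix x assume x: "x \<in> E"
      have "F (d x) e = F (d x) (\<Sum>y\<in>E. ?s (d y \<cdot> e) \<odot> y)"
        by (simp add: basis_expansion)
      also have "\<dots> = (\<Sum>y\<in>E. ?s (d y \<cdot> e) \<odot> F (d x) y)"
        by (intro linear_on_Hom_sum[OF lin(1)] basis_in_Hom dual_basis_in_Hom x)
      finally show "?s (d' e \<cdot> x) \<odot> F (d x) e = ?s (d' e \<cdot> x) \<odot> (\<Sum>y\<in>E. ?s (d y \<cdot> e) \<odot> F (d x) y)"
        by simp
    qed simp
    finally show ?thesis
      by (simp add: scale_sum_right mult.commute)
  qed
  then have "(\<Sum>e\<in>E'. F (d' e) e) = (\<Sum>e\<in>E'. \<Sum>x\<in>E. \<Sum>y\<in>E. (?s (d y \<cdot> e) * ?s (d' e \<cdot> x)) \<odot> F (d x) y)"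
    by simp
  also have "\<dots> = (\<Sum>x\<in>E. \<Sum>y\<in>E. \<Sum>e\<in>E'. (?s (d y \<cdot> e) * ?s (d' e \<cdot> x)) \<odot> F (d x) y)"
    by (subst sum.swap, rule sum.cong[OF refl], rule sum.swap)
  \<comment> \<open>The sum over \<open>E'\<close> multiplies the base change matrix by its inverse;
    this is the completeness relation for \<open>E'\<close>.\<close>
  also have "\<dots> = (\<Sum>x\<in>E. \<Sum>y\<in>E. ?s (d y \<cdot> x) \<odot> F (d x) y)"
    by (intro sum.cong refl, subst scale_sum_left[symmetric],
        subst semisimple_stable_autonomous_category.scalar_of_basis_expansion
          [OF semisimple_stable_autonomous_category_axioms db'])
      (auto intro: basis_in_Hom dual_basis_in_Hom)
  also have "\<dots> = (\<Sum>x\<in>E. \<Sum>y\<in>E. if y = x then F (d x) y else 0)"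
    by (intro sum.cong refl) (auto simp: scalar_of_dual_basis)
  also have "\<dots> = (\<Sum>e\<in>E. F (d e) e)"
    using finite_basis by simp
  finally show ?thesis .
qed

text \<open>Removes the basis picked in \<open>trace_on\<close>: its vectors are expanded in
  \<open>E\<close>, the sums are exchanged, and the coordinates of \<open>\<phi> e\<close>
  reassemble.\<close>

lemma trace_on_eq:
  assumes "linear_on_Hom \<one> A \<phi>" "\<And>u. u \<in> Hom C \<one> A \<Longrightarrow> \<phi> u \<in> Hom C \<one> A"
  shows "trace_on (scal C) (Hom C \<one> A) \<phi> = (\<Sum>e\<in>E. scalar_of C (d e \<cdot> \<phi> e))"
proof -
  define B where "B = (SOME B. independent B \<and> span B = Hom C \<one> A)"
  have "independent B \<and> span B = Hom C \<one> A"
    unfolding B_def by (rule someI_ex) (use db in \<open>auto simp: dual_bases_def\<close>)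
  then have ind: "independent B" and span: "span B = Hom C \<one> A"
    by auto
  have fin: "finite B"
    using independent_span_bound[OF finite_basis ind] db span span_superset[of B]
    by (auto simp: dual_bases_def)
  have B: "v \<in> Hom C \<one> A" if "v \<in> B" for v
    using that span span_superset by blast
  let ?s = "scalar_of C" and ?r = "representation B"
  have "trace_on (scal C) (Hom C \<one> A) \<phi> = (\<Sum>v\<in>B. ?r (\<phi> v) v)"
    by (simp add: trace_on_def B_def Let_def)
  also have "\<dots> = (\<Sum>v\<in>B. \<Sum>e\<in>E. ?s (d e \<cdot> v) * ?r (\<phi> e) v)"
  proof (rule sum.cong)
    fix v assume v: "v \<in> B"
    have "\<phi> v = \<phi> (\<Sum>e\<in>E. ?s (d e \<cdot> v) \<odot> e)"
      by (simp add: basis_expansion B v)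
    also have "\<dots> = (\<Sum>e\<in>E. ?s (d e \<cdot> v) \<odot> \<phi> e)"
      by (intro linear_on_Hom_sum[OF assms(1)] basis_in_Hom)
    finally show "?r (\<phi> v) v = (\<Sum>e\<in>E. ?s (d e \<cdot> v) * ?r (\<phi> e) v)"
      using ind by (simp add: representation_sum representation_scale span assms(2) basis_in_Hom)
  qed simp
  also have "\<dots> = (\<Sum>e\<in>E. \<Sum>v\<in>B. ?r (\<phi> e) v * ?s (d e \<cdot> v))"
    by (subst sum.swap) (simp add: mult.commute)
  also have "\<dots> = (\<Sum>e\<in>E. ?s (d e \<cdot> \<phi> e))"
  proof (rule sum.cong)
    fix e assume e: "e \<in> E"
    have "d e \<cdot> \<phi> e = d e \<cdot> (\<Sum>v\<in>B. ?r (\<phi> e) v \<odot> v)"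
      using ind fin e by (simp add: sum_representation_eq span assms(2) basis_in_Hom)
    also have "\<dots> = (\<Sum>v\<in>B. ?r (\<phi> e) v \<odot> (d e \<cdot> v))"
      by (rule cmp_sum_right[OF dual_basis_in_Hom[OF e] B])
    finally show "(\<Sum>v\<in>B. ?r (\<phi> e) v * ?s (d e \<cdot> v)) = ?s (d e \<cdot> \<phi> e)"
      using scalar_of_sum[of B "\<lambda>v. d e \<cdot> v" "?r (\<phi> e)"] cmp_in_Hom[OF B dual_basis_in_Hom[OF e]]
      by simp
  qed simp
  finally show ?thesis .
qed

end

end

section \<open>Duality for words\<close>

context symmetric_monoidal_category
begin

lemma wid_wtensor_wid_wtensor [simp]: "wok f \<Longrightarrow> wid C X \<boxtimes> (wid C Y \<boxtimes> f) = wid C (X @ Y) \<boxtimes> f"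
  by (subst wtensor_assoc[symmetric]) simp_all

lemma whisker:
  "\<lbrakk>wok f; wok g; wsrc g = wtgt f\<rbrakk> \<Longrightarrow> (g \<bullet> f) \<boxtimes> wid C X = (g \<boxtimes> wid C X) \<bullet> (f \<boxtimes> wid C X)"
  "\<lbrakk>wok f; wok g; wsrc g = wtgt f\<rbrakk> \<Longrightarrow> wid C X \<boxtimes> (g \<bullet> f) = (wid C X \<boxtimes> g) \<bullet> (wid C X \<boxtimes> f)"
  by (simp_all add: wtensor_wcomp)

lemma wtensor_wcomp_assoc:
  "\<lbrakk>wok f; wok f'; wok g; wok g'; wsrc f' = wtgt f; wsrc g' = wtgt g; wok x; wtgt x = wsrc f @ wsrc g\<rbrakk>
   \<Longrightarrow> (f' \<boxtimes> g') \<bullet> ((f \<boxtimes> g) \<bullet> x) = ((f' \<bullet> f) \<boxtimes> (g' \<bullet> g)) \<bullet> x"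
  by (subst wcomp_reassoc[OF wtensor_wcomp]) simp_all

lemma interchange:
  assumes "wok f" "wok g" "wsrc f = X" "wtgt f = X'" "wsrc g = Y" "wtgt g = Y'"
  shows "(f \<boxtimes> wid C Y') \<bullet> (wid C X \<boxtimes> g) = f \<boxtimes> g" "(wid C X' \<boxtimes> g) \<bullet> (f \<boxtimes> wid C Y) = f \<boxtimes> g"
  using assms by (simp_all add: wtensor_wcomp)

text \<open>By naturality a strand \<open>W\<close> crosses a state on \<open>X @ Y\<close> as if it
  crossed the empty word; hence reaching the place between \<open>X\<close> and \<open>Y\<close>
  from the left or from the right gives the same morphism.\<close>

lemma slide_coev:
  assumes [simp]: "wok u" "wsrc u = []" "wtgt u = X @ Y"
  shows "(wsymm C W X \<boxtimes> wid C Y) \<bullet> (wid C W \<boxtimes> u) = (wid C X \<boxtimes> wsymm C Y W) \<bullet> (u \<boxtimes> wid C W)"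
proof (rule wcomp_left_cancel[of "wid C X \<boxtimes> wsymm C W Y"])
  have "(wid C X \<boxtimes> wsymm C W Y) \<bullet> ((wsymm C W X \<boxtimes> wid C Y) \<bullet> (wid C W \<boxtimes> u))
      = wsymm C W (X @ Y) \<bullet> (wid C W \<boxtimes> u)"
    by (simp add: wsymm_append_right)
  also have "\<dots> = u \<boxtimes> wid C W"
    by (subst wsymm_natural) simp_all
  also have "\<dots> = (wid C X \<boxtimes> wsymm C W Y) \<bullet> ((wid C X \<boxtimes> wsymm C Y W) \<bullet> (u \<boxtimes> wid C W))"
    by (simp add: wtensor_wcomp_assoc)
  finally show "(wid C X \<boxtimes> wsymm C W Y) \<bullet> ((wsymm C W X \<boxtimes> wid C Y) \<bullet> (wid C W \<boxtimes> u))
      = (wid C X \<boxtimes> wsymm C W Y) \<bullet> ((wid C X \<boxtimes> wsymm C Y W) \<bullet> (u \<boxtimes> wid C W))" .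
qed simp_all

lemma slide_eval:
  assumes [simp]: "wok v" "wtgt v = []" "wsrc v = X @ Y"
  shows "(v \<boxtimes> wid C W) \<bullet> (wid C X \<boxtimes> wsymm C W Y) = (wid C W \<boxtimes> v) \<bullet> (wsymm C X W \<boxtimes> wid C Y)"
proof (rule wcomp_right_cancel[of "wid C X \<boxtimes> wsymm C Y W"])
  have "((wid C W \<boxtimes> v) \<bullet> (wsymm C X W \<boxtimes> wid C Y)) \<bullet> (wid C X \<boxtimes> wsymm C Y W)
      = (wid C W \<boxtimes> v) \<bullet> wsymm C (X @ Y) W"
    by (simp add: wsymm_append_left)
  also have "\<dots> = v \<boxtimes> wid C W"
    using wsymm_natural[of v "wid C W"] by simp
  also have "\<dots> = ((v \<boxtimes> wid C W) \<bullet> (wid C X \<boxtimes> wsymm C W Y)) \<bullet> (wid C X \<boxtimes> wsymm C Y W)"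
    by (simp add: wtensor_wcomp)
  finally show "((v \<boxtimes> wid C W) \<bullet> (wid C X \<boxtimes> wsymm C W Y)) \<bullet> (wid C X \<boxtimes> wsymm C Y W)
      = ((wid C W \<boxtimes> v) \<bullet> (wsymm C X W \<boxtimes> wid C Y)) \<bullet> (wid C X \<boxtimes> wsymm C Y W)"
    by (rule sym)
qed simp_all

lemma jn_single_single: "jn [A] [B] = WMor [A \<diamondop> B] [A, B] (idm C (A \<diamondop> B))"
  by (simp add: jn_single)

lemma wmor_wsymm_single: "wmor (wsymm C [A] [B]) = \<gamma> A B"
proof -
  have unjoin: "unjoin C [A] [B] = idm C (A \<diamondop> B)"
    unfolding unjoin_def by (rule inv_mor_eqI) (simp add: inverse_pair_def id_in_Hom cmp_id_left[OF id_in_Hom])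
  show ?thesis
    by (simp add: wsymm_def unjoin cmp_id_left[OF symm_in_Hom] cmp_id_right[OF symm_in_Hom])
qed

end

context autonomous_category
begin

lemma wcoev_sel [simp]: "wsrc (wcoev C A) = []" "wtgt (wcoev C A) = [dual C A, A]" "wmor (wcoev C A) = \<Lambda> A"
  by (simp_all add: wcoev_def)

lemma weval_sel [simp]: "wsrc (weval C A) = [A, dual C A]" "wtgt (weval C A) = []" "wmor (weval C A) = \<epsilon> A"
  by (simp_all add: weval_def)

lemma wok_wcoev [simp]: "wok (wcoev C A)"
  by (simp add: wok_def coev_in_Hom)

lemma wok_weval [simp]: "wok (weval C A)"
  by (simp add: wok_def eval_in_Hom)

lemma jn_single_pair: "jn [A] [B, D] = jn [A, B] [D] \<bullet> winv C (asc [A] [B] [D])"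
proof -
  have "jn [A] [B] \<odot>\<odot> wid C [D] = wid C [A \<diamondop> B \<diamondop> D]"
    by (rule wmor_eqI) (simp_all add: jn_single_single tensor_id)
  then show ?thesis
    using jn_snoc[of "[A]" "[B]" D] by simp
qed

lemma wzigzag: "(weval C A \<boxtimes> wid C [A]) \<bullet> (wid C [A] \<boxtimes> wcoev C A) = wid C [A]"
proof -
  let ?f = "lw [A] \<bullet> (weval C A \<odot>\<odot> wid C [A]) \<bullet> winv C (asc [A] [dual C A] [A]) \<bullet> (wid C [A] \<odot>\<odot> wcoev C A) \<bullet> winv C (rw [A])"
  have "(weval C A \<boxtimes> wid C [A]) \<bullet> (wid C [A] \<boxtimes> wcoev C A) = ?f"
    by (simp add: wtensor_eq jn_single_pair)
  also have "\<dots> = wid C [A]"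
    by (rule wmor_eqI)
      (simp_all add: lw_def asc_def rw_def winv_def zigzag del: wcomp_assoc)
  finally show ?thesis .
qed

lemma wzigzag_dual: "(wid C [dual C A] \<boxtimes> weval C A) \<bullet> (wcoev C A \<boxtimes> wid C [dual C A]) = wid C [dual C A]"
proof -
  let ?A' = "dual C A"
  let ?f = "rw [?A'] \<bullet> (wid C [?A'] \<odot>\<odot> weval C A) \<bullet> asc [?A'] [A] [?A'] \<bullet> (wcoev C A \<odot>\<odot> wid C [?A']) \<bullet> winv C (lw [?A'])"
  have "(wid C [?A'] \<boxtimes> weval C A) \<bullet> (wcoev C A \<boxtimes> wid C [?A']) = ?f"
    by (simp add: wtensor_eq jn_single_pair winv_wcomp)
  also have "\<dots> = wid C [?A']"
    by (rule wmor_eqI)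
      (simp_all add: lw_def asc_def rw_def winv_def zigzag_dual del: wcomp_assoc)
  finally show ?thesis .
qed

end

context stable_autonomous_category
begin

declare dual_dual [simp]

lemma wsymm_wcoev: "wsymm C [dual C A] [A] \<bullet> wcoev C A = wcoev C (dual C A)"
  by (rule wmor_eqI) (simp_all add: wmor_wsymm_single symm_coev)

lemma wzigzag': "(weval C (dual C A) \<boxtimes> wid C [dual C A]) \<bullet> (wid C [dual C A] \<boxtimes> wcoev C (dual C A)) = wid C [dual C A]"
  "(wid C [A] \<boxtimes> weval C (dual C A)) \<bullet> (wcoev C (dual C A) \<boxtimes> wid C [A]) = wid C [A]"
  using wzigzag[of "dual C A"] wzigzag_dual[of "dual C A"] by simp_all

text \<open>Stability is assumed for coevaluations only. An evaluation satisfying a zig-zag identity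
  with a given coevaluation is unique, and the left side \<open>c\<close> satisfies one with the
  coevaluation of the dual.\<close>

lemma wsymm_weval: "weval C A \<bullet> wsymm C [dual C A] [A] = weval C (dual C A)"
proof -
  let ?B = "wid C [A]" and ?D = "wid C [dual C A]"
  let ?e = "weval C (dual C A)" and ?n = "wcoev C (dual C A)"
  define c where "c = weval C A \<bullet> wsymm C [dual C A] [A]"
  have [simp]: "wok c" "wsrc c = [dual C A, A]" "wtgt c = []"
    by (simp_all add: c_def)
  have "(c \<boxtimes> ?D) \<bullet> (?D \<boxtimes> ?n) = (weval C A \<boxtimes> ?D) \<bullet> ((wsymm C [dual C A] [A] \<boxtimes> ?D) \<bullet> (?D \<boxtimes> ?n))"
    by (simp add: c_def whisker)
  also have "\<dots> = (weval C A \<boxtimes> ?D) \<bullet> ((?B \<boxtimes> wsymm C [dual C A] [dual C A]) \<bullet> (?n \<boxtimes> ?D))"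
    by (subst slide_coev) simp_all
  also have "\<dots> = (?D \<boxtimes> weval C A) \<bullet> ((wsymm C [A] [dual C A] \<boxtimes> ?D) \<bullet> (?n \<boxtimes> ?D))"
    by (subst wcomp_reassoc[OF slide_eval]) simp_all
  also have "\<dots> = (?D \<boxtimes> weval C A) \<bullet> (wcoev C A \<boxtimes> ?D)"
    using wsymm_wcoev[of "dual C A"] by (simp add: wtensor_wcomp)
  finally have *: "(c \<boxtimes> ?D) \<bullet> (?D \<boxtimes> ?n) = ?D"
    by (simp add: wzigzag_dual)
  \<comment> \<open>Uniqueness: a zig-zag with the genuine evaluation is inserted below
    \<open>c\<close>, and interchanging the two evaluations lets \<open>c\<close> meet
    \<open>?n\<close>.\<close>
  have "c = c \<bullet> (?D \<boxtimes> ((?B \<boxtimes> ?e) \<bullet> (?n \<boxtimes> ?B)))"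
    by (simp add: wzigzag')
  also have "\<dots> = c \<bullet> ((wid C [dual C A, A] \<boxtimes> ?e) \<bullet> (?D \<boxtimes> (?n \<boxtimes> ?B)))"
    by (simp add: whisker)
  also have "\<dots> = ?e \<bullet> ((c \<boxtimes> wid C [dual C A, A]) \<bullet> (?D \<boxtimes> (?n \<boxtimes> ?B)))"
    using interchange[of c ?e "[dual C A, A]" "[]" "[dual C A, A]" "[]"]
    by (subst (1 2) wcomp_reassoc[where h = "c \<boxtimes> ?e"]) simp_all
  also have "(c \<boxtimes> wid C [dual C A, A]) \<bullet> (?D \<boxtimes> (?n \<boxtimes> ?B)) = ((c \<boxtimes> ?D) \<bullet> (?D \<boxtimes> ?n)) \<boxtimes> ?B"
    by (simp add: whisker)
  also have "?e \<bullet> \<dots> = ?e"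
    by (simp add: *)
  finally show ?thesis
    by (simp add: c_def)
qed

end

section \<open>Linearity, simple objects and partial traces\<close>

context semisimple_stable_autonomous_category
begin

lemma wscal_sel [simp]: "wsrc (wscal C c f) = wsrc f" "wtgt (wscal C c f) = wtgt f"
  "wmor (wscal C c f) = c \<odot> wmor f"
  by (simp_all add: wscal_def)

lemma wok_wscal [simp]: "wok f \<Longrightarrow> wok (wscal C c f)"
  by (simp add: wok_def)

lemma wscal_wscal [simp]: "wscal C c (wscal C c' f) = wscal C (c * c') f"
  by (rule wmor_eqI) simp_all

lemma wscal_1 [simp]: "wscal C 1 f = f"
  by (rule wmor_eqI) simp_all

lemma wcomp_wscal_left [simp]: "\<lbrakk>wok f; wok g; wsrc g = wtgt f\<rbrakk> \<Longrightarrow> wscal C c g \<bullet> f = wscal C c (g \<bullet> f)"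
  by (rule wmor_eqI) (auto simp: wok_def cmp_scal_left)

lemma wcomp_wscal_right [simp]: "\<lbrakk>wok f; wok g; wsrc g = wtgt f\<rbrakk> \<Longrightarrow> g \<bullet> wscal C c f = wscal C c (g \<bullet> f)"
  by (rule wmor_eqI) (auto simp: wok_def cmp_scal_right)

lemma ntensor_wscal:
  "\<lbrakk>wok f; wok g\<rbrakk> \<Longrightarrow> wscal C c f \<odot>\<odot> g = wscal C c (f \<odot>\<odot> g)"
  "\<lbrakk>wok f; wok g\<rbrakk> \<Longrightarrow> f \<odot>\<odot> wscal C c g = wscal C c (f \<odot>\<odot> g)"
  by (auto intro!: wmor_eqI simp: wok_def tensor_scal_left tensor_scal_right)

lemma wtensor_wscal [simp]:
  "\<lbrakk>wok f; wok g\<rbrakk> \<Longrightarrow> wscal C c f \<boxtimes> g = wscal C c (f \<boxtimes> g)"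
  "\<lbrakk>wok f; wok g\<rbrakk> \<Longrightarrow> f \<boxtimes> wscal C c g = wscal C c (f \<boxtimes> g)"
  by (simp_all add: wtensor_eq ntensor_wscal)

abbreviation sval where "sval f \<equiv> scalar_of C (wmor f)"

lemma sval_wscal_wid [simp]: "sval (wscal C c (wid C [])) = c"
  by simp

lemma wscal_sval: "\<lbrakk>wok f; wsrc f = []; wtgt f = []\<rbrakk> \<Longrightarrow> f = wscal C (sval f) (wid C [])"
  by (rule wmor_eqI) (simp_all add: wok_def scalar_of_eq)

lemma sval_wscal: "\<lbrakk>wok f; wsrc f = []; wtgt f = []\<rbrakk> \<Longrightarrow> sval (wscal C c f) = c * sval f"
  by (subst wscal_sval[of f]) (simp_all del: wscal_sel)

section \<open>Schur's lemma, bending, and invariants of two factors\<close>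

lemma schur:
  assumes "a \<in> S" "wok h" "wsrc h = [a]" "wtgt h = [a]"
  obtains c where "h = wscal C c (wid C [a])"
proof -
  have "wmor h \<in> Hom C a a"
    using assms by (simp add: wok_def)
  then obtain c where "wmor h = c \<odot> idm C a"
    using Hom_same[OF assms(1)] by blast
  then have "h = wscal C c (wid C [a])"
    using assms by (intro wmor_eqI) simp_all
  then show ?thesis
    by (rule that)
qed

text \<open>Zero is written as \<open>wscal C 0 h\<close>: this keeps both words, and the scalar can
  be moved out of any diagram by rewriting.\<close>

lemma schur_distinct:
  "\<lbrakk>a \<in> S; b \<in> S; a \<noteq> b; wok h; wsrc h = [a]; wtgt h = [b]\<rbrakk> \<Longrightarrow> h = wscal C 0 h"
  using Hom_distinct[of a b] by (auto intro!: wmor_eqI simp: wok_def)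

lemma weval_wcoev: "weval C (dual C b) \<bullet> wcoev C b = wscal C (rank C b) (wid C [])"
  using wscal_sval[of "weval C (dual C b) \<bullet> wcoev C b"] by (simp add: rank_def)

text \<open>By stability both orientations of the closed loop have the same value.\<close>

lemma weval_wcoev': "weval C b \<bullet> wcoev C (dual C b) = wscal C (rank C b) (wid C [])"
proof -
  have "weval C b \<bullet> wcoev C (dual C b) = (weval C b \<bullet> wsymm C [dual C b] [b]) \<bullet> wcoev C b"
    by (simp add: wsymm_wcoev)
  then show ?thesis
    unfolding wsymm_weval weval_wcoev .
qed

text \<open>The duality between states on \<open>X @ [b]\<close> and morphisms from the dual of
  \<open>b\<close> to \<open>X\<close>: bending the last factor down and up again is a
  zig-zag.\<close>

lemma bend_state:
  assumes [simp]: "wok u" "wsrc u = []" "wtgt u = X @ [b]"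
  shows "u = (((wid C X \<boxtimes> weval C b) \<bullet> (u \<boxtimes> wid C [dual C b])) \<boxtimes> wid C [b]) \<bullet> wcoev C b"
proof -
  have "(((wid C X \<boxtimes> weval C b) \<bullet> (u \<boxtimes> wid C [dual C b])) \<boxtimes> wid C [b]) \<bullet> wcoev C b
    = (wid C X \<boxtimes> (weval C b \<boxtimes> wid C [b])) \<bullet> ((u \<boxtimes> wid C [dual C b, b]) \<bullet> wcoev C b)"
    by (simp add: whisker)
  also have "(u \<boxtimes> wid C [dual C b, b]) \<bullet> wcoev C b = (wid C (X @ [b]) \<boxtimes> wcoev C b) \<bullet> u"
    using interchange[of u "wcoev C b" "[]" "X @ [b]" "[]" "[dual C b, b]"] by simp
  also have "(wid C X \<boxtimes> (weval C b \<boxtimes> wid C [b])) \<bullet> \<dots>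
    = (wid C X \<boxtimes> ((weval C b \<boxtimes> wid C [b]) \<bullet> (wid C [b] \<boxtimes> wcoev C b))) \<bullet> u"
    by (simp add: whisker)
  finally show ?thesis
    by (simp add: wzigzag)
qed

lemma bend_costate:
  assumes [simp]: "wok v" "wtgt v = []" "wsrc v = X @ [b]"
  shows "v = weval C (dual C b) \<bullet> (((v \<boxtimes> wid C [dual C b]) \<bullet> (wid C X \<boxtimes> wcoev C (dual C b))) \<boxtimes> wid C [b])"
proof -
  have "weval C (dual C b) \<bullet> (((v \<boxtimes> wid C [dual C b]) \<bullet> (wid C X \<boxtimes> wcoev C (dual C b))) \<boxtimes> wid C [b])
    = (weval C (dual C b) \<bullet> (v \<boxtimes> wid C [dual C b, b])) \<bullet> (wid C X \<boxtimes> (wcoev C (dual C b) \<boxtimes> wid C [b]))"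
    by (simp add: whisker)
  also have "weval C (dual C b) \<bullet> (v \<boxtimes> wid C [dual C b, b]) = v \<bullet> (wid C (X @ [b]) \<boxtimes> weval C (dual C b))"
    using interchange[of v "weval C (dual C b)" "X @ [b]" "[]" "[dual C b, b]" "[]"] by simp
  also have "\<dots> \<bullet> (wid C X \<boxtimes> (wcoev C (dual C b) \<boxtimes> wid C [b]))
    = v \<bullet> (wid C X \<boxtimes> ((wid C [b] \<boxtimes> weval C (dual C b)) \<bullet> (wcoev C (dual C b) \<boxtimes> wid C [b])))"
    by (simp add: whisker)
  finally show ?thesis
    by (simp add: wzigzag')
qed

text \<open>Bending makes \<open>u\<close> a morphism between two simple objects, where Schur's
  lemma decides.\<close>

lemma state_pair:
  assumes "a \<in> S" "b \<in> S" and [simp]: "wok u" "wsrc u = []" "wtgt u = [a, b]"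
  shows "if a = dual C b then \<exists>c. u = wscal C c (wcoev C b) else u = wscal C 0 u"
proof -
  define h where "h = (wid C [a] \<boxtimes> weval C b) \<bullet> (u \<boxtimes> wid C [dual C b])"
  have h [simp]: "wok h" "wsrc h = [dual C b]" "wtgt h = [a]"
    by (simp_all add: h_def)
  have u: "u = (h \<boxtimes> wid C [b]) \<bullet> wcoev C b"
    using bend_state[of u "[a]" b] by (simp add: h_def)
  show ?thesis
  proof (cases "a = dual C b")
    case True
    then obtain c where "h = wscal C c (wid C [a])"
      using schur[OF \<open>a \<in> S\<close>, of h] by auto
    then show ?thesis
      using True u by auto
  next
    case False
    then have "h = wscal C 0 h"
      using assms(1,2) by (intro schur_distinct[of "dual C b" a] dual_in) auto
    then have "u = (wscal C 0 h \<boxtimes> wid C [b]) \<bullet> wcoev C b"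
      using u by metis
    also have "\<dots> = wscal C 0 u"
      by (simp add: u[symmetric])
    finally show ?thesis
      using False by simp
  qed
qed

lemma costate_pair:
  assumes "a \<in> S" "b \<in> S" and [simp]: "wok v" "wsrc v = [a, b]" "wtgt v = []"
  shows "if a = dual C b then \<exists>c. v = wscal C c (weval C (dual C b)) else v = wscal C 0 v"
proof -
  define h where "h = (v \<boxtimes> wid C [dual C b]) \<bullet> (wid C [a] \<boxtimes> wcoev C (dual C b))"
  have h [simp]: "wok h" "wsrc h = [a]" "wtgt h = [dual C b]"
    by (simp_all add: h_def)
  have v: "v = weval C (dual C b) \<bullet> (h \<boxtimes> wid C [b])"
    using bend_costate[of v "[a]" b] by (simp add: h_def)
  show ?thesis
  proof (cases "a = dual C b")
    case True
    then obtain c where "h = wscal C c (wid C [a])"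
      using schur[OF \<open>a \<in> S\<close>, of h] by auto
    then show ?thesis
      using True v by auto
  next
    case False
    then have "h = wscal C 0 h"
      using assms(1,2) by (intro schur_distinct[of a "dual C b"] dual_in) auto
    then have "v = weval C (dual C b) \<bullet> (wscal C 0 h \<boxtimes> wid C [b])"
      using v by metis
    also have "\<dots> = wscal C 0 v"
      by (simp add: v[symmetric])
    finally show ?thesis
      using False by simp
  qed
qed

text \<open>A vanishing coevaluation would annihilate the zig-zag, hence the identity of
  \<open>b\<close>.\<close>

lemma wcoev_nonzero:
  assumes "b \<in> S"
  shows "\<Lambda> b \<noteq> 0"
proof
  assume "\<Lambda> b = 0"
  then have "wcoev C b = wscal C 0 (wcoev C b)"
    by (intro wmor_eqI) simp_all
  then have "wid C [b] = (weval C b \<boxtimes> wid C [b]) \<bullet> (wid C [b] \<boxtimes> wscal C 0 (wcoev C b))"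
    by (metis wzigzag)
  then have "idm C b = wmor ((weval C b \<boxtimes> wid C [b]) \<bullet> (wid C [b] \<boxtimes> wscal C 0 (wcoev C b)))"
    by (metis wid_sel(3) oprod.simps(2) foldl.simps(1))
  then have "idm C b = 0"
    by (simp del: wcomp_sel)
  then show False
    using id_nonzero[OF assms] by simp
qed

lemma word_of_Hom:
  "f \<in> Hom C (oprod C X) (oprod C Y) \<Longrightarrow> wok (WMor X Y f)"
  by (simp add: wok_def)

text \<open>If the loop were 0, every covector on the pair, being a multiple of the evaluation,
  would kill the coevaluation; expansion in a basis would then make the coevaluation 0.\<close>

lemma rank_nonzero:
  assumes b: "b \<in> S"
  shows "rank C b \<noteq> 0"
proof
  assume r: "rank C b = 0"
  let ?A = "oprod C [dual C b, b]"
  obtain E d where "dual_bases C \<one> ?A E d"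
    using exists_dual_bases[OF uno_in] by blast
  note db = this and E = basis_expansion[OF this] dual_bases_unit[OF this]
  have "scalar_of C (d e \<cdot> \<Lambda> b) = 0" if e: "e \<in> E" for e
  proof -
    define v where "v = WMor [dual C b, b] [] (d e)"
    have [simp]: "wok v" "wsrc v = [dual C b, b]" "wtgt v = []"
      using E(4)[OF e] by (simp_all add: v_def wok_def)
    obtain c where "v = wscal C c (weval C (dual C b))"
      using costate_pair[of "dual C b" b v] b dual_in by auto
    then have "v \<bullet> wcoev C b = wscal C 0 (wid C [])"
      using weval_wcoev[of b] r by simp
    then have "wmor (v \<bullet> wcoev C b) = wmor (wscal C 0 (wid C []))"
      by (rule arg_cong)
    then show ?thesis
      by (simp add: v_def)
  qed
  then have "\<Lambda> b = 0"
    using E(1)[of "\<Lambda> b"] coev_in_Hom[of b] by simp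
  then show False
    using wcoev_nonzero[OF b] by simp
qed

lemma dual_bases_pair:
  assumes b: "b \<in> S"
  shows "dual_bases C \<one> (oprod C [b, dual C b]) {wmor (wcoev C (dual C b))} (\<lambda>_. wmor (wscal C (inverse (rank C b)) (weval C b)))"
proof (rule dual_basesI)
  let ?n = "wcoev C (dual C b)" and ?v = "wscal C (inverse (rank C b)) (weval C b)"
  have "?v \<bullet> ?n = wid C []"
    by (simp add: weval_wcoev' rank_nonzero[OF b])
  then have "wmor (?v \<bullet> ?n) = wmor (wid C [])"
    by (rule arg_cong)
  then have "wmor ?v \<cdot> wmor ?n = idm C \<one>"
    unfolding wcomp_sel wid_sel by simp
  then show "wmor ?v \<cdot> e' = (if e = e' then idm C \<one> else 0)" if "e \<in> {wmor ?n}" "e' \<in> {wmor ?n}" for e e'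
    using that by (simp del: wscal_sel wcoev_sel)
  show "Hom C \<one> (oprod C [b, dual C b]) \<subseteq> span {wmor ?n}"
  proof
    fix u assume "u \<in> Hom C \<one> (oprod C [b, dual C b])"
    then obtain c where "WMor [] [b, dual C b] u = wscal C c ?n"
      using state_pair[of b "dual C b" "WMor [] [b, dual C b] u"] b dual_in by (auto simp: wok_def)
    then have "wmor (WMor [] [b, dual C b] u) = wmor (wscal C c ?n)"
      by (rule arg_cong)
    then have "u = c \<odot> wmor ?n"
      by simp
    then show "u \<in> span {wmor ?n}"
      by (simp add: span_base span_scale)
  qed
  show "Hom C (oprod C [b, dual C b]) \<one> \<subseteq> span ((\<lambda>_. wmor ?v) ` {wmor ?n})"
  proof
    fix v assume "v \<in> Hom C (oprod C [b, dual C b]) \<one>"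
    then obtain c where "WMor [b, dual C b] [] v = wscal C c (weval C b)"
      using costate_pair[of b "dual C b" "WMor [b, dual C b] [] v"] b dual_in by (auto simp: wok_def)
    then have "wmor (WMor [b, dual C b] [] v) = wmor (wscal C c (weval C b))"
      by (rule arg_cong)
    then have "v = (c * rank C b) \<odot> wmor ?v"
      using rank_nonzero[OF b] by simp
    then show "v \<in> span ((\<lambda>_. wmor ?v) ` {wmor ?n})"
      using span_scale[OF span_base[of "wmor ?v" "{wmor ?v}"], of "c * rank C b"] by simp
  qed
qed (use coev_in_Hom[of "dual C b"] eval_in_Hom[of b] id_nonzero[OF uno_in] in auto)

text \<open>With the empty basis a partial trace becomes an empty sum; the dual function
  \<open>d\<close> is then arbitrary.\<close>

lemma dual_bases_pair_empty:
  assumes "a \<in> S" "b \<in> S" "a \<noteq> dual C b"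
  shows "dual_bases C \<one> (oprod C [a, b]) {} d"
proof (rule dual_basesI)
  show "Hom C \<one> (oprod C [a, b]) \<subseteq> span {}"
  proof
    fix u assume "u \<in> Hom C \<one> (oprod C [a, b])"
    then have "WMor [] [a, b] u = wscal C 0 (WMor [] [a, b] u)"
      using state_pair[of a b "WMor [] [a, b] u"] assms by (simp add: wok_def)
    then have "wmor (WMor [] [a, b] u) = wmor (wscal C 0 (WMor [] [a, b] u))"
      by (rule arg_cong)
    then show "u \<in> span {}"
      by simp
  qed
  show "Hom C (oprod C [a, b]) \<one> \<subseteq> span (d ` {})"
  proof
    fix v assume "v \<in> Hom C (oprod C [a, b]) \<one>"
    then have "WMor [a, b] [] v = wscal C 0 (WMor [a, b] [] v)"
      using costate_pair[of a b "WMor [a, b] [] v"] assms by (simp add: wok_def)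
    then have "wmor (WMor [a, b] [] v) = wmor (wscal C 0 (WMor [a, b] [] v))"
      by (rule arg_cong)
    then show "v \<in> span (d ` {})"
      by simp
  qed
qed (use id_nonzero[OF uno_in] in auto)

section \<open>Partial traces to the unit object\<close>

lemma linear_on_Hom_wtensor_wid:
  "linear_on_Hom (oprod C X) (oprod C X') (\<lambda>v. wmor (WMor X X' v \<boxtimes> wid C Y))"
proof -
  let ?A = "oprod C X" and ?A' = "oprod C X'" and ?B = "oprod C Y"
  have "linear_on_Hom ?A ?A' (\<lambda>v. wmor (jn X' Y) \<cdot> ((v \<otimes> idm C ?B) \<cdot> wmor (winv C (jn X Y))))"
  proof (rule linear_on_Hom_comp[of _ _ "\<lambda>v. v \<otimes> idm C ?B" "?A \<diamondop> ?B" "?A' \<diamondop> ?B" "\<lambda>v. wmor (jn X' Y) \<cdot> (v \<cdot> wmor (winv C (jn X Y)))"])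
    show "linear_on_Hom ?A ?A' (\<lambda>v. v \<otimes> idm C ?B)"
      by (simp add: linear_on_Hom_def tensor_add_left[OF _ _ id_in_Hom] tensor_scal_left[OF _ id_in_Hom])
    have 1: "wmor (winv C (jn X Y)) \<in> Hom C (oprod C (X @ Y)) (?A \<diamondop> ?B)"
      using wok_winv[OF wiso_jn, of X Y] by (simp add: wok_def)
    have 2: "wmor (jn X' Y) \<in> Hom C (?A' \<diamondop> ?B) (oprod C (X' @ Y))"
      using wok_wiso[OF wiso_jn, of X' Y] by (simp add: wok_def)
    show "linear_on_Hom (?A \<diamondop> ?B) (?A' \<diamondop> ?B) (\<lambda>v. wmor (jn X' Y) \<cdot> (v \<cdot> wmor (winv C (jn X Y))))"
      by (rule linear_on_Hom_comp[OF linear_on_Hom_cmp(2)[OF 1] linear_on_Hom_cmp(1)[OF 2]])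
        (rule cmp_in_Hom[OF 1])
  qed (auto intro: tensor_in_Hom id_in_Hom)
  then show ?thesis
    by (simp add: linear_on_Hom_def wtensor_eq word_of_Hom add_in_Hom)
qed

text \<open>Replaces the pair picked by the choice operator by any convenient one. The case of an
  empty left word is enough, because \<open>full_trace\<close> always contracts the leading
  factor.\<close>

lemma partial_trace_unit:
  assumes db: "dual_bases C \<one> (oprod C G) E d"
    and [simp]: "wok \<phi>" "wsrc \<phi> = G @ Y" "wtgt \<phi> = G @ Y"
  shows "partial_trace C [] G Y [] \<phi>
    = WMor Y Y (\<Sum>e\<in>E. wmor ((WMor G [] (d e) \<boxtimes> wid C Y) \<bullet> (\<phi> \<bullet> (WMor [] G e \<boxtimes> wid C Y))))"
proof -
  let ?F = "\<lambda>v e. wmor ((WMor G [] v \<boxtimes> wid C Y) \<bullet> (\<phi> \<bullet> (WMor [] G e \<boxtimes> wid C Y)))"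
  have [simp]: "wok (WMor G [] v)" if "v \<in> Hom C (oprod C G) \<one>" for v
    using that by (simp add: wok_def)
  have [simp]: "wok (WMor [] G u)" if "u \<in> Hom C \<one> (oprod C G)" for u
    using that by (simp add: wok_def)
  have Hom: "wmor (f \<boxtimes> wid C Y) \<in> Hom C (oprod C (wsrc f @ Y)) (oprod C (wtgt f @ Y))" if "wok f" for f
    using wok_wtensor[OF that wok_wid, of Y] by (simp add: wok_def)
  have Hom_v: "wmor (WMor G [] v \<boxtimes> wid C Y) \<in> Hom C (oprod C (G @ Y)) (oprod C Y)"
    if "v \<in> Hom C (oprod C G) \<one>" for v
    using Hom[of "WMor G [] v"] that by simp
  have Hom_u: "wmor (WMor [] G u \<boxtimes> wid C Y) \<in> Hom C (oprod C Y) (oprod C (G @ Y))"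
    if "u \<in> Hom C \<one> (oprod C G)" for u
    using Hom[of "WMor [] G u"] that by simp
  have phi: "wmor \<phi> \<in> Hom C (oprod C (G @ Y)) (oprod C (G @ Y))"
    using \<open>wok \<phi>\<close> by (simp add: wok_def)
  \<comment> \<open>A summand is bilinear in covector and vector, which is the condition for
    independence of the basis.\<close>
  have lin2: "linear_on_Hom (oprod C G) \<one> (\<lambda>v. ?F v u)" if u: "u \<in> Hom C \<one> (oprod C G)" for u
  proof -
    have "wmor (\<phi> \<bullet> (WMor [] G u \<boxtimes> wid C Y)) \<in> Hom C (oprod C Y) (oprod C (G @ Y))"
      using Hom[of "WMor [] G u"] u by (auto intro: cmp_in_Hom[OF _ phi])
    from linear_on_Hom_comp[OF linear_on_Hom_wtensor_wid[of G "[]" Y] linear_on_Hom_cmp(2)[OF this, where D = "oprod C Y"]]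
    show ?thesis
      using Hom_v by simp
  qed
  have lin1: "linear_on_Hom \<one> (oprod C G) (?F v)" if v: "v \<in> Hom C (oprod C G) \<one>" for v
  proof -
    have "wmor ((WMor G [] v \<boxtimes> wid C Y) \<bullet> \<phi>) \<in> Hom C (oprod C (G @ Y)) (oprod C Y)"
      using Hom[of "WMor G [] v"] v by (auto intro: cmp_in_Hom[OF phi])
    from linear_on_Hom_comp[OF linear_on_Hom_wtensor_wid[of "[]" G Y] linear_on_Hom_cmp(1)[OF this, where A = "oprod C Y"]]
    have "linear_on_Hom \<one> (oprod C G) (\<lambda>u. wmor ((WMor G [] v \<boxtimes> wid C Y) \<bullet> \<phi>) \<cdot> wmor (WMor [] G u \<boxtimes> wid C Y))"
      using Hom_u by (simp del: wcomp_sel)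
    moreover have "?F v u = wmor ((WMor G [] v \<boxtimes> wid C Y) \<bullet> \<phi>) \<cdot> wmor (WMor [] G u \<boxtimes> wid C Y)"
      if "u \<in> Hom C \<one> (oprod C G)" for u
      unfolding wcomp_sel(3)[symmetric] using that v by simp
    ultimately show ?thesis
      by (simp add: linear_on_Hom_def add_in_Hom del: wcomp_sel)
  qed
  define Ed where "Ed = (SOME (E, d). dual_bases C (oprod C []) (oprod C G) E d)"
  obtain E' d' where Ed: "Ed = (E', d')"
    by fastforce
  have "case Ed of (E, d) \<Rightarrow> dual_bases C (oprod C []) (oprod C G) E d"
    unfolding Ed_def by (rule someI[of _ "(E, d)"]) (use db in simp)
  then have db': "dual_bases C \<one> (oprod C G) E' d'"
    by (simp add: Ed)
  have "partial_trace C [] G Y [] \<phi> = WMor Y Y (\<Sum>e\<in>E'. ?F (d' e) e)"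
    unfolding partial_trace_def Ed_def[symmetric] Ed Let_def prod.case
    using basis_in_Hom[OF db'] dual_basis_in_Hom[OF db']
    by (auto intro!: sum.cong simp del: wcomp_sel)
  then show ?thesis
    using dual_bases_sum_unique[OF db db' lin1 lin2] by simp
qed

lemma scalar_of_sum1:
  "(\<And>i. i \<in> I \<Longrightarrow> f i \<in> Hom C \<one> \<one>) \<Longrightarrow> scalar_of C (\<Sum>i\<in>I. f i) = (\<Sum>i\<in>I. scalar_of C (f i))"
  using scalar_of_sum[of I f "\<lambda>_. 1"] by simp

lemma
  assumes "dual_bases C \<one> (oprod C G) E d" "e \<in> E"
  shows wok_basis: "wok (WMor [] G e)" and wok_dual_basis: "wok (WMor G [] (d e))"
  using basis_in_Hom[OF assms] dual_basis_in_Hom[OF assms] by (simp_all add: wok_def)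

lemma sval_full_trace_one:
  assumes db: "dual_bases C \<one> (oprod C G) E d"
    and [simp]: "wok \<phi>" "wsrc \<phi> = G" "wtgt \<phi> = G"
  shows "sval (full_trace C [G] \<phi>) = (\<Sum>e\<in>E. sval (WMor G [] (d e) \<bullet> (\<phi> \<bullet> WMor [] G e)))"
proof -
  note [simp] = wok_basis[OF db] wok_dual_basis[OF db]
  have "wok (WMor G [] (d e) \<bullet> (\<phi> \<bullet> WMor [] G e))" if "e \<in> E" for e
    using that by simp
  then have "wmor (WMor G [] (d e) \<bullet> (\<phi> \<bullet> WMor [] G e)) \<in> Hom C \<one> \<one>" if "e \<in> E" for e
    using that unfolding wok_def by (simp del: wcomp_sel(3))
  then show ?thesis
    using partial_trace_unit[OF db, of \<phi> "[]"] by (simp add: scalar_of_sum1 del: wcomp_sel(3) cong: sum.cong)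
qed

lemma sval_full_trace_two:
  assumes db: "dual_bases C \<one> (oprod C G) E d" and db': "dual_bases C \<one> (oprod C H) E' d'"
    and [simp]: "wok \<phi>" "wsrc \<phi> = G @ H" "wtgt \<phi> = G @ H"
  shows "sval (full_trace C [G, H] \<phi>) = (\<Sum>e\<in>E. \<Sum>f\<in>E'.
     sval ((WMor G [] (d e) \<boxtimes> WMor H [] (d' f)) \<bullet> (\<phi> \<bullet> (WMor [] G e \<boxtimes> WMor [] H f))))"
proof -
  note [simp] = wok_basis[OF db] wok_dual_basis[OF db] wok_basis[OF db'] wok_dual_basis[OF db']
  define m where "m e = (WMor G [] (d e) \<boxtimes> wid C H) \<bullet> (\<phi> \<bullet> (WMor [] G e \<boxtimes> wid C H))" for e
  have m [simp]: "wok (m e)" "wsrc (m e) = H" "wtgt (m e) = H" if "e \<in> E" for e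
    using that by (simp_all add: m_def)
  have m_Hom: "wmor (m e) \<in> Hom C (oprod C H) (oprod C H)" if "e \<in> E" for e
    using m[OF that] by (simp add: wok_def)
  define \<psi> where "\<psi> = WMor H H (\<Sum>e\<in>E. wmor (m e))"
  have psi [simp]: "wok \<psi>" "wsrc \<psi> = H" "wtgt \<psi> = H"
    by (simp_all add: \<psi>_def wok_def sum_in_Hom m_Hom)
  \<comment> \<open>Insertions into different factors slide past each other, so the two successive
    traces insert simultaneously.\<close>
  have eq: "WMor H [] (d' f) \<bullet> (m e \<bullet> WMor [] H f)
     = (WMor G [] (d e) \<boxtimes> WMor H [] (d' f)) \<bullet> (\<phi> \<bullet> (WMor [] G e \<boxtimes> WMor [] H f))" if "e \<in> E" "f \<in> E'" for e f
  proof -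
    have "WMor H [] (d' f) \<bullet> (m e \<bullet> WMor [] H f) = ((wid C [] \<boxtimes> WMor H [] (d' f)) \<bullet> (WMor G [] (d e) \<boxtimes> wid C H))
        \<bullet> (\<phi> \<bullet> ((WMor [] G e \<boxtimes> wid C H) \<bullet> (wid C [] \<boxtimes> WMor [] H f)))"
      using that by (simp add: m_def)
    then show ?thesis
      using that by (simp add: wtensor_wcomp del: wid_Nil_wtensor)
  qed
  have "full_trace C [G, H] \<phi> = full_trace C [H] \<psi>"
    using partial_trace_unit[OF db, of \<phi> H] by (simp add: \<psi>_def m_def)
  then have "sval (full_trace C [G, H] \<phi>) = (\<Sum>f\<in>E'. sval (WMor H [] (d' f) \<bullet> (\<psi> \<bullet> WMor [] H f)))"
    using sval_full_trace_one[OF db' psi] by (simp del: wcomp_sel(3))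
  also have "\<dots> = (\<Sum>f\<in>E'. \<Sum>e\<in>E. sval (WMor H [] (d' f) \<bullet> (m e \<bullet> WMor [] H f)))"
  proof (rule sum.cong)
    fix f assume f: "f \<in> E'"
    note f_Hom = basis_in_Hom[OF db' f] dual_basis_in_Hom[OF db' f]
    have "wmor (WMor H [] (d' f) \<bullet> (\<psi> \<bullet> WMor [] H f)) = (\<Sum>e\<in>E. wmor (WMor H [] (d' f) \<bullet> (m e \<bullet> WMor [] H f)))"
      using cmp_sum_left1[OF f_Hom(1), of E "\<lambda>e. wmor (m e)" "oprod C H"] m_Hom
        cmp_sum_right1[OF f_Hom(2), of E "\<lambda>e. wmor (m e) \<cdot> f" \<one>] cmp_in_Hom[OF f_Hom(1) m_Hom]
      by (simp add: \<psi>_def)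
    moreover have "wok (WMor H [] (d' f) \<bullet> (m e \<bullet> WMor [] H f))" if "e \<in> E" for e
      using that f by simp
    then have "wmor (WMor H [] (d' f) \<bullet> (m e \<bullet> WMor [] H f)) \<in> Hom C \<one> \<one>" if "e \<in> E" for e
      using that unfolding wok_def by (simp del: wcomp_sel(3))
    ultimately show "sval (WMor H [] (d' f) \<bullet> (\<psi> \<bullet> WMor [] H f)) = (\<Sum>e\<in>E. sval (WMor H [] (d' f) \<bullet> (m e \<bullet> WMor [] H f)))"
      by (simp add: scalar_of_sum1 del: wcomp_sel(3))
  qed simp
  also have "\<dots> = (\<Sum>e\<in>E. \<Sum>f\<in>E'. sval (WMor H [] (d' f) \<bullet> (m e \<bullet> WMor [] H f)))"
    by (rule sum.swap)
  finally show ?thesis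
    by (simp add: eq del: wcomp_sel(3) cong: sum.cong)
qed

primrec wpow where
  "wpow f 0 = wid C []"
| "wpow f (Suc n) = f \<boxtimes> wpow f n"

lemma wpow_sel [simp]:
  "wsrc (wpow f n) = concat (replicate n (wsrc f))" "wtgt (wpow f n) = concat (replicate n (wtgt f))"
  by (induction n) simp_all

lemma wok_wpow [simp]: "wok f \<Longrightarrow> wok (wpow f n)"
  by (induction n) simp_all

lemma concat_replicate_Nil [simp]: "concat (replicate n []) = []"
  by (induction n) simp_all

text \<open>When the invariants of each factor form a line, no sum survives and the full trace is
  one sandwich, whatever the number of generators.\<close>

lemma full_trace_replicate:
  assumes db: "dual_bases C \<one> (oprod C G) {wmor u} (\<lambda>_. wmor v)"
    and uv [simp]: "wok u" "wsrc u = []" "wtgt u = G" "wok v" "wsrc v = G" "wtgt v = []"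
    and "wok \<phi>" "wsrc \<phi> = concat (replicate m G)" "wtgt \<phi> = concat (replicate m G)"
  shows "full_trace C (replicate m G) \<phi> = wpow v m \<bullet> (\<phi> \<bullet> wpow u m)"
  using assms(8-)
proof (induction m arbitrary: \<phi>)
  case (Suc m)
  note [simp] = Suc.prems
  let ?H = "concat (replicate m G)"
  have u: "WMor [] G (wmor u) = u" and v: "WMor G [] (wmor v) = v"
    by (auto intro: wmor_eqI)
  let ?\<psi> = "(v \<boxtimes> wid C ?H) \<bullet> (\<phi> \<bullet> (u \<boxtimes> wid C ?H))"
  have "full_trace C (replicate (Suc m) G) \<phi> = full_trace C (replicate m G) (WMor ?H ?H (wmor ?\<psi>))"
    using partial_trace_unit[OF db, of \<phi> ?H] by (simp add: u v)
  also have "WMor ?H ?H (wmor ?\<psi>) = ?\<psi>"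
    by (rule wmor_eqI) simp_all
  also have "full_trace C (replicate m G) ?\<psi> = wpow v m \<bullet> (?\<psi> \<bullet> wpow u m)"
    by (rule Suc.IH) simp_all
  also have "\<dots> = ((wid C [] \<boxtimes> wpow v m) \<bullet> (v \<boxtimes> wid C ?H)) \<bullet> (\<phi> \<bullet> ((u \<boxtimes> wid C ?H) \<bullet> (wid C [] \<boxtimes> wpow u m)))"
    by simp
  also have "\<dots> = wpow v (Suc m) \<bullet> (\<phi> \<bullet> wpow u (Suc m))"
    by (simp add: wtensor_wcomp del: wid_Nil_wtensor)
  finally show ?case .
qed simp

section \<open>The morphism of a relator\<close>

lemma wpower_simps [simp]: "wpower C b 1 = [b]" "wpower C b (- 1) = [dual C b]"
  by (simp_all add: wpower_def)

text \<open>For exponent -1 no factor is carried through: the strand is absorbed and a new one is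
  created.\<close>

lemma pass_simps: "pass C b 1 = wid C [b, b]" "pass C b (- 1) = wcoev C b \<bullet> weval C b"
  by (simp_all add: pass_def numeral_2_eq_2)

lemma Cons_replicate: "x # replicate n x = replicate n x @ [x]"
  by (induction n) auto

lemma
  assumes "l \<noteq> 0"
  shows pass_sel [simp]: "wsrc (pass C b l) = b # wpower C b l" "wtgt (pass C b l) = wpower C b l @ [b]"
    and wok_pass [simp]: "wok (pass C b l)"
proof -
  obtain n where n: "nat l = Suc n" if "l > 0"
    by (cases "nat l") auto
  obtain m where m: "nat (- l) = Suc m" if "l < 0"
    by (cases "nat (- l)") auto
  have "l > 0 \<or> l < 0"
    using assms by linarith
  then show "wsrc (pass C b l) = b # wpower C b l" "wtgt (pass C b l) = wpower C b l @ [b]" "wok (pass C b l)"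
    using n m Cons_replicate[of b] Cons_replicate[of "dual C b"]
    by (auto simp: pass_def wpower_def Let_def)
qed

text \<open>Excludes exponent 0, for which \<open>pass\<close> takes its negative branch and starts
  at \<open>[b, dual C b]\<close> although the power is empty.\<close>

definition exponents_nonzero :: "(nat \<times> int) list \<Rightarrow> bool" where
  "exponents_nonzero R \<longleftrightarrow> (\<forall>(i, l)\<in>set R. l \<noteq> 0)"

lemma exponents_nonzero_simps [simp]:
  "exponents_nonzero []" "exponents_nonzero ((i, l) # R) \<longleftrightarrow> l \<noteq> 0 \<and> exponents_nonzero R"
  "exponents_nonzero (R @ R') \<longleftrightarrow> exponents_nonzero R \<and> exponents_nonzero R'"
  by (auto simp: exponents_nonzero_def)

lemma relator_word_simps [simp]:
  "relator_word C b [] = []" "relator_word C b ((i, l) # R) = wpower C b l @ relator_word C b R"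
  "relator_word C b (R @ R') = relator_word C b R @ relator_word C b R'"
  by (simp_all add: relator_word_def blocks_def)

lemma
  assumes "exponents_nonzero R"
  shows open_relator_sel [simp]: "wsrc (open_relator C b R) = b # relator_word C b R"
    "wtgt (open_relator C b R) = relator_word C b R @ [b]"
    and wok_open_relator [simp]: "wok (open_relator C b R)"
proof -
  have "wsrc (open_relator C b R) = b # relator_word C b R \<and> wtgt (open_relator C b R) = relator_word C b R @ [b] \<and>
      wok (open_relator C b R)"
    using assms by (induction b R rule: open_relator.induct) auto
  then show "wsrc (open_relator C b R) = b # relator_word C b R"
    "wtgt (open_relator C b R) = relator_word C b R @ [b]" "wok (open_relator C b R)"
    by auto
qed

lemma open_relator_append:
  assumes "exponents_nonzero R" "exponents_nonzero R'"
  shows "open_relator C b (R @ R') = (wid C (relator_word C b R) \<boxtimes> open_relator C b R') \<bullet>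
    (open_relator C b R \<boxtimes> wid C (relator_word C b R'))"
  using assms by (induction b R rule: open_relator.induct) (simp_all add: whisker)

lemma
  assumes "exponents_nonzero R"
  shows closed_relator_sel [simp]: "wsrc (closed_relator C b R) = relator_word C b R"
    "wtgt (closed_relator C b R) = relator_word C b R"
    and wok_closed_relator [simp]: "wok (closed_relator C b R)"
  using assms by (simp_all add: closed_relator_def)

definition strand where
  "strand R b D E = (D \<boxtimes> wid C [b]) \<bullet> (open_relator C b R \<bullet> (wid C [b] \<boxtimes> E))"

lemma closed_relator_sandwich:
  assumes R [simp]: "exponents_nonzero R"
    and [simp]: "wok D" "wsrc D = relator_word C b R" "wtgt D = []"
    and [simp]: "wok E" "wsrc E = []" "wtgt E = relator_word C b R"
    and strand: "strand R b D E = wscal C t (wid C [b])"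
  shows "sval (D \<bullet> (closed_relator C b R \<bullet> E)) = rank C b * rank C b * t"
proof -
  let ?W = "relator_word C b R" and ?b' = "wid C [dual C b]"
  let ?o = "open_relator C b R"
  have D: "D \<bullet> (weval C (dual C b) \<boxtimes> wid C ?W) = weval C (dual C b) \<bullet> (wid C [dual C b, b] \<boxtimes> D)"
    using interchange[of "weval C (dual C b)" D "[dual C b, b]" "[]" ?W "[]"] by simp
  have E: "(wcoev C b \<boxtimes> wid C ?W) \<bullet> E = (wid C [dual C b, b] \<boxtimes> E) \<bullet> wcoev C b"
    using interchange[of "wcoev C b" E "[]" "[dual C b, b]" "[]" ?W] by simp
  have "D \<bullet> ((weval C (dual C b) \<boxtimes> wid C ?W) \<bullet>
        ((?b' \<boxtimes> (wsymm C ?W [b] \<bullet> ?o)) \<bullet> ((wcoev C b \<boxtimes> wid C ?W) \<bullet> E)))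
      = weval C (dual C b) \<bullet> ((wid C [dual C b, b] \<boxtimes> D) \<bullet>
        ((?b' \<boxtimes> (wsymm C ?W [b] \<bullet> ?o)) \<bullet> ((wid C [dual C b, b] \<boxtimes> E) \<bullet> wcoev C b)))"
    by (subst wcomp_reassoc[OF D]) (simp_all add: E)
  also have "\<dots> = weval C (dual C b) \<bullet> ((?b' \<boxtimes> ((wid C [b] \<boxtimes> D) \<bullet> (wsymm C ?W [b] \<bullet> (?o \<bullet> (wid C [b] \<boxtimes> E))))) \<bullet> wcoev C b)"
    by (simp add: whisker)
  \<comment> \<open>Once \<open>D\<close> has closed the relator word, the crossing in the closure
    becomes a crossing with the empty word and disappears.\<close>
  also have "(wid C [b] \<boxtimes> D) \<bullet> (wsymm C ?W [b] \<bullet> (?o \<bullet> (wid C [b] \<boxtimes> E))) = strand R b D E"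
    using wsymm_natural[of D "wid C [b]" "[]" "[b]"]
    by (subst wcomp_reassoc[of _ _ "D \<boxtimes> wid C [b]"]) (simp_all add: strand_def)
  also have "weval C (dual C b) \<bullet> ((?b' \<boxtimes> strand R b D E) \<bullet> wcoev C b) = wscal C (t * rank C b) (wid C [])"
    by (simp add: strand weval_wcoev)
  finally have "D \<bullet> (closed_relator C b R \<bullet> E) = wscal C (rank C b * (t * rank C b)) (wid C [])"
    by (simp add: closed_relator_def)
  then show ?thesis
    by (simp del: wcomp_sel(3))
qed

text \<open>The two parts occupy different factors: \<open>D\<close> may be applied before the
  strand reaches \<open>R'\<close>, and \<open>E'\<close> need not be created earlier than
  that.\<close>

lemma strand_append:
  assumes [simp]: "exponents_nonzero R" "exponents_nonzero R'"
    and [simp]: "wok D" "wsrc D = relator_word C b R" "wtgt D = []"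
    and [simp]: "wok E" "wsrc E = []" "wtgt E = relator_word C b R"
    and [simp]: "wok D'" "wsrc D' = relator_word C b R'" "wtgt D' = []"
    and [simp]: "wok E'" "wsrc E' = []" "wtgt E' = relator_word C b R'"
  shows "strand (R @ R') b (D \<boxtimes> D') (E \<boxtimes> E') = strand R' b D' E' \<bullet> strand R b D E"
proof -
  let ?W = "relator_word C b R" and ?W' = "relator_word C b R'" and ?b = "wid C [b]"
  define g where "g = (D' \<boxtimes> ?b) \<bullet> open_relator C b R'"
  define h where "h = open_relator C b R \<bullet> (?b \<boxtimes> E)"
  have [simp]: "wok g" "wsrc g = b # ?W'" "wtgt g = [b]" "wok h" "wsrc h = [b]" "wtgt h = ?W @ [b]"
    by (simp_all add: g_def h_def)
  have D: "(D \<boxtimes> (D' \<boxtimes> ?b)) \<bullet> (wid C ?W \<boxtimes> open_relator C b R') = D \<boxtimes> g"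
    by (simp add: g_def wtensor_wcomp)
  have E: "(open_relator C b R \<boxtimes> wid C ?W') \<bullet> (?b \<boxtimes> (E \<boxtimes> E')) = h \<boxtimes> E'"
    using wtensor_wcomp[of "?b \<boxtimes> E" "open_relator C b R" E' "wid C ?W'"] by (simp add: h_def)
  have "strand (R @ R') b (D \<boxtimes> D') (E \<boxtimes> E') = (D \<boxtimes> g) \<bullet> (h \<boxtimes> E')"
    by (simp add: strand_def open_relator_append E wcomp_reassoc[OF D])
  also have "h \<boxtimes> E' = (wid C ?W \<boxtimes> (?b \<boxtimes> E')) \<bullet> h"
    using interchange[of h E' "[b]" "?W @ [b]" "[]" ?W'] by simp
  also have "(D \<boxtimes> g) \<bullet> \<dots> = (D \<boxtimes> strand R' b D' E') \<bullet> h"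
    by (subst wtensor_wcomp_assoc) (simp_all add: strand_def g_def)
  also have "D \<boxtimes> strand R' b D' E' = strand R' b D' E' \<bullet> (D \<boxtimes> ?b)"
    using interchange[of D "strand R' b D' E'" ?W "[]" "[b]" "[b]"] by (simp add: strand_def)
  finally show ?thesis
    by (simp add: strand_def h_def)
qed

subsection \<open>Cyclic relators\<close>

text \<open>The partial closure of a crossing is a straight strand: once the crossing is slid past
  the evaluation, a zig-zag remains.\<close>

lemma loop_wsymm:
  "(weval C (dual C b) \<boxtimes> wid C [b]) \<bullet> ((wid C [dual C b] \<boxtimes> wsymm C [b] [b]) \<bullet> (wcoev C b \<boxtimes> wid C [b])) = wid C [b]"
proof -
  let ?b = "wid C [b]" and ?d = "wid C [dual C b]"
  have "(weval C (dual C b) \<boxtimes> ?b) \<bullet> ((?d \<boxtimes> wsymm C [b] [b]) \<bullet> (wcoev C b \<boxtimes> ?b))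
     = (?b \<boxtimes> weval C (dual C b)) \<bullet> ((wsymm C [dual C b] [b] \<boxtimes> ?b) \<bullet> (wcoev C b \<boxtimes> ?b))"
    by (subst wcomp_reassoc[OF slide_eval]) simp_all
  also have "\<dots> = (?b \<boxtimes> weval C (dual C b)) \<bullet> (wcoev C (dual C b) \<boxtimes> ?b)"
    by (simp add: wtensor_wcomp wsymm_wcoev)
  finally show ?thesis
    by (simp add: wzigzag')
qed

text \<open>A positive power is passed unchanged, so the closure involves only the crossing of k
  strands with one. Of this, the crossing with the first factor lies in the loop and is yanked
  straight; the others remain.\<close>

lemma closed_relator_power:
  assumes "k \<ge> 1"
  shows "closed_relator C b [(i, int k)] = wscal C (rank C b) (wsymm C (replicate (k - 1) b) [b])"
proof -
  let ?B = "replicate (k - 1) b" and ?b = "wid C [b]" and ?d = "wid C [dual C b]"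
  have k: "replicate k b = b # ?B" "nat (1 + int k) = Suc k"
    using assms by (cases k; simp)+
  have "closed_relator C b [(i, int k)] = wscal C (rank C b)
     ((weval C (dual C b) \<boxtimes> (?b \<boxtimes> wid C ?B)) \<bullet> ((?d \<boxtimes> wsymm C ([b] @ ?B) [b]) \<bullet> (wcoev C b \<boxtimes> (?b \<boxtimes> wid C ?B))))"
    using assms Cons_replicate[of b "k - 1"] by (simp add: closed_relator_def pass_def wpower_def k)
  also have "(?d \<boxtimes> wsymm C ([b] @ ?B) [b]) \<bullet> (wcoev C b \<boxtimes> (?b \<boxtimes> wid C ?B))
     = (?d \<boxtimes> (wsymm C [b] [b] \<boxtimes> wid C ?B)) \<bullet> ((wid C [dual C b, b] \<boxtimes> wsymm C ?B [b]) \<bullet> (wcoev C b \<boxtimes> wid C (?B @ [b])))"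
    unfolding wsymm_append_left by (simp add: whisker Cons_replicate)
  also have "(wid C [dual C b, b] \<boxtimes> wsymm C ?B [b]) \<bullet> (wcoev C b \<boxtimes> wid C (?B @ [b]))
     = (wcoev C b \<boxtimes> (?b \<boxtimes> wid C ?B)) \<bullet> wsymm C ?B [b]"
    using interchange[of "wcoev C b" "wsymm C ?B [b]" "[]" "[dual C b, b]" "?B @ [b]" "[b] @ ?B"] by simp
  also have "(weval C (dual C b) \<boxtimes> (?b \<boxtimes> wid C ?B)) \<bullet> ((?d \<boxtimes> (wsymm C [b] [b] \<boxtimes> wid C ?B)) \<bullet> \<dots>)
     = (((weval C (dual C b) \<boxtimes> ?b) \<bullet> ((?d \<boxtimes> wsymm C [b] [b]) \<bullet> (wcoev C b \<boxtimes> ?b))) \<boxtimes> wid C ?B) \<bullet> wsymm C ?B [b]"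
    by (simp add: whisker)
  finally show ?thesis
    by (simp add: loop_wsymm)
qed

lemma scalar_of_idm [simp]: "scalar_of C (idm C \<one>) = 1"
  using scalar_of_scal[of 1] by simp

lemma wperm_id: "wperm C Ws [0..<length Ws] = wid C (concat Ws)"
proof (induction Ws)
  case (Cons W Ws)
  have "[0..<length (W # Ws)] = 0 # map Suc [0..<length Ws]"
    by (simp add: map_Suc_upt upt_conv_Cons del: upt_Suc)
  then show ?case
    using Cons by (simp add: comp_def)
qed simp

lemma wperm_last_to_front:
  assumes "k \<ge> 1"
  shows "wperm C (replicate k [b]) ((k - 1) # [0..<k - 1]) = wsymm C (replicate (k - 1) b) [b]"
proof -
  have "concat (replicate n [b]) = replicate n b" for n
    by (induction n) simp_all
  moreover have "map (\<lambda>q. if k - 1 < q then q - 1 else q) [0..<k - 1] = [0..<k - 1]"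
    by (rule map_idI) simp
  ultimately show ?thesis
    using assms wperm_id[of "replicate (k - 1) [b]"] by simp
qed

text \<open>The cycle sends \<open>k\<close> to 1, so the first target slot is filled from the last
  source slot; subtracting 1 passes to positions counted from 0.\<close>

lemma inv_cycle_upt:
  assumes "k \<ge> 1"
  shows "map (\<lambda>j. inv (cycle_of_list [1..<k + 1]) j - 1) [1..<k + 1] = (k - 1) # [0..<k - 1]"
proof -
  let ?\<sigma> = "cycle_of_list [1..<k + 1]"
  have inj: "inj ?\<sigma>"
    by (rule permutes_inj[OF cycle_permutes])
  have split: "[1..<k + 1] = [1..<k] @ [k]" "[1..<k + 1] = 1 # [2..<k + 1]"
    using assms by (simp_all add: upt_conv_Cons numeral_2_eq_2)
  have "map ?\<sigma> [1..<k + 1] = rotate1 [1..<k + 1]"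
    using cyclic_rotation[of "[1..<k + 1]" 1] by simp
  then have "map ?\<sigma> ([1..<k] @ [k]) = [2..<k + 1] @ [1]"
    using split by (metis rotate1.simps(2))
  \<comment> \<open>Listing the arguments with \<open>k\<close> first puts the values in increasing
    order, so the inverse can be read off.\<close>
  then have "map ?\<sigma> (k # [1..<k]) = [1..<k + 1]"
    using split(2) by simp
  then have "map (inv ?\<sigma>) [1..<k + 1] = map (inv ?\<sigma>) (map ?\<sigma> (k # [1..<k]))"
    by simp
  also have "\<dots> = k # [1..<k]"
    unfolding map_map inv_o_cancel[OF inj] by simp
  finally have "map (\<lambda>x. x - 1) (map (inv ?\<sigma>) [1..<k + 1]) = map (\<lambda>x. x - 1) (k # [1..<k])"
    by simp
  moreover have "map (\<lambda>x. x - 1) [1..<k] = [0..<k - 1]"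
    by (rule nth_equalityI) auto
  ultimately show ?thesis
    by (simp add: comp_def)
qed

lemma perm_rep_cycle:
  "k \<ge> 1 \<Longrightarrow> perm_rep C b k (cycle_of_list [1..<k + 1]) = (\<lambda>u. wmor (wsymm C (replicate (k - 1) b) [b]) \<cdot> u)"
  by (rule ext) (simp only: perm_rep_def inv_cycle_upt wperm_last_to_front)

lemma trace_on_wmor:
  assumes db: "dual_bases C \<one> (oprod C X) E d" and [simp]: "wok p" "wsrc p = X" "wtgt p = X"
  shows "trace_on (scal C) (Hom C \<one> (oprod C X)) (\<lambda>u. wmor p \<cdot> u)
    = (\<Sum>e\<in>E. sval (WMor X [] (d e) \<bullet> (p \<bullet> WMor [] X e)))"
proof -
  have p: "wmor p \<in> Hom C (oprod C X) (oprod C X)"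
    using \<open>wok p\<close> by (simp add: wok_def)
  show ?thesis
    using trace_on_eq[OF db linear_on_Hom_cmp(1)[OF p]] cmp_in_Hom[OF _ p] by simp
qed

theorem Q_power:
  assumes k: "k \<ge> 1"
  shows "Q C S 1 [(1, int k)] = (\<Sum>b\<in>S. rank C b * trace_on (scal C) (Hom C \<one> (oprod C (replicate k b)))
     (perm_rep C b k (cycle_of_list [1..<k + 1])))"
  unfolding Q_def
proof (rule sum.cong)
  fix b assume "b \<in> S"
  let ?B = "replicate k b" and ?R = "[(1::nat, int k)]"
  let ?p = "wsymm C (replicate (k - 1) b) [b]"
  have B: "replicate (k - Suc 0) b @ [b] = ?B" "b # replicate (k - Suc 0) b = ?B"
    using k Cons_replicate[of b "k - 1"] by (cases k; simp)+
  obtain E d where db: "dual_bases C \<one> (oprod C ?B) E d"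
    using exists_dual_bases[OF uno_in] by blast
  note [simp] = wok_basis[OF db] wok_dual_basis[OF db]
  have groups: "map (\<lambda>k. group_word C k ?R b) [1..<1 + 1] = [?B]"
    using k by (simp add: group_word_def blocks_def wpower_def)
  have grouping: "grouping C 1 ?R b = wid C ?B"
    using k by (simp add: grouping_def blocks_def wpower_def)
  have "sval (full_trace C [?B] (grouping C 1 ?R b \<bullet> closed_relator C b ?R \<bullet> winv C (grouping C 1 ?R b)))
      = sval (full_trace C [?B] (wscal C (rank C b) ?p))"
    unfolding grouping closed_relator_power[OF k] by (simp add: B)
  also have "\<dots> = (\<Sum>e\<in>E. sval (WMor ?B [] (d e) \<bullet> (wscal C (rank C b) ?p \<bullet> WMor [] ?B e)))"
    by (rule sval_full_trace_one[OF db]) (simp_all add: B)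
  also have "\<dots> = (\<Sum>e\<in>E. rank C b * sval (WMor ?B [] (d e) \<bullet> (?p \<bullet> WMor [] ?B e)))"
    by (rule sum.cong) (simp_all add: sval_wscal B del: wcomp_sel(3) wscal_sel(3))
  also have "\<dots> = rank C b * trace_on (scal C) (Hom C \<one> (oprod C ?B)) (perm_rep C b k (cycle_of_list [1..<k + 1]))"
    unfolding perm_rep_cycle[OF k] by (subst trace_on_wmor[OF db]) (simp_all add: B sum_distrib_left)
  finally show "sval (full_trace C (map (\<lambda>k. group_word C k ?R b) [1..<1 + 1])
        (grouping C 1 ?R b \<bullet> closed_relator C b ?R \<bullet> winv C (grouping C 1 ?R b)))
      = rank C b * trace_on (scal C) (Hom C \<one> (oprod C ?B)) (perm_rep C b k (cycle_of_list [1..<k + 1]))"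
    unfolding groups .
qed simp

lemma sum_self_dual:
  "(\<Sum>b\<in>S. if b = dual C b then f b else 0) = (\<Sum>b\<in>{b\<in>S. b = dual C b}. f b)"
  using finite_simples by (simp add: sum.inter_filter)

text \<open>On two factors the invariants form a line or vanish; for self-dual \<open>b\<close>,
  stability makes the swap fix the coevaluation, so the trace is 1 or 0.\<close>

theorem Q_square: "Q C S 1 [(1, 2)] = (\<Sum>b\<in>{b\<in>S. b = dual C b}. rank C b)"
proof -
  have "trace_on (scal C) (Hom C \<one> (oprod C [b, b])) (\<lambda>u. wmor (wsymm C [b] [b]) \<cdot> u)
      = (if b = dual C b then 1 else 0)" if b: "b \<in> S" for b
  proof (cases "b = dual C b")
    case True
    then have sd: "dual C b = b"
      by simp
    have "WMor [] [b, b] (\<Lambda> b) = wcoev C b"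
      "WMor [b, b] [] (inverse (rank C b) \<odot> \<epsilon> b) = wscal C (inverse (rank C b)) (weval C b)"
      by (simp_all add: wmor_eqI sd)
    moreover have "weval C b \<bullet> (wsymm C [b] [b] \<bullet> wcoev C b) = wscal C (rank C b) (wid C [])"
      using wsymm_wcoev[of b] weval_wcoev[of b] by (simp add: sd)
    ultimately show ?thesis
      using trace_on_wmor[OF dual_bases_pair[OF b, unfolded sd], of "wsymm C [b] [b]"] True rank_nonzero[OF b]
      by (simp add: sd del: wcomp_sel(3))
  next
    case False
    then show ?thesis
      using trace_on_wmor[OF dual_bases_pair_empty[OF b b False], of "wsymm C [b] [b]"] by simp
  qed
  moreover have two: "replicate 2 b = [b, b]" for b
    by (simp add: numeral_2_eq_2)
  ultimately have "Q C S 1 [(1, int 2)] = (\<Sum>b\<in>S. if b = dual C b then rank C b else 0)"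
    using perm_rep_cycle[of 2] by (subst Q_power) (auto intro!: sum.cong simp: two)
  then show ?thesis
    by (simp add: sum_self_dual)
qed

section \<open>Products of commutators and the Klein bottle\<close>

text \<open>The permutation that groups the letters of one commutator by generators.\<close>

definition swap_middle where
  "swap_middle b = wid C [b] \<boxtimes> (wsymm C [b] [dual C b] \<boxtimes> wid C [dual C b])"

lemma swap_middle_sel [simp]:
  "wsrc (swap_middle b) = [b, b, dual C b, dual C b]" "wtgt (swap_middle b) = [b, dual C b, b, dual C b]"
  "wiso (swap_middle b)"
  by (simp_all add: swap_middle_def)

lemma winv_swap_middle: "winv C (swap_middle b) = wid C [b] \<boxtimes> (wsymm C [dual C b] [b] \<boxtimes> wid C [dual C b])"
  by (simp add: swap_middle_def winv_wtensor)

text \<open>The strand created by the first passage is absorbed at once by the second, and the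
  zig-zag turns it into a plain factor.\<close>

lemma pass_inverse_twice:
  "(wid C [dual C b] \<boxtimes> pass C b (- 1)) \<bullet> (pass C b (- 1) \<boxtimes> wid C [dual C b])
   = (wid C [dual C b] \<boxtimes> wcoev C b) \<bullet> (weval C b \<boxtimes> wid C [dual C b])"
proof -
  let ?d = "wid C [dual C b]"
  have "(?d \<boxtimes> pass C b (- 1)) \<bullet> (pass C b (- 1) \<boxtimes> ?d) = (?d \<boxtimes> wcoev C b) \<bullet>
    ((?d \<boxtimes> weval C b) \<bullet> ((wcoev C b \<boxtimes> ?d) \<bullet> (weval C b \<boxtimes> ?d)))"
    by (simp add: pass_simps whisker)
  then show ?thesis
    by (subst (asm) wcomp_reassoc[OF wzigzag_dual]) simp_all
qed

text \<open>The contraction joins one leg of each coevaluation, and a zig-zag leaves a single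
  one.\<close>

lemma coev_coev_eval:
  "(wid C [b] \<boxtimes> (weval C b \<boxtimes> wid C [dual C b])) \<bullet>
     (winv C (swap_middle b) \<bullet> (wcoev C (dual C b) \<boxtimes> wcoev C (dual C b))) = wcoev C (dual C b)"
proof -
  let ?b = "wid C [b]" and ?d = "wid C [dual C b]" and ?n = "wcoev C (dual C b)"
  have "(?b \<boxtimes> (weval C b \<boxtimes> ?d)) \<bullet> (winv C (swap_middle b) \<bullet> (?n \<boxtimes> ?n))
    = (?b \<boxtimes> ((weval C b \<bullet> wsymm C [dual C b] [b]) \<boxtimes> ?d)) \<bullet> ((?n \<boxtimes> wid C [b, dual C b]) \<bullet> ?n)"
    using interchange[of ?n ?n "[]" "[b, dual C b]" "[]" "[b, dual C b]"]
    by (simp add: winv_swap_middle whisker)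
  also have "\<dots> = (((?b \<boxtimes> weval C (dual C b)) \<bullet> (?n \<boxtimes> ?b)) \<boxtimes> ?d) \<bullet> ?n"
    unfolding wsymm_weval by (simp add: whisker)
  finally show ?thesis
    by (simp add: wzigzag')
qed

lemma strand_commutator:
  "strand [(i, 1), (j, 1), (i', -1), (j', -1)] b ((weval C b \<boxtimes> weval C b) \<bullet> swap_middle b)
     (winv C (swap_middle b) \<bullet> (wcoev C (dual C b) \<boxtimes> wcoev C (dual C b))) = wid C [b]"
proof -
  let ?b = "wid C [b]" and ?d = "wid C [dual C b]" and ?n' = "wcoev C (dual C b)"
  let ?e = "weval C b" and ?n = "wcoev C b" and ?s = "wsymm C [b] [dual C b]"
  let ?R = "[(i, 1), (j, 1), (i', -1), (j', -1)]"
  let ?E = "winv C (swap_middle b) \<bullet> (?n' \<boxtimes> ?n')" and ?D = "(?e \<boxtimes> ?e) \<bullet> swap_middle b"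
  have "open_relator C b ?R = wid C [b, b] \<boxtimes> ((?d \<boxtimes> pass C b (- 1)) \<bullet> (pass C b (- 1) \<boxtimes> ?d))"
    by (simp add: pass_simps(1) whisker)
  then have opn: "open_relator C b ?R = (wid C [b, b, dual C b] \<boxtimes> ?n) \<bullet> (wid C [b, b] \<boxtimes> (?e \<boxtimes> ?d))"
    by (simp add: pass_inverse_twice whisker)
  \<comment> \<open>The recreated strand meets the second evaluation of \<open>?D\<close> and is
    straightened, which leaves one evaluation.\<close>
  have "(?D \<boxtimes> ?b) \<bullet> (wid C [b, b, dual C b] \<boxtimes> ?n) = (?e \<boxtimes> (?e \<boxtimes> ?b)) \<bullet>
      (?b \<boxtimes> ((?s \<boxtimes> wid C [dual C b, b]) \<bullet> (wid C [b, dual C b] \<boxtimes> ?n)))"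
    by (simp add: swap_middle_def whisker)
  also have "(?s \<boxtimes> wid C [dual C b, b]) \<bullet> (wid C [b, dual C b] \<boxtimes> ?n) = (wid C [dual C b, b] \<boxtimes> ?n) \<bullet> ?s"
    using interchange[of ?s ?n "[b, dual C b]" "[dual C b, b]" "[]" "[dual C b, b]"] by simp
  also have "(?e \<boxtimes> (?e \<boxtimes> ?b)) \<bullet> (?b \<boxtimes> ((wid C [dual C b, b] \<boxtimes> ?n) \<bullet> ?s))
      = (?e \<boxtimes> (?e \<boxtimes> ?b)) \<bullet> ((wid C [b, dual C b] \<boxtimes> (?b \<boxtimes> ?n)) \<bullet> (?b \<boxtimes> ?s))"
    by (simp add: whisker)
  also have "\<dots> = (?e \<boxtimes> ?b) \<bullet> (?b \<boxtimes> ?s)"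
    by (subst wtensor_wcomp_assoc) (simp_all add: wzigzag)
  finally have D: "(?D \<boxtimes> ?b) \<bullet> (wid C [b, b, dual C b] \<boxtimes> ?n) = (?e \<boxtimes> ?b) \<bullet> (?b \<boxtimes> ?s)" .
  have "strand ?R b ?D ?E = ((?D \<boxtimes> ?b) \<bullet> (wid C [b, b, dual C b] \<boxtimes> ?n)) \<bullet>
      (?b \<boxtimes> ((?b \<boxtimes> (?e \<boxtimes> ?d)) \<bullet> ?E))"
    by (simp add: strand_def opn whisker del: open_relator.simps)
  also have "\<dots> = (?e \<boxtimes> ?b) \<bullet> (?b \<boxtimes> (?s \<bullet> ?n'))"
    unfolding D coev_coev_eval by (simp add: whisker)
  finally show ?thesis
    using wsymm_wcoev[of "dual C b"] by (simp add: wzigzag)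
qed

text \<open>Only the third letter is an inverse, so the strand is absorbed and recreated there. The
  second generator groups two positive letters, whose invariants vanish unless \<open>b\<close> is
  self-dual.\<close>

lemma strand_klein:
  assumes sd [simp]: "dual C b = b"
  shows "strand [(i, 1), (j, 1), (i', -1), (j', 1)] b ((weval C b \<boxtimes> weval C b) \<bullet> swap_middle b)
     (winv C (swap_middle b) \<bullet> (wcoev C b \<boxtimes> wcoev C b)) = wid C [b]"
proof -
  let ?b = "wid C [b]" and ?e = "weval C b" and ?n = "wcoev C b" and ?s = "wsymm C [b] [b]"
  let ?R = "[(i, 1), (j, 1), (i', -1), (j', 1)]"
  let ?E = "winv C (swap_middle b) \<bullet> (?n \<boxtimes> ?n)" and ?D = "(?e \<boxtimes> ?e) \<bullet> swap_middle b"
  have opn: "open_relator C b ?R = (wid C [b, b] \<boxtimes> (?n \<boxtimes> ?b)) \<bullet> (wid C [b, b] \<boxtimes> (?e \<boxtimes> ?b))"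
    by (simp add: pass_simps whisker)
  have "(?D \<boxtimes> ?b) \<bullet> (wid C [b, b] \<boxtimes> (?n \<boxtimes> ?b)) = (?e \<boxtimes> (?e \<boxtimes> ?b)) \<bullet>
      (?b \<boxtimes> (((?s \<boxtimes> ?b) \<bullet> (?b \<boxtimes> ?n)) \<boxtimes> ?b))"
    by (simp add: swap_middle_def whisker)
  also have "(?s \<boxtimes> ?b) \<bullet> (?b \<boxtimes> ?n) = (?b \<boxtimes> ?s) \<bullet> (?n \<boxtimes> ?b)"
    by (rule slide_coev) simp_all
  also have "(?e \<boxtimes> (?e \<boxtimes> ?b)) \<bullet> (?b \<boxtimes> (((?b \<boxtimes> ?s) \<bullet> (?n \<boxtimes> ?b)) \<boxtimes> ?b))
      = (?e \<boxtimes> (?e \<boxtimes> ?b)) \<bullet> ((wid C [b, b] \<boxtimes> (?s \<boxtimes> ?b)) \<bullet> (?b \<boxtimes> (?n \<boxtimes> wid C [b, b])))"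
    by (simp add: whisker)
  also have "\<dots> = (?e \<boxtimes> ((?e \<bullet> ?s) \<boxtimes> ?b)) \<bullet> (?b \<boxtimes> (?n \<boxtimes> wid C [b, b]))"
    by (subst wtensor_wcomp_assoc) (simp_all add: whisker)
  \<comment> \<open>For self-dual \<open>b\<close> the law for evaluations says that the evaluation
    is symmetric.\<close>
  also have "?e \<bullet> ?s = ?e"
    using wsymm_weval[of b] by simp
  also have "?e \<boxtimes> (?e \<boxtimes> ?b) = (?e \<boxtimes> ?b) \<bullet> (?e \<boxtimes> wid C [b, b, b])"
    using interchange(2)[of ?e "?e \<boxtimes> ?b" "[b, b]" "[]" "[b, b, b]" "[b]"] by simp
  also have "((?e \<boxtimes> ?b) \<bullet> (?e \<boxtimes> wid C [b, b, b])) \<bullet> (?b \<boxtimes> (?n \<boxtimes> wid C [b, b]))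
      = (?e \<boxtimes> ?b) \<bullet> (((?e \<boxtimes> ?b) \<bullet> (?b \<boxtimes> ?n)) \<boxtimes> wid C [b, b])"
    by (simp add: whisker)
  also have "\<dots> = ?e \<boxtimes> ?b"
    using wzigzag[of b] by simp
  finally have D: "(?D \<boxtimes> ?b) \<bullet> (wid C [b, b] \<boxtimes> (?n \<boxtimes> ?b)) = ?e \<boxtimes> ?b" .
  have "strand ?R b ?D ?E = ((?D \<boxtimes> ?b) \<bullet> (wid C [b, b] \<boxtimes> (?n \<boxtimes> ?b))) \<bullet>
      (?b \<boxtimes> ((?b \<boxtimes> (?e \<boxtimes> ?b)) \<bullet> ?E))"
    by (simp add: strand_def opn whisker del: open_relator.simps)
  also have "\<dots> = (?e \<boxtimes> ?b) \<bullet> (?b \<boxtimes> ?n)"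
    using coev_coev_eval[of b] by (simp add: D)
  finally show ?thesis
    using wzigzag[of b] by simp
qed

text \<open>Peels one commutator off the front; the remaining positions are shifted by its four
  blocks. This is the induction step for surfaces.\<close>

lemma wperm_swap_middle:
  assumes "wok (wperm C Ws ps)" "wsrc (wperm C Ws ps) = concat Ws"
  shows "wperm C ([a] # [b] # [c] # [d] # Ws) (0 # 2 # 1 # 3 # map (\<lambda>p. p + 4) ps)
    = wid C [a] \<boxtimes> (wsymm C [b] [c] \<boxtimes> (wid C [d] \<boxtimes> wperm C Ws ps))"
proof -
  let ?p = "wperm C Ws ps"
  have shift: "map (\<lambda>q. if 0 < q then q - 1 else q) (map (\<lambda>p. p + 1 + n) ps) = map (\<lambda>p. p + n) ps" for n :: nat
    by simp
  have "wperm C ([a] # [b] # [c] # [d] # Ws) (0 # 2 # 1 # 3 # map (\<lambda>p. p + 4) ps)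
    = wid C [a] \<boxtimes> ((wid C [c] \<boxtimes> (wid C [b] \<boxtimes> (wid C [d] \<boxtimes> ?p))) \<bullet> (wsymm C [b] [c] \<boxtimes> wid C ([d] @ concat Ws)))"
    using assms by (simp add: comp_def numeral_eq_Suc)
  also have "(wid C [c] \<boxtimes> (wid C [b] \<boxtimes> (wid C [d] \<boxtimes> ?p))) \<bullet> (wsymm C [b] [c] \<boxtimes> wid C ([d] @ concat Ws))
    = wsymm C [b] [c] \<boxtimes> (wid C [d] \<boxtimes> ?p)"
    using interchange(2)[of "wsymm C [b] [c]" "wid C [d] \<boxtimes> ?p" "[b, c]" "[c, b]" "[d] @ concat Ws"] assms
    by simp
  finally show ?thesis .
qed

theorem Q_klein_bottle:
  "Q C S 2 [(1, 1), (2, 1), (1, -1), (2, 1)] = of_nat (card {b\<in>S. b = dual C b})"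
proof -
  define R :: "(nat \<times> int) list" where "R = [(1, 1), (2, 1), (1, -1), (2, 1)]"
  have R [simp]: "exponents_nonzero R" "relator_word C b R = [b, b, dual C b, b]" for b
    by (simp_all add: R_def)
  have "sval (full_trace C (map (\<lambda>k. group_word C k R b) [1..<2 + 1])
      (grouping C 2 R b \<bullet> closed_relator C b R \<bullet> winv C (grouping C 2 R b))) = (if b = dual C b then 1 else 0)"
    (is "sval (full_trace C ?Gs ?\<phi>) = _") if b: "b \<in> S" for b
  proof -
    have groups: "?Gs = [[b, dual C b], [b, b]]"
      by (simp add: group_word_def blocks_def upt_rec R_def)
    have "grouping C 2 R b = wperm C ([b] # [b] # [dual C b] # [b] # []) (0 # 2 # 1 # 3 # map (\<lambda>p. p + 4) [])"
      by (simp add: grouping_def blocks_def upt_rec R_def)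
    then have grouping: "grouping C 2 R b = wid C [b] \<boxtimes> (wsymm C [b] [dual C b] \<boxtimes> wid C [b])"
      by (subst (asm) wperm_swap_middle) simp_all
    show ?thesis
    proof (cases "b = dual C b")
      case True
      then have sd: "dual C b = b"
        by simp
      let ?u = "wcoev C b" and ?i = "inverse (rank C b)"
      let ?v = "wscal C ?i (weval C b)"
      have g: "grouping C 2 R b = swap_middle b"
        unfolding grouping swap_middle_def by (simp add: sd)
      have db: "dual_bases C \<one> (oprod C [b, b]) {wmor ?u} (\<lambda>_. wmor ?v)"
        using dual_bases_pair[OF b] by (simp add: sd)
      have w: "WMor [] [b, b] (wmor ?u) = ?u" "WMor [b, b] [] (wmor ?v) = ?v"
        by (auto intro!: wmor_eqI simp: sd)
      have "sval (full_trace C [[b, b], [b, b]] ?\<phi>) = sval ((?v \<boxtimes> ?v) \<bullet> (?\<phi> \<bullet> (?u \<boxtimes> ?u)))"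
        using sval_full_trace_two[OF db db, of ?\<phi>] by (simp add: g w sd del: wcomp_sel(3) wscal_sel(3) wcoev_sel(3))
      also have "\<dots> = sval (((?v \<boxtimes> ?v) \<bullet> swap_middle b) \<bullet> (closed_relator C b R \<bullet> (winv C (swap_middle b) \<bullet> (?u \<boxtimes> ?u))))"
        by (simp add: g sd del: wcomp_sel(3))
      \<comment> \<open>Each of the two dual covectors carries 1/r(b), which cancels the factor from
        the closed strand: every self-dual \<open>b\<close> counts 1.\<close>
      also have "\<dots> = rank C b * rank C b * (?i * ?i)"
      proof (rule closed_relator_sandwich)
        show "strand R b ((?v \<boxtimes> ?v) \<bullet> swap_middle b) (winv C (swap_middle b) \<bullet> (?u \<boxtimes> ?u))
            = wscal C (?i * ?i) (wid C [b])"
          unfolding strand_klein[OF sd, of 1 2 1 2, symmetric] R_def[symmetric] by (simp add: strand_def sd)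
      qed (simp_all add: sd)
      finally show ?thesis
        using rank_nonzero[OF b] True unfolding groups by (simp add: sd field_simps)
    next
      case False
      \<comment> \<open>The group of the second generator has no invariants here, so the inner sum
        is empty.\<close>
      have "sval (full_trace C [[b, dual C b], [b, b]] ?\<phi>) = 0"
        using sval_full_trace_two[OF dual_bases_pair[OF b] dual_bases_pair_empty[OF b b False], of ?\<phi>]
        by (simp add: grouping del: wcomp_sel(3))
      then show ?thesis
        using False unfolding groups by simp
    qed
  qed
  then have "Q C S 2 R = (\<Sum>b\<in>S. if b = dual C b then 1 else 0)"
    unfolding Q_def by (rule sum.cong[OF refl])
  then show ?thesis
    by (simp add: sum_self_dual R_def)
qed

section \<open>Relators of closed orientable surfaces\<close>

definition surface_relator :: "nat \<Rightarrow> (nat \<times> int) list" where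
  "surface_relator n = concat (map (\<lambda>j. [(2*j - 1, 1), (2*j, 1), (2*j - 1, -1), (2*j, -1)]) [1..<n + 1])"

lemma surface_relator_Suc:
  "surface_relator (Suc n) = surface_relator n @ [(2*n + 1, 1), (2*n + 2, 1), (2*n + 1, -1), (2*n + 2, -1)]"
  by (simp add: surface_relator_def)

lemma surface_relator_0 [simp]: "surface_relator 0 = []"
  by (simp add: surface_relator_def)

lemma length_surface_relator [simp]: "length (surface_relator n) = 4 * n"
  by (induction n) (simp_all add: surface_relator_Suc)

lemma exponents_nonzero_surface_relator [simp]: "exponents_nonzero (surface_relator n)"
  by (induction n) (simp_all add: surface_relator_Suc)

lemma concat_replicate_snoc: "concat (replicate (Suc n) X) = concat (replicate n X) @ X"
  by (simp only: Cons_replicate replicate_Suc concat_append) simp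

lemma blocks_surface_relator:
  "blocks C b (surface_relator n) = concat (replicate n [[b], [b], [dual C b], [dual C b]])"
proof (induction n)
  case (Suc n)
  then show ?case
    unfolding concat_replicate_snoc by (simp add: surface_relator_Suc blocks_def)
qed (simp add: blocks_def)

lemma relator_word_surface_relator:
  "relator_word C b (surface_relator n) = concat (replicate n [b, b, dual C b, dual C b])"
  unfolding relator_word_def blocks_surface_relator by (induction n) simp_all

lemma filter_surface_relator:
  "filter (\<lambda>(i, l). i = k) (surface_relator n) = (if 1 \<le> k \<and> k \<le> 2 * n then [(k, 1), (k, -1)] else [])"
proof (induction n)
  case (Suc n)
  consider "k = 2 * n + 1" | "k = 2 * n + 2" | "k < 2 * n + 1 \<or> k > 2 * n + 2"
    by linarith
  then show ?case
    by cases (use Suc in \<open>auto simp: surface_relator_Suc\<close>)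
qed simp

lemma map_group_word_surface_relator:
  "map (\<lambda>k. group_word C k (surface_relator n) b) [1..<2 * n + 1] = replicate (2 * n) [b, dual C b]"
proof -
  have "map (\<lambda>k. group_word C k (surface_relator n) b) [1..<2 * n + 1] = map (\<lambda>k. [b, dual C b]) [1..<2 * n + 1]"
    by (rule map_cong) (auto simp: group_word_def filter_surface_relator blocks_def)
  then show ?thesis
    by (simp add: map_replicate_const)
qed

text \<open>Letter \<open>r\<close> lies in commutator \<open>r div 4\<close>; inside it the two
  generators alternate, so the parity of \<open>r\<close> selects one of them.\<close>

lemma fst_surface_relator_nth: "r < 4 * n \<Longrightarrow> fst (surface_relator n ! r) = 2 * (r div 4) + 1 + r mod 2"
proof (induction n)
  case (Suc n)
  show ?case
  proof (cases "r < 4 * n")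
    case False
    then have "r = 4 * n \<or> r = 4 * n + 1 \<or> r = 4 * n + 2 \<or> r = 4 * n + 3"
      using Suc.prems by arith
    then show ?thesis
      by (elim disjE) (simp_all add: surface_relator_Suc nth_append, presburger+)
  qed (use Suc in \<open>simp add: surface_relator_Suc nth_append\<close>)
qed simp

lemma filter_upt_pair:
  assumes "p < q" "q < n" "\<And>r. r < n \<Longrightarrow> P r \<longleftrightarrow> r = p \<or> r = q"
  shows "filter P [0..<n] = [p, q]"
proof (rule sorted_distinct_set_unique)
  show "set (filter P [0..<n]) = set [p, q]"
    using assms by auto
qed (use assms(1) in \<open>simp_all add: sorted_wrt_filter\<close>)

text \<open>Built from the front, as \<open>wperm\<close> recurses, whereas \<open>grouping\<close>
  lists positions generator by generator; \<open>surface_positions_eq\<close> gives the closed form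
  in which both meet.\<close>

primrec surface_positions :: "nat \<Rightarrow> nat list" where
  "surface_positions 0 = []"
| "surface_positions (Suc n) = 0 # 2 # 1 # 3 # map (\<lambda>p. p + 4) (surface_positions n)"

lemma surface_positions_eq: "surface_positions n = concat (map (\<lambda>j. [4*j, 4*j + 2, 4*j + 1, 4*j + 3]) [0..<n])"
proof (induction n)
  case (Suc n)
  have "[0..<Suc n] = 0 # map Suc [0..<n]"
    by (simp add: map_Suc_upt upt_conv_Cons del: upt_Suc)
  then show ?case
    unfolding surface_positions.simps Suc by (simp add: map_concat comp_def algebra_simps)
qed simp

lemma surface_position_iff:
  fixes r m :: nat
  shows "2 * (r div 4) + 1 + r mod 2 = 2 * m + 1 \<longleftrightarrow> r = 4 * m \<or> r = 4 * m + 2"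
    "2 * (r div 4) + 1 + r mod 2 = 2 * m + 2 \<longleftrightarrow> r = 4 * m + 1 \<or> r = 4 * m + 3"
proof -
  define q s where "q = r div 4" and "s = r mod 4"
  have r: "r = 4 * q + s" and "s < 4"
    by (simp_all add: q_def s_def)
  have q: "r div 4 = q"
    by (simp add: q_def)
  have r2: "r mod 2 = s mod 2"
    unfolding r by presburger
  consider "s = 0" | "s = 1" | "s = 2" | "s = 3"
    using \<open>s < 4\<close> by linarith
  then have "(2 * q + 1 + s mod 2 = 2 * m + 1 \<longleftrightarrow> 4 * q + s = 4 * m \<or> 4 * q + s = 4 * m + 2) \<and>
    (2 * q + 1 + s mod 2 = 2 * m + 2 \<longleftrightarrow> 4 * q + s = 4 * m + 1 \<or> 4 * q + s = 4 * m + 3)"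
    by cases (auto, presburger+)
  then show "2 * (r div 4) + 1 + r mod 2 = 2 * m + 1 \<longleftrightarrow> r = 4 * m \<or> r = 4 * m + 2"
    "2 * (r div 4) + 1 + r mod 2 = 2 * m + 2 \<longleftrightarrow> r = 4 * m + 1 \<or> r = 4 * m + 3"
    unfolding q r2 by (simp_all add: r)
qed

text \<open>The relator keeps all \<open>n\<close> commutators while the number \<open>2 * m\<close>
  of generators grows, so the induction never changes the list that is filtered.\<close>

lemma positions_surface_relator:
  assumes "m \<le> n"
  shows "concat (map (\<lambda>k. filter (\<lambda>r. fst (surface_relator n ! r) = k) [0..<4 * n]) [1..<2 * m + 1])
    = concat (map (\<lambda>j. [4*j, 4*j + 2, 4*j + 1, 4*j + 3]) [0..<m])"
  using assms
proof (induction m)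
  case (Suc m)
  have P: "fst (surface_relator n ! r) = 2 * m + 1 \<longleftrightarrow> r = 4 * m \<or> r = 4 * m + 2"
    "fst (surface_relator n ! r) = 2 * m + 2 \<longleftrightarrow> r = 4 * m + 1 \<or> r = 4 * m + 3" if "r < 4 * n" for r
    unfolding fst_surface_relator_nth[OF that] by (rule surface_position_iff)+
  have "filter (\<lambda>r. fst (surface_relator n ! r) = 2 * m + 1) [0..<4 * n] = [4 * m, 4 * m + 2]"
    by (rule filter_upt_pair[OF _ _ P(1)]) (use Suc.prems in simp_all)
  moreover have "filter (\<lambda>r. fst (surface_relator n ! r) = 2 * m + 2) [0..<4 * n] = [4 * m + 1, 4 * m + 3]"
    by (rule filter_upt_pair[OF _ _ P(2)]) (use Suc.prems in simp_all)
  moreover have "[1..<2 * Suc m + 1] = [1..<2 * m + 1] @ [2 * m + 1, 2 * m + 2]"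
    by simp
  ultimately show ?case
    using Suc by simp
qed simp

lemma wpow_snoc: "wok f \<Longrightarrow> wpow f (Suc n) = wpow f n \<boxtimes> f"
proof (induction n)
  case (Suc n)
  then have "wpow f (Suc (Suc n)) = f \<boxtimes> (wpow f n \<boxtimes> f)"
    by (metis wpow.simps(2))
  then show ?case
    using Suc.prems by simp
qed simp

lemma wpow_wcomp: "\<lbrakk>wok f; wok g; wsrc g = wtgt f\<rbrakk> \<Longrightarrow> wpow (g \<bullet> f) n = wpow g n \<bullet> wpow f n"
  by (induction n) (simp_all add: wtensor_wcomp)

lemma wiso_wpow [simp]: "wiso f \<Longrightarrow> wiso (wpow f n)"
  by (induction n) simp_all

lemma winv_wpow: "wiso f \<Longrightarrow> winv C (wpow f n) = wpow (winv C f) n"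
  by (induction n) (simp_all add: winv_wtensor)

lemma wpow_double: "wok f \<Longrightarrow> wpow f (2 * n) = wpow (f \<boxtimes> f) n"
  by (induction n) simp_all

lemma grouping_surface_relator: "grouping C (2 * n) (surface_relator n) b = wpow (swap_middle b) n"
proof -
  have "wperm C (concat (replicate n [[b], [b], [dual C b], [dual C b]])) (surface_positions n) = wpow (swap_middle b) n"
  proof (induction n)
    case (Suc n)
    have "concat (concat (replicate n [[b], [b], [dual C b], [dual C b]])) = concat (replicate n [b, b, dual C b, dual C b])"
      by (induction n) simp_all
    then show ?case
      using wperm_swap_middle[of "concat (replicate n [[b], [b], [dual C b], [dual C b]])" "surface_positions n" b b "dual C b" "dual C b"]
      by (simp add: Suc swap_middle_def del: wperm.simps)
  qed simp
  then show ?thesis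
    using positions_surface_relator[of n n]
    by (simp add: grouping_def blocks_surface_relator surface_positions_eq)
qed

lemma strand_surface_relator:
  assumes comm: "\<And>i j. strand [(i, 1), (j, 1), (i, -1), (j, -1)] b D E = wscal C c (wid C [b])"
    and [simp]: "wok D" "wsrc D = [b, b, dual C b, dual C b]" "wtgt D = []"
    and [simp]: "wok E" "wsrc E = []" "wtgt E = [b, b, dual C b, dual C b]"
  shows "strand (surface_relator n) b (wpow D n) (wpow E n) = wscal C (c ^ n) (wid C [b])"
proof (induction n)
  case 0
  then show ?case
    by (simp add: strand_def)
next
  case (Suc n)
  show ?case
    using Suc by (simp add: surface_relator_Suc wpow_snoc strand_append relator_word_surface_relator comm
        mult.commute del: wpow.simps)
qed

theorem Q_surface:
  "Q C S (2 * n) (surface_relator n) = (\<Sum>b\<in>S. rank C b powi (- 2 * (int n - 1)))"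
  unfolding Q_def
proof (rule sum.cong)
  fix b assume b: "b \<in> S"
  let ?R = "surface_relator n" and ?k = "swap_middle b"
  let ?u = "wcoev C (dual C b)" and ?i = "inverse (rank C b)"
  define v where "v = wscal C ?i (weval C b)"
  have [simp]: "wok v" "wsrc v = [b, dual C b]" "wtgt v = []"
    by (simp_all add: v_def)
  let ?D = "(v \<boxtimes> v) \<bullet> ?k" and ?E = "winv C ?k \<bullet> (?u \<boxtimes> ?u)"
  let ?\<phi> = "wpow ?k n \<bullet> closed_relator C b ?R \<bullet> winv C (wpow ?k n)"
  \<comment> \<open>The traces see one pair per generator, the grouping permutation one quadruple
    per commutator.\<close>
  have G: "concat (replicate (2 * n) [b, dual C b]) = concat (replicate n [b, dual C b, b, dual C b])"
    by (induction n) simp_all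
  \<comment> \<open>Each commutator uses two dual covectors, hence two factors 1/r(b).\<close>
  have "strand [(i, 1), (j, 1), (i, -1), (j, -1)] b ?D ?E = wscal C (?i * ?i) (wid C [b])" for i j
    unfolding strand_commutator[of i j i j b, symmetric] by (simp add: v_def strand_def del: open_relator.simps)
  then have strand: "strand ?R b (wpow ?D n) (wpow ?E n) = wscal C ((?i * ?i) ^ n) (wid C [b])"
    by (rule strand_surface_relator) simp_all
  have "full_trace C (replicate (2 * n) [b, dual C b]) ?\<phi> = wpow v (2 * n) \<bullet> (?\<phi> \<bullet> wpow ?u (2 * n))"
    by (rule full_trace_replicate[OF dual_bases_pair[OF b, folded v_def]]) (simp_all add: G relator_word_surface_relator)
  also have "\<dots> = wpow ?D n \<bullet> (closed_relator C b ?R \<bullet> wpow ?E n)"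
    by (simp add: wpow_double wpow_wcomp winv_wpow relator_word_surface_relator G)
  finally have "sval (full_trace C (replicate (2 * n) [b, dual C b]) ?\<phi>) = rank C b * rank C b * (?i * ?i) ^ n"
    using closed_relator_sandwich[OF _ _ _ _ _ _ _ strand]
    by (simp add: relator_word_surface_relator del: wcomp_sel(3))
  \<comment> \<open>In the exponent 2 - 2n, the 2 comes from the closed strand and each of the 2n
    generators contributes -1.\<close>
  also have "\<dots> = rank C b powi (- 2 * (int n - 1))"
  proof -
    have "rank C b powi (- 2 * (int n - 1)) = rank C b powi 2 * rank C b powi (- int (2 * n))"
      using rank_nonzero[OF b] by (subst power_int_add[symmetric]) (simp_all add: algebra_simps)
    also have "\<dots> = rank C b ^ 2 * ?i ^ (2 * n)"
      unfolding power_int_minus power_int_of_nat power_inverse by simp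
    finally show ?thesis
      by (simp add: power2_eq_square power_mult)
  qed
  finally show "sval (full_trace C (map (\<lambda>k. group_word C k ?R b) [1..<2 * n + 1])
      (grouping C (2 * n) ?R b \<bullet> closed_relator C b ?R \<bullet> winv C (grouping C (2 * n) ?R b)))
    = rank C b powi (- 2 * (int n - 1))"
    unfolding map_group_word_surface_relator grouping_surface_relator .
qed simp

end

section \<open>The trefoil relator\<close>

context semisimple_stable_autonomous_category
begin

text \<open>Letters 1, 3, 5 belong to x and 2, 4, 6 to y: letters 2 and 3 are exchanged, then letter
  5 moves in front of the two y-letters before it.\<close>

definition trefoil_grouping where
  "trefoil_grouping b = (wid C [b, b] \<boxtimes> (wsymm C [b, dual C b] [dual C b] \<boxtimes> wid C [dual C b])) \<bullet>
  (wid C [b] \<boxtimes> (wsymm C [b] [b] \<boxtimes> wid C [dual C b, dual C b, dual C b]))"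

lemma trefoil_grouping_sel [simp]: "wiso (trefoil_grouping b)"
  "wsrc (trefoil_grouping b) = [b, b, b, dual C b, dual C b, dual C b]"
  "wtgt (trefoil_grouping b) = [b, b, dual C b, b, dual C b, dual C b]"
  by (simp_all add: trefoil_grouping_def)

lemma winv_trefoil_grouping:
  "winv C (trefoil_grouping b) = (wid C [b] \<boxtimes> (wsymm C [b] [b] \<boxtimes> wid C [dual C b, dual C b, dual C b])) \<bullet>
    (wid C [b, b] \<boxtimes> (wsymm C [dual C b] [b, dual C b] \<boxtimes> wid C [dual C b]))"
  by (simp add: trefoil_grouping_def winv_wcomp winv_wtensor)

context
  fixes b :: 'o and p q u v :: "('o, 'm) wmor"
  assumes p [simp]: "wok p" "wsrc p = [b, b, dual C b]" "wtgt p = []"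
    and q [simp]: "wok q" "wsrc q = [b, dual C b, dual C b]" "wtgt q = []"
    and u [simp]: "wok u" "wsrc u = []" "wtgt u = [b, b, dual C b]"
    and v [simp]: "wok v" "wsrc v = []" "wtgt v = [b, dual C b, dual C b]"
begin

text \<open>The second factor of \<open>u\<close> is the one that gets contracted with
  \<open>v\<close>; it is brought to the end, where it can be bent.\<close>

definition "u_swapped = (wid C [b] \<boxtimes> wsymm C [b] [dual C b]) \<bullet> u"

definition "u_bent = (wid C [b, dual C b] \<boxtimes> weval C b) \<bullet> (u_swapped \<boxtimes> wid C [dual C b])"

text \<open>The incoming \<open>b\<close> crosses the first factor of \<open>v\<close> and is
  absorbed by the second.\<close>

definition "v_bent = (wid C [b] \<boxtimes> (weval C b \<boxtimes> wid C [dual C b])) \<bullet>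
  ((wsymm C [b] [b] \<boxtimes> wid C [dual C b, dual C b]) \<bullet> (wid C [b] \<boxtimes> v))"

definition "q_bent = (q \<boxtimes> wid C [b]) \<bullet> (wid C [b, dual C b] \<boxtimes> wcoev C b)"

lemma bent_sel [simp]:
  "wok u_swapped" "wsrc u_swapped = []" "wtgt u_swapped = [b, dual C b, b]"
  "wok u_bent" "wsrc u_bent = [dual C b]" "wtgt u_bent = [b, dual C b]"
  "wok v_bent" "wsrc v_bent = [b]" "wtgt v_bent = [b, dual C b]"
  "wok q_bent" "wsrc q_bent = [b, dual C b]" "wtgt q_bent = [b]"
  by (simp_all add: u_swapped_def u_bent_def v_bent_def q_bent_def)

lemma u_swapped_eq: "u_swapped = (u_bent \<boxtimes> wid C [b]) \<bullet> wcoev C b"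
  using bend_state[of u_swapped "[b, dual C b]" b] by (simp add: u_bent_def)

text \<open>After ungrouping, the evaluation contracts the second factor of \<open>u\<close> with
  the second factor of \<open>v\<close>; in bent form this composes \<open>v_bent\<close> with the
  last leg of \<open>u_swapped\<close>.\<close>

lemma trefoil_vector:
  "(wid C [b, b] \<boxtimes> (weval C b \<boxtimes> wid C [dual C b, dual C b])) \<bullet> (winv C (trefoil_grouping b) \<bullet> (u \<boxtimes> v))
   = (wid C [b] \<boxtimes> (wsymm C [dual C b] [b] \<boxtimes> wid C [dual C b])) \<bullet> ((u_bent \<boxtimes> v_bent) \<bullet> wcoev C b)"
proof -
  let ?b = "wid C [b]" and ?d = "wid C [dual C b]" and ?e = "weval C b"
  let ?s = "wsymm C [b] [b]" and ?t = "wsymm C [dual C b] [b]"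
  let ?g = "wsymm C [dual C b] [b, b, dual C b]"
  have u: "u = (?b \<boxtimes> ?t) \<bullet> u_swapped"
    by (simp add: u_swapped_def wtensor_wcomp_assoc)
  have uv: "u \<boxtimes> v = (?b \<boxtimes> (?t \<boxtimes> wid C [b, dual C b, dual C b])) \<bullet> (u_swapped \<boxtimes> v)"
    using wtensor_wcomp[of u_swapped "?b \<boxtimes> ?t" v "wid C [b, dual C b, dual C b]"] u by simp
  \<comment> \<open>The last factor of \<open>u\<close> crosses a block on which the swap and the
    evaluation act; by naturality it may cross afterwards, when one factor of the block is
    left.\<close>
  have "(?b \<boxtimes> (?e \<boxtimes> ?d)) \<bullet> ((?s \<boxtimes> wid C [dual C b, dual C b]) \<bullet>
        ((?b \<boxtimes> wsymm C [dual C b] [b, dual C b]) \<bullet> (?t \<boxtimes> wid C [b, dual C b])))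
      = (?b \<boxtimes> (?e \<boxtimes> ?d)) \<bullet> ((?s \<boxtimes> wid C [dual C b, dual C b]) \<bullet> ?g)"
    using wsymm_append_right[of "[dual C b]" "[b]" "[b, dual C b]"] by simp
  also have "\<dots> = (?b \<boxtimes> (?e \<boxtimes> ?d)) \<bullet> (?g \<bullet> (?d \<boxtimes> (?s \<boxtimes> ?d)))"
    using wsymm_natural[of ?d "?s \<boxtimes> ?d" "[dual C b]" "[b, b, dual C b]"] by simp
  also have "\<dots> = ?t \<bullet> ((wid C [dual C b, b] \<boxtimes> ?e) \<bullet> (?d \<boxtimes> (?s \<boxtimes> ?d)))"
    using wsymm_natural[of ?d "?b \<boxtimes> ?e" "[dual C b]" "[b]"] by (subst wcomp_reassoc[of _ _ "?t \<bullet> (wid C [dual C b, b] \<boxtimes> ?e)"]) simp_all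
  finally have Y: "(?b \<boxtimes> (?e \<boxtimes> ?d)) \<bullet> ((?s \<boxtimes> wid C [dual C b, dual C b]) \<bullet>
        ((?b \<boxtimes> wsymm C [dual C b] [b, dual C b]) \<bullet> (?t \<boxtimes> wid C [b, dual C b])))
      = ?t \<bullet> ((wid C [dual C b, b] \<boxtimes> ?e) \<bullet> (?d \<boxtimes> (?s \<boxtimes> ?d)))" .
  have "(wid C [b, b] \<boxtimes> (?e \<boxtimes> wid C [dual C b, dual C b])) \<bullet> (winv C (trefoil_grouping b) \<bullet> (u \<boxtimes> v))
    = (?b \<boxtimes> (((?b \<boxtimes> (?e \<boxtimes> ?d)) \<bullet> ((?s \<boxtimes> wid C [dual C b, dual C b]) \<bullet>
        ((?b \<boxtimes> wsymm C [dual C b] [b, dual C b]) \<bullet> (?t \<boxtimes> wid C [b, dual C b])))) \<boxtimes> ?d)) \<bullet> (u_swapped \<boxtimes> v)"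
    by (simp add: winv_trefoil_grouping uv whisker)
  also have "\<dots> = (?b \<boxtimes> (?t \<boxtimes> ?d)) \<bullet> ((wid C [b, dual C b, b] \<boxtimes> (?e \<boxtimes> ?d)) \<bullet>
      ((wid C [b, dual C b] \<boxtimes> (?s \<boxtimes> wid C [dual C b, dual C b])) \<bullet> (u_swapped \<boxtimes> v)))"
    unfolding Y by (simp add: whisker)
  also have "u_swapped \<boxtimes> v = (wid C [b, dual C b, b] \<boxtimes> v) \<bullet> u_swapped"
    using interchange(2)[of u_swapped v "[]" "[b, dual C b, b]" "[]"] by simp
  also have "(?b \<boxtimes> (?t \<boxtimes> ?d)) \<bullet> ((wid C [b, dual C b, b] \<boxtimes> (?e \<boxtimes> ?d)) \<bullet>
      ((wid C [b, dual C b] \<boxtimes> (?s \<boxtimes> wid C [dual C b, dual C b])) \<bullet> ((wid C [b, dual C b, b] \<boxtimes> v) \<bullet> u_swapped)))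
    = (?b \<boxtimes> (?t \<boxtimes> ?d)) \<bullet> ((wid C [b, dual C b] \<boxtimes> v_bent) \<bullet> u_swapped)"
    by (simp add: v_bent_def whisker)
  also have "(wid C [b, dual C b] \<boxtimes> v_bent) \<bullet> u_swapped = (u_bent \<boxtimes> v_bent) \<bullet> wcoev C b"
    unfolding u_swapped_eq
    by (subst wcomp_reassoc[OF interchange(2)[of u_bent v_bent]]) simp_all
  finally show ?thesis .
qed

text \<open>Among three consecutive inverse letters the inner creations and absorptions cancel by
  zig-zags: the strand is absorbed by the first and reappears after the last.\<close>

lemma open_trefoil:
  "open_relator C b [(i, 1), (j, 1), (i', 1), (j', -1), (i'', -1), (j'', -1)]
   = (wid C [b, b, b, dual C b, dual C b] \<boxtimes> wcoev C b) \<bullet> (wid C [b, b, b] \<boxtimes> (weval C b \<boxtimes> wid C [dual C b, dual C b]))"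
proof -
  let ?d = "wid C [dual C b]" and ?P = "pass C b (- 1)"
  have "open_relator C b [(i, 1), (j, 1), (i', 1), (j', -1), (i'', -1), (j'', -1)]
    = wid C [b, b, b] \<boxtimes> ((?d \<boxtimes> (?d \<boxtimes> ?P)) \<bullet> (((?d \<boxtimes> ?P) \<bullet> (?P \<boxtimes> ?d)) \<boxtimes> ?d))"
    by (simp add: pass_simps(1) whisker)
  also have "(?d \<boxtimes> (?d \<boxtimes> ?P)) \<bullet> (((?d \<boxtimes> ?P) \<bullet> (?P \<boxtimes> ?d)) \<boxtimes> ?d)
    = (?d \<boxtimes> ((?d \<boxtimes> wcoev C b) \<bullet> ((?d \<boxtimes> weval C b) \<bullet> (wcoev C b \<boxtimes> ?d)))) \<bullet> (weval C b \<boxtimes> wid C [dual C b, dual C b])"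
    unfolding pass_inverse_twice by (simp add: pass_simps whisker)
  finally show ?thesis
    unfolding wzigzag_dual by (simp add: whisker)
qed

text \<open>The factor \<open>q_bent \<bullet> u_bent\<close> goes from \<open>b*\<close> to \<open>b\<close>, so only self-dual \<open>b\<close> contribute.\<close>

lemma strand_trefoil:
  "strand [(i, 1), (j, 1), (i', 1), (j', -1), (i'', -1), (j'', -1)] b
     ((p \<boxtimes> q) \<bullet> trefoil_grouping b) (winv C (trefoil_grouping b) \<bullet> (u \<boxtimes> v))
   = ((p \<bullet> (wid C [b] \<boxtimes> v_bent)) \<boxtimes> (q_bent \<bullet> u_bent)) \<bullet> (wid C [b] \<boxtimes> wcoev C (dual C b))"
proof -
  let ?b = "wid C [b]" and ?d = "wid C [dual C b]" and ?e = "weval C b" and ?n = "wcoev C b"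
  let ?s = "wsymm C [b] [b]" and ?t = "wsymm C [dual C b] [b]" and ?r = "wsymm C [b, dual C b] [dual C b]"
  let ?D = "(p \<boxtimes> q) \<bullet> trefoil_grouping b" and ?E = "winv C (trefoil_grouping b) \<bullet> (u \<boxtimes> v)"
  \<comment> \<open>The grouping leaves the first and the last factor alone; \<open>k\<close> is its
    action on the four in between.\<close>
  define k where "k = (?b \<boxtimes> ?r) \<bullet> (?s \<boxtimes> wid C [dual C b, dual C b])"
  have [simp]: "wok k" "wsrc k = [b, b, dual C b, dual C b]" "wtgt k = [b, dual C b, b, dual C b]"
    by (simp_all add: k_def)
  have k: "trefoil_grouping b = ?b \<boxtimes> (k \<boxtimes> ?d)"
    by (simp add: trefoil_grouping_def k_def whisker)
  have "(?D \<boxtimes> ?b) \<bullet> (wid C [b, b, b, dual C b, dual C b] \<boxtimes> ?n)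
    = (p \<boxtimes> (q \<boxtimes> ?b)) \<bullet> (?b \<boxtimes> ((k \<boxtimes> wid C [dual C b, b]) \<bullet> (wid C [b, b, dual C b, dual C b] \<boxtimes> ?n)))"
    by (simp add: k whisker)
  also have "(k \<boxtimes> wid C [dual C b, b]) \<bullet> (wid C [b, b, dual C b, dual C b] \<boxtimes> ?n) = (wid C [b, dual C b, b, dual C b] \<boxtimes> ?n) \<bullet> k"
    using interchange[of k ?n "[b, b, dual C b, dual C b]" "[b, dual C b, b, dual C b]" "[]" "[dual C b, b]"] by simp
  also have "(p \<boxtimes> (q \<boxtimes> ?b)) \<bullet> (?b \<boxtimes> ((wid C [b, dual C b, b, dual C b] \<boxtimes> ?n) \<bullet> k))
    = ((p \<boxtimes> (q \<boxtimes> ?b)) \<bullet> (wid C [b, b, dual C b] \<boxtimes> (wid C [b, dual C b] \<boxtimes> ?n))) \<bullet> (?b \<boxtimes> k)"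
    by (simp add: whisker)
  also have "(p \<boxtimes> (q \<boxtimes> ?b)) \<bullet> (wid C [b, b, dual C b] \<boxtimes> (wid C [b, dual C b] \<boxtimes> ?n)) = p \<boxtimes> q_bent"
    by (subst wtensor_wcomp) (simp_all add: q_bent_def)
  finally have D: "(?D \<boxtimes> ?b) \<bullet> (wid C [b, b, b, dual C b, dual C b] \<boxtimes> ?n) = (p \<boxtimes> q_bent) \<bullet> (?b \<boxtimes> k)" .
  \<comment> \<open>\<open>k\<close> and the crossing left by \<open>trefoil_vector\<close> combine
    to the crossing of two pairs, which by naturality exchanges \<open>u_bent\<close> and
    \<open>v_bent\<close>.\<close>
  have "k \<bullet> (?b \<boxtimes> (?t \<boxtimes> ?d)) = (?b \<boxtimes> ?r) \<bullet> (((?s \<boxtimes> ?d) \<bullet> (?b \<boxtimes> ?t)) \<boxtimes> ?d)"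
    by (simp add: k_def whisker)
  also have "(?s \<boxtimes> ?d) \<bullet> (?b \<boxtimes> ?t) = wsymm C [b, dual C b] [b]"
    using wsymm_append_left[of "[b]" "[dual C b]" "[b]"] by simp
  also have "(?b \<boxtimes> ?r) \<bullet> (wsymm C [b, dual C b] [b] \<boxtimes> ?d) = wsymm C [b, dual C b] [b, dual C b]"
    using wsymm_append_right[of "[b, dual C b]" "[b]" "[dual C b]"] by simp
  finally have "k \<bullet> ((?b \<boxtimes> (?t \<boxtimes> ?d)) \<bullet> ((u_bent \<boxtimes> v_bent) \<bullet> ?n))
    = wsymm C [b, dual C b] [b, dual C b] \<bullet> ((u_bent \<boxtimes> v_bent) \<bullet> ?n)"
    by (rule wcomp_reassoc) simp_all
  also have "\<dots> = (v_bent \<boxtimes> u_bent) \<bullet> (?t \<bullet> ?n)"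
    by (subst wcomp_reassoc[OF wsymm_natural]) simp_all
  finally have K: "k \<bullet> ((?b \<boxtimes> (?t \<boxtimes> ?d)) \<bullet> ((u_bent \<boxtimes> v_bent) \<bullet> ?n)) = (v_bent \<boxtimes> u_bent) \<bullet> wcoev C (dual C b)"
    by (simp add: wsymm_wcoev)
  have "strand [(i, 1), (j, 1), (i', 1), (j', -1), (i'', -1), (j'', -1)] b ?D ?E
    = ((?D \<boxtimes> ?b) \<bullet> (wid C [b, b, b, dual C b, dual C b] \<boxtimes> ?n)) \<bullet>
      (?b \<boxtimes> ((wid C [b, b] \<boxtimes> (?e \<boxtimes> wid C [dual C b, dual C b])) \<bullet> ?E))"
    unfolding strand_def open_trefoil by (simp add: whisker)
  also have "\<dots> = (p \<boxtimes> q_bent) \<bullet> (?b \<boxtimes> (k \<bullet> ((?b \<boxtimes> (?t \<boxtimes> ?d)) \<bullet> ((u_bent \<boxtimes> v_bent) \<bullet> ?n))))"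
    unfolding D trefoil_vector by (simp add: whisker)
  also have "\<dots> = ((p \<boxtimes> q_bent) \<bullet> ((?b \<boxtimes> v_bent) \<boxtimes> u_bent)) \<bullet> (?b \<boxtimes> wcoev C (dual C b))"
    unfolding K by (simp add: whisker)
  also have "(p \<boxtimes> q_bent) \<bullet> ((?b \<boxtimes> v_bent) \<boxtimes> u_bent) = (p \<bullet> (?b \<boxtimes> v_bent)) \<boxtimes> (q_bent \<bullet> u_bent)"
    by (subst wtensor_wcomp) simp_all
  finally show ?thesis .
qed

text \<open>The strand is the product of two Schur scalars. Closing each of them to a loop, to read
  it as a matrix coefficient, takes one factor r(b); this uses up both factors of the closed strand,
  so no rank is left in the trefoil formula.\<close>

lemma strand_trefoil_self_dual:
  assumes b: "b \<in> S" and sd: "dual C b = b"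
  shows "\<exists>t. strand [(i, 1), (j, 1), (i', 1), (j', -1), (i'', -1), (j'', -1)] b
     ((p \<boxtimes> q) \<bullet> trefoil_grouping b) (winv C (trefoil_grouping b) \<bullet> (u \<boxtimes> v)) = wscal C t (wid C [b]) \<and>
     rank C b * rank C b * t
      = sval (p \<bullet> ((wsymm C [b] [b] \<boxtimes> wid C [b]) \<bullet> v)) * sval (q \<bullet> ((wid C [b] \<boxtimes> wsymm C [b] [b]) \<bullet> u))"
proof -
  let ?b = "wid C [b]" and ?e = "weval C b" and ?n = "wcoev C b" and ?s = "wsymm C [b] [b]"
  have loop: "?e \<bullet> ?n = wscal C (rank C b) (wid C [])"
    using weval_wcoev[of b] by (simp add: sd)
  obtain t where t: "q_bent \<bullet> u_bent = wscal C t ?b"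
    using schur[OF b, of "q_bent \<bullet> u_bent"] by (auto simp: sd)
  obtain t' where t': "p \<bullet> (?b \<boxtimes> v_bent) = wscal C t' ?e"
    using costate_pair[OF b b, of "p \<bullet> (?b \<boxtimes> v_bent)"] by (auto simp: sd)
  have "q = ?e \<bullet> (q_bent \<boxtimes> ?b)"
    using bend_costate[of q "[b, b]" b] by (simp add: q_bent_def sd)
  then have "q \<bullet> u_swapped = (?e \<bullet> (q_bent \<boxtimes> ?b)) \<bullet> ((u_bent \<boxtimes> ?b) \<bullet> ?n)"
    by (rule arg_cong2[OF _ u_swapped_eq, of _ _ "wcomp C"])
  also have "\<dots> = ?e \<bullet> (((q_bent \<bullet> u_bent) \<boxtimes> ?b) \<bullet> ?n)"
    by (simp add: whisker sd)
  also have "\<dots> = wscal C (t * rank C b) (wid C [])"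
    by (simp add: t loop sd)
  finally have q_u: "sval (q \<bullet> ((?b \<boxtimes> ?s) \<bullet> u)) = t * rank C b"
    by (simp add: u_swapped_def sd del: wcomp_sel(3))
  \<comment> \<open>Closed by a coevaluation, \<open>v_bent\<close> straightens to \<open>v\<close>
    with its first two factors exchanged, so the second scalar is a coefficient of (1,2).\<close>
  have "(?b \<boxtimes> v_bent) \<bullet> ?n = (wid C [b, b] \<boxtimes> (?e \<boxtimes> ?b)) \<bullet> ((?b \<boxtimes> (?s \<boxtimes> wid C [b, b])) \<bullet> ((wid C [b, b] \<boxtimes> v) \<bullet> ?n))"
    by (simp add: v_bent_def whisker sd)
  also have "(wid C [b, b] \<boxtimes> v) \<bullet> ?n = (?n \<boxtimes> wid C [b, b, b]) \<bullet> v"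
    using interchange[of ?n v "[]" "[b, b]" "[]" "[b, b, b]"] by (simp add: sd)
  also have "(?b \<boxtimes> (?s \<boxtimes> wid C [b, b])) \<bullet> ((?n \<boxtimes> wid C [b, b, b]) \<bullet> v) = (((?b \<boxtimes> ?s) \<bullet> (?n \<boxtimes> ?b)) \<boxtimes> wid C [b, b]) \<bullet> v"
    by (simp add: whisker sd)
  also have "(?b \<boxtimes> ?s) \<bullet> (?n \<boxtimes> ?b) = (?s \<boxtimes> ?b) \<bullet> (?b \<boxtimes> ?n)"
    using slide_coev[of ?n "[b]" "[b]" "[b]"] by (simp add: sd)
  also have "(wid C [b, b] \<boxtimes> (?e \<boxtimes> ?b)) \<bullet> ((((?s \<boxtimes> ?b) \<bullet> (?b \<boxtimes> ?n)) \<boxtimes> wid C [b, b]) \<bullet> v)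
    = (((wid C [b, b] \<boxtimes> (?e \<boxtimes> ?b)) \<bullet> (?s \<boxtimes> wid C [b, b, b])) \<bullet> (?b \<boxtimes> (?n \<boxtimes> wid C [b, b]))) \<bullet> v"
    by (simp add: whisker sd)
  also have "(wid C [b, b] \<boxtimes> (?e \<boxtimes> ?b)) \<bullet> (?s \<boxtimes> wid C [b, b, b]) = (?s \<boxtimes> ?b) \<bullet> (wid C [b, b] \<boxtimes> (?e \<boxtimes> ?b))"
    using interchange[of ?s "?e \<boxtimes> ?b" "[b, b]" "[b, b]" "[b, b, b]" "[b]"] by (simp add: sd)
  also have "((?s \<boxtimes> ?b) \<bullet> (wid C [b, b] \<boxtimes> (?e \<boxtimes> ?b))) \<bullet> (?b \<boxtimes> (?n \<boxtimes> wid C [b, b])) \<bullet> v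
    = (?s \<boxtimes> ?b) \<bullet> ((?b \<boxtimes> (((?b \<boxtimes> ?e) \<bullet> (?n \<boxtimes> ?b)) \<boxtimes> ?b)) \<bullet> v)"
    by (simp add: whisker sd)
  also have "\<dots> = (?s \<boxtimes> ?b) \<bullet> v"
    using wzigzag_dual[of b] by (simp add: sd)
  finally have "p \<bullet> ((?s \<boxtimes> ?b) \<bullet> v) = p \<bullet> ((?b \<boxtimes> v_bent) \<bullet> ?n)"
    by simp
  also have "\<dots> = (p \<bullet> (?b \<boxtimes> v_bent)) \<bullet> ?n"
    by (simp add: sd)
  finally have p_v: "sval (p \<bullet> ((?s \<boxtimes> ?b) \<bullet> v)) = t' * rank C b"
    by (simp add: t' loop sd del: wcomp_sel(3))
  have "strand [(i, 1), (j, 1), (i', 1), (j', -1), (i'', -1), (j'', -1)] b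
     ((p \<boxtimes> q) \<bullet> trefoil_grouping b) (winv C (trefoil_grouping b) \<bullet> (u \<boxtimes> v)) = wscal C (t * t') ?b"
    using wzigzag[of b] by (simp add: strand_trefoil t t' sd mult.commute)
  then show ?thesis
    unfolding q_u p_v by (intro exI[of _ "t * t'"]) simp
qed

lemma strand_trefoil_not_self_dual:
  assumes b: "b \<in> S" and nsd: "dual C b \<noteq> b"
  shows "strand [(i, 1), (j, 1), (i', 1), (j', -1), (i'', -1), (j'', -1)] b
     ((p \<boxtimes> q) \<bullet> trefoil_grouping b) (winv C (trefoil_grouping b) \<bullet> (u \<boxtimes> v)) = wscal C 0 (wid C [b])"
proof -
  have h: "q_bent \<bullet> u_bent = wscal C 0 (q_bent \<bullet> u_bent)"
    by (rule schur_distinct[OF dual_in[OF b] b nsd]) simp_all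
  have "((p \<bullet> (wid C [b] \<boxtimes> v_bent)) \<boxtimes> (q_bent \<bullet> u_bent)) \<bullet> (wid C [b] \<boxtimes> wcoev C (dual C b))
    = ((p \<bullet> (wid C [b] \<boxtimes> v_bent)) \<boxtimes> wscal C 0 (q_bent \<bullet> u_bent)) \<bullet> (wid C [b] \<boxtimes> wcoev C (dual C b))"
    by (rule arg_cong[OF h, of "\<lambda>x. ((p \<bullet> (wid C [b] \<boxtimes> v_bent)) \<boxtimes> x) \<bullet> (wid C [b] \<boxtimes> wcoev C (dual C b))"])
  also have "\<dots> = wscal C 0 (((p \<bullet> (wid C [b] \<boxtimes> v_bent)) \<boxtimes> (q_bent \<bullet> u_bent)) \<bullet> (wid C [b] \<boxtimes> wcoev C (dual C b)))"
    by simp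
  also have "\<dots> = wscal C 0 (wid C [b])"
    by (rule wmor_eqI) simp_all
  finally show ?thesis
    unfolding strand_trefoil .
qed

end

theorem Q_trefoil:
  "Q C S 2 [(1, 1), (2, 1), (1, 1), (2, -1), (1, -1), (2, -1)] =
    (\<Sum>b\<in>{b\<in>S. b = dual C b}. trace_on (scal C) (Hom C \<one> (oprod C (replicate 3 b)))
       (perm_rep C b 3 (cycle_of_list [1, 2, 3])))"
proof -
  define R :: "(nat \<times> int) list" where "R = [(1, 1), (2, 1), (1, 1), (2, -1), (1, -1), (2, -1)]"
  have R [simp]: "exponents_nonzero R" "relator_word C b R = [b, b, b, dual C b, dual C b, dual C b]" for b
    by (simp_all add: R_def)
  have "sval (full_trace C (map (\<lambda>k. group_word C k R b) [1..<2 + 1])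
      (grouping C 2 R b \<bullet> closed_relator C b R \<bullet> winv C (grouping C 2 R b))) =
    (if b = dual C b then trace_on (scal C) (Hom C \<one> (oprod C (replicate 3 b)))
       (perm_rep C b 3 (cycle_of_list [1, 2, 3])) else 0)"
    (is "sval (full_trace C ?Gs ?\<phi>) = _") if b: "b \<in> S" for b
  proof -
    have groups: "?Gs = [[b, b, dual C b], [b, dual C b, dual C b]]"
      by (simp add: group_word_def blocks_def upt_rec R_def)
    have grouping: "grouping C 2 R b = trefoil_grouping b"
      by (simp add: grouping_def blocks_def upt_rec R_def trefoil_grouping_def whisker numeral_eq_Suc)
    have sandwich: "sval ((p \<boxtimes> q) \<bullet> (?\<phi> \<bullet> (u \<boxtimes> v))) = rank C b * rank C b * t"
      if "strand R b ((p \<boxtimes> q) \<bullet> trefoil_grouping b) (winv C (trefoil_grouping b) \<bullet> (u \<boxtimes> v)) = wscal C t (wid C [b])"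
        and [simp]: "wok p" "wsrc p = [b, b, dual C b]" "wtgt p = []" "wok q" "wsrc q = [b, dual C b, dual C b]" "wtgt q = []"
         "wok u" "wsrc u = []" "wtgt u = [b, b, dual C b]" "wok v" "wsrc v = []" "wtgt v = [b, dual C b, dual C b]"
      for p q u v t
    proof -
      have "(p \<boxtimes> q) \<bullet> (?\<phi> \<bullet> (u \<boxtimes> v)) = ((p \<boxtimes> q) \<bullet> trefoil_grouping b) \<bullet> (closed_relator C b R \<bullet> (winv C (trefoil_grouping b) \<bullet> (u \<boxtimes> v)))"
        by (simp add: grouping)
      then show ?thesis
        using closed_relator_sandwich[OF _ _ _ _ _ _ _ that(1)] by (simp del: wcomp_sel(3))
    qed
    obtain E d where db: "dual_bases C \<one> (oprod C [b, b, dual C b]) E d"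
      using exists_dual_bases[OF uno_in] by blast
    show ?thesis
    proof (cases "b = dual C b")
      case True
      then have sd: "dual C b = b"
        by simp
      let ?s = "wsymm C [b] [b]" and ?b = "wid C [b]"
      let ?u = "\<lambda>e. WMor [] [b, b, b] e" and ?p = "\<lambda>e. WMor [b, b, b] [] (d e)"
      \<comment> \<open>For self-dual \<open>b\<close> both groups are \<open>[b, b, b]\<close>, so
        one pair of dual bases serves both generators and the sum over \<open>f\<close> can be
        contracted.\<close>
      note db = db[unfolded sd]
      note [simp] = wok_basis[OF db] wok_dual_basis[OF db]
      have "sval (full_trace C [[b, b, b], [b, b, b]] ?\<phi>)
          = (\<Sum>e\<in>E. \<Sum>f\<in>E. sval ((?p e \<boxtimes> ?p f) \<bullet> (?\<phi> \<bullet> (?u e \<boxtimes> ?u f))))"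
        by (rule sval_full_trace_two[OF db db]) (simp_all add: grouping sd)
      also have "\<dots> = (\<Sum>e\<in>E. \<Sum>f\<in>E. sval ((?p e \<bullet> (?s \<boxtimes> ?b)) \<bullet> ?u f) * sval (?p f \<bullet> ((?b \<boxtimes> ?s) \<bullet> ?u e)))"
      proof (intro sum.cong refl)
        fix e f assume [simp]: "e \<in> E" "f \<in> E"
        obtain t where t: "strand R b ((?p e \<boxtimes> ?p f) \<bullet> trefoil_grouping b) (winv C (trefoil_grouping b) \<bullet> (?u e \<boxtimes> ?u f)) = wscal C t ?b"
          "rank C b * rank C b * t = sval (?p e \<bullet> ((?s \<boxtimes> ?b) \<bullet> ?u f)) * sval (?p f \<bullet> ((?b \<boxtimes> ?s) \<bullet> ?u e))"
          using strand_trefoil_self_dual[of "?p e" b "?p f" "?u e" "?u f" 1 2 1 2 1 2] b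
          unfolding R_def[symmetric] by (auto simp: sd simp del: wcomp_sel(3))
        show "sval ((?p e \<boxtimes> ?p f) \<bullet> (?\<phi> \<bullet> (?u e \<boxtimes> ?u f)))
            = sval ((?p e \<bullet> (?s \<boxtimes> ?b)) \<bullet> ?u f) * sval (?p f \<bullet> ((?b \<boxtimes> ?s) \<bullet> ?u e))"
          using sandwich[OF t(1)] t(2) by (simp add: sd del: wcomp_sel(3))
      qed
      also have "\<dots> = (\<Sum>e\<in>E. sval ((?p e \<bullet> (?s \<boxtimes> ?b)) \<bullet> ((?b \<boxtimes> ?s) \<bullet> ?u e)))"
      proof (rule sum.cong)
        fix e assume [simp]: "e \<in> E"
        have "wok ((?b \<boxtimes> ?s) \<bullet> ?u e)" "wok (?p e \<bullet> (?s \<boxtimes> ?b))"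
          by simp_all
        then have "wmor ((?b \<boxtimes> ?s) \<bullet> ?u e) \<in> Hom C \<one> (oprod C [b, b, b])"
          "wmor (?p e \<bullet> (?s \<boxtimes> ?b)) \<in> Hom C (oprod C [b, b, b]) \<one>"
          unfolding wok_def by (simp_all del: wcomp_sel(3))
        from scalar_of_basis_expansion[OF db this]
        show "(\<Sum>f\<in>E. sval ((?p e \<bullet> (?s \<boxtimes> ?b)) \<bullet> ?u f) * sval (?p f \<bullet> ((?b \<boxtimes> ?s) \<bullet> ?u e)))
          = sval ((?p e \<bullet> (?s \<boxtimes> ?b)) \<bullet> ((?b \<boxtimes> ?s) \<bullet> ?u e))"
          unfolding wcomp_sel(3)[of "?p e \<bullet> (?s \<boxtimes> ?b)"] wcomp_sel(3)[of "?p f" for f] by simp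
      qed simp
      \<comment> \<open>The product of the two transpositions moves the last factor to the front, as
        the cycle does.\<close>
      also have "\<dots> = trace_on (scal C) (Hom C \<one> (oprod C [b, b, b])) (\<lambda>u. wmor (wsymm C [b, b] [b]) \<cdot> u)"
        using wsymm_append_left[of "[b]" "[b]" "[b]"]
        by (subst trace_on_wmor[OF db]) (simp_all del: wcomp_sel(3) cong: sum.cong)
      also have "(\<lambda>u. wmor (wsymm C [b, b] [b]) \<cdot> u) = perm_rep C b 3 (cycle_of_list [1, 2, 3])"
        using perm_rep_cycle[of 3 b] by (simp add: numeral_eq_Suc upt_rec)
      finally show ?thesis
        unfolding groups using True by (simp add: sd numeral_eq_Suc)
    next
      case False
      obtain E' d' where db': "dual_bases C \<one> (oprod C [b, dual C b, dual C b]) E' d'"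
        using exists_dual_bases[OF uno_in] by blast
      note [simp] = wok_basis[OF db] wok_dual_basis[OF db] wok_basis[OF db'] wok_dual_basis[OF db']
      have "sval (full_trace C [[b, b, dual C b], [b, dual C b, dual C b]] ?\<phi>) = (\<Sum>e\<in>E. \<Sum>f\<in>E'.
         sval ((WMor [b, b, dual C b] [] (d e) \<boxtimes> WMor [b, dual C b, dual C b] [] (d' f)) \<bullet>
           (?\<phi> \<bullet> (WMor [] [b, b, dual C b] e \<boxtimes> WMor [] [b, dual C b, dual C b] f))))"
        by (rule sval_full_trace_two[OF db db']) (simp_all add: grouping)
      also have "\<dots> = (\<Sum>e\<in>E. \<Sum>f\<in>E'. rank C b * rank C b * 0)"
      proof (intro sum.cong refl sandwich)
        fix e f assume "e \<in> E" "f \<in> E'"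
        then show "strand R b ((WMor [b, b, dual C b] [] (d e) \<boxtimes> WMor [b, dual C b, dual C b] [] (d' f)) \<bullet> trefoil_grouping b)
          (winv C (trefoil_grouping b) \<bullet> (WMor [] [b, b, dual C b] e \<boxtimes> WMor [] [b, dual C b, dual C b] f)) = wscal C 0 (wid C [b])"
          unfolding R_def using False by (intro strand_trefoil_not_self_dual b) auto
      qed simp_all
      finally show ?thesis
        unfolding groups using False by simp
    qed
  qed
  then have "Q C S 2 R = (\<Sum>b\<in>S. if b = dual C b then trace_on (scal C) (Hom C \<one> (oprod C (replicate 3 b)))
       (perm_rep C b 3 (cycle_of_list [1, 2, 3])) else 0)"
    unfolding Q_def by (rule sum.cong[OF refl])
  then show ?thesis
    by (simp add: sum_self_dual R_def)
qed

end

theorem mainTheorem3: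
  fixes C :: "('o, 'm::ab_group_add, 'k::field) tensor_category"
    and S :: "'o set"
  assumes "semisimple_stable_autonomous_category C S"
  shows "(\<forall>k\<ge>1. Q C S 1 [(1, int k)] =
            (\<Sum>b\<in>S. rank C b * trace_on (scal C) (Hom C (uno C) (oprod C (replicate k b)))
                               (perm_rep C b k (cycle_of_list [1..<k + 1]))))
      \<and> Q C S 1 [(1, 2)] = (\<Sum>b\<in>{b\<in>S. b = dual C b}. rank C b)
      \<and> (\<forall>n\<ge>1. Q C S (2 * n)
              (concat (map (\<lambda>j. [(2*j - 1, 1), (2*j, 1), (2*j - 1, -1), (2*j, -1)]) [1..<n + 1])) =
            (\<Sum>b\<in>S. rank C b powi (- 2 * (int n - 1))))
      \<and> Q C S 2 [(1, 1), (2, 1), (1, 1), (2, -1), (1, -1), (2, -1)] =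
            (\<Sum>b\<in>{b\<in>S. b = dual C b}.
               trace_on (scal C) (Hom C (uno C) (oprod C (replicate 3 b)))
                 (perm_rep C b 3 (cycle_of_list [1, 2, 3])))
      \<and> Q C S 2 [(1, 1), (2, 1), (1, -1), (2, 1)] = of_nat (card {b\<in>S. b = dual C b})"
proof -
  interpret semisimple_stable_autonomous_category C S
    by (rule assms)
  show ?thesis
    by (intro conjI allI impI Q_power Q_square Q_surface[unfolded surface_relator_def] Q_trefoil Q_klein_bottle; assumption)
qed

end
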